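(* Let $n$ be a $2$-wide positive integer and let $q=P^{+}(n)$ be the largest prime dividing $n$. Then $\mathsf{K}_1(C_n)=\mathsf{K}_1^{*}(C_n)$ and $\mathsf{K}_1(C_n\oplus C_q)=\mathsf{K}_1^{*}(C_n\oplus C_q)$.
   Context: Groups are finite abelian, written additively; $C_m$ is the cyclic group of order $m$; $\mathbb{N}=\mathbb{Z}_{\ge 0}$; $G^{\bullet}=G\setminus\{0\}$. An indexed sequence over $G$ is an element of the free abelian monoid (written multiplicatively, identity $1$) on $G^{\bullet}\times\mathbb{N}$; all indexed sequences are assumed squarefree, i.e. every pair $(g,n)$ occurs with multiplicity at most one, so an indexed sequence is a finite set of labelled nonzero elements of $G$ (the same $g$ may occur with several labels). For an indexed sequence $S$, $\overline{v}_g(S)$ is the number of terms of $S$ with first coordinate $g$, and $\overline{\sigma}(S)=\sum_{g\in G^\bullet}\overline{v}_g(S)\,g\in G$. A subsequence of $S$ is a divisor of $S$ in the monoid. $S$ is zero-sum if $\overline{\sigma}(S)=0$, and irreducible if $S\ne 1$, $S$ is zero-sum, and $S$ has no nontrivial proper zero-sum subsequence. An irreducible factorization of a zero-sum indexed sequence $S$ is a way of writing $S=\prod_{i\le m}S_i$ with all $S_i$ irreducible, up to the order of the factors. $S$ is a unique factorization indexed sequence (UFIS) if it is zero-sum and has exactly one irreducible factorization. The cross number of $S$ is $\mathsf{k}(S)=\sum_{g\in G^\bullet}\overline{v}_g(S)/\mathrm{ord}(g)$, and $$\mathsf{K}_1(G)=\max\{\mathsf{k}(S): S \text{ a UFIS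 over } G\}.$$ Writing $G\cong\bigoplus_{i=1}^{r}C_{p_i^{\alpha_i}}$ as a direct sum of cyclic groups of prime power order ($p_i$ not necessarily distinct), define $$\mathsf{K}_1^{*}(G)=\sum_{i=1}^{r}\frac{p_i^{\alpha_i}-1}{p_i^{\alpha_i}-p_i^{\alpha_i-1}}.$$ A prime $p$ is $2$-wide with respect to a positive integer $n$, written $p\prec_2 n$, if $p\nmid n$ and, with prime factorization $n=q_1^{\alpha_1}\cdots q_r^{\alpha_r}$, $$\frac{p^{2}+2p-2}{p^{2}}\ge\prod_{j=1}^{r}\frac{q_j^{\alpha_j+1}-1}{q_j^{\alpha_j+1}-q_j^{\alpha_j}},$$ the empty product being $1$. A positive integer $n=q_1^{\alpha_1}\cdots q_r^{\alpha_r}$ with primes $q_1<\cdots<q_r$ is $2$-wide if $q_i\prec_2\prod_{j=i+1}^{r}q_j^{\alpha_j}$ for each $i$ with $1\le i\le r-1$. *)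

theory Defs
  imports
    Complex_Main
    "HOL-Library.Multiset"
    "HOL-Computational_Algebra.Primes"
    "HOL-Algebra.FiniteProduct"
    "HOL-Algebra.Multiplicative_Group"
    "HOL-Algebra.Product_Groups"
begin

text \<open>
  Groups are those of HOL-Algebra, hence written multiplicatively: \<open>\<one>\<^bsub>G\<^esub>\<close> is the zero element
  of the additive notation and \<open>g [^]\<^bsub>G\<^esub> n\<close> is the multiple \<open>ng\<close>. The definitions are meant for
  finite abelian groups \<open>G\<close>. The cyclic group of order \<open>n > 0\<close> is \<^term>\<open>integer_mod_group n\<close>.
\<close>

section \<open>Indexed sequences\<close>

text \<open>
  Elements of the free abelian monoid on a set are finite multisets over it: the product is the
  multiset sum, the identity is \<open>{#}\<close>, and divisibility is \<open>\<subseteq>#\<close>. Squarefreeness is part of the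
  definition of an indexed sequence.
\<close>

definition indexed_seq :: "('a, 'b) monoid_scheme \<Rightarrow> ('a \<times> nat) multiset \<Rightarrow> bool" where
  "indexed_seq G S \<longleftrightarrow>
     set_mset S \<subseteq> (carrier G - {\<one>\<^bsub>G\<^esub>}) \<times> UNIV \<and> (\<forall>x. count S x \<le> 1)"

definition val :: "'a \<Rightarrow> ('a \<times> nat) multiset \<Rightarrow> nat" where
  "val g S = size {#x \<in># S. fst x = g#}"

definition seq_sum :: "('a, 'b) monoid_scheme \<Rightarrow> ('a \<times> nat) multiset \<Rightarrow> 'a" where
  "seq_sum G S = (\<Otimes>\<^bsub>G\<^esub>g\<in>carrier G - {\<one>\<^bsub>G\<^esub>}. g [^]\<^bsub>G\<^esub> val g S)"

definition zero_sum :: "('a, 'b) monoid_scheme \<Rightarrow> ('a \<times> nat) multiset \<Rightarrow> bool" where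
  "zero_sum G S \<longleftrightarrow> seq_sum G S = \<one>\<^bsub>G\<^esub>"

definition irreducible_seq :: "('a, 'b) monoid_scheme \<Rightarrow> ('a \<times> nat) multiset \<Rightarrow> bool" where
  "irreducible_seq G S \<longleftrightarrow>
     indexed_seq G S \<and> S \<noteq> {#} \<and> zero_sum G S \<and>
     \<not> (\<exists>T. T \<subseteq># S \<and> T \<noteq> {#} \<and> T \<noteq> S \<and> zero_sum G T)"

text \<open>A factorization up to the order of its factors is the multiset of its factors.\<close>

definition irreducible_factorization ::
    "('a, 'b) monoid_scheme \<Rightarrow> ('a \<times> nat) multiset \<Rightarrow> ('a \<times> nat) multiset multiset \<Rightarrow> bool" where
  "irreducible_factorization G S F \<longleftrightarrow> (\<forall>T\<in>#F. irreducible_seq G T) \<and> \<Sum>\<^sub># F = S"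

definition UFIS :: "('a, 'b) monoid_scheme \<Rightarrow> ('a \<times> nat) multiset \<Rightarrow> bool" where
  "UFIS G S \<longleftrightarrow>
     indexed_seq G S \<and> zero_sum G S \<and> (\<exists>!F. irreducible_factorization G S F)"

section \<open>Cross numbers\<close>

definition cross_number :: "('a, 'b) monoid_scheme \<Rightarrow> ('a \<times> nat) multiset \<Rightarrow> real" where
  "cross_number G S = (\<Sum>g\<in>carrier G - {\<one>\<^bsub>G\<^esub>}. real (val g S) / real (group.ord G g))"

text \<open>
  The maximum is \<open>GREATEST\<close> rather than \<^const>\<open>Max\<close>, as a nontrivial group has infinitely many UFISs
  (there are infinitely many labels) and the finiteness of the set of their cross numbers is not
  apparent from the definition.
\<close>

definition K1 :: "('a, 'b) monoid_scheme \<Rightarrow> real" where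
  "K1 G = (GREATEST x. \<exists>S. UFIS G S \<and> x = cross_number G S)"

definition prime_power_decomposition ::
    "('a, 'b) monoid_scheme \<Rightarrow> nat \<Rightarrow> (nat \<Rightarrow> nat) \<Rightarrow> (nat \<Rightarrow> nat) \<Rightarrow> bool" where
  "prime_power_decomposition G r p \<alpha> \<longleftrightarrow>
     (\<forall>i<r. prime (p i) \<and> \<alpha> i > 0) \<and>
     G \<cong> sum_group {..<r} (\<lambda>i. integer_mod_group (p i ^ \<alpha> i))"

text \<open>
  The value does not depend on the decomposition, as the prime powers \<open>p i ^ \<alpha> i\<close> are determined
  by the group up to their order.
\<close>

definition K1_star :: "('a, 'b) monoid_scheme \<Rightarrow> real" where
  "K1_star G = (THE x. \<exists>r p \<alpha>. prime_power_decomposition G r p \<alpha> \<and>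
     x = (\<Sum>i<r. (real (p i) ^ \<alpha> i - 1) / (real (p i) ^ \<alpha> i - real (p i) ^ (\<alpha> i - 1))))"

section \<open>2-wide integers\<close>

definition two_wide_wrt :: "nat \<Rightarrow> nat \<Rightarrow> bool"  (infix "\<prec>\<^sub>2" 50) where
  "p \<prec>\<^sub>2 n \<longleftrightarrow> prime p \<and> n > 0 \<and> \<not> p dvd n \<and>
     (real p ^ 2 + 2 * real p - 2) / real p ^ 2 \<ge>
     (\<Prod>q\<in>prime_factors n.
        (real q ^ (multiplicity q n + 1) - 1) /
        (real q ^ (multiplicity q n + 1) - real q ^ multiplicity q n))"

text \<open>The convention for \<open>n = 1\<close>, which has no prime factors, is \<open>P\<^sup>+(1) = 1\<close>.\<close>

definition largest_prime_factor :: "nat \<Rightarrow> nat" where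
  "largest_prime_factor n = (if n = 1 then 1 else Max (prime_factors n))"

text \<open>
  As in the original condition \<open>1 \<le> i \<le> r - 1\<close>, the largest prime factor itself is exempt.
\<close>

definition two_wide :: "nat \<Rightarrow> bool" where
  "two_wide n \<longleftrightarrow> n > 0 \<and>
     (\<forall>p\<in>prime_factors n. p < largest_prime_factor n \<longrightarrow>
        p \<prec>\<^sub>2 (\<Prod>q\<in>{q \<in> prime_factors n. p < q}. q ^ multiplicity q n))"

end

theory Submission
  imports
    Defs
    "HOL-Number_Theory.Residues"
    "HOL-Computational_Algebra.Polynomial_Factorial"
    "HOL-Library.Product_Plus"
begin

text \<open>
  A sequence has unique factorization iff its zero-sum subsets are closed under intersection. This
  property passes to subsequences, survives replacing some terms by their sum, and makes sense
  modulo a subgroup, so the terms can be treated one prime at a time.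

  Let \<open>p\<close> be the smallest prime of \<open>n\<close>. Terms of the same order divisible by \<open>p\<close> lie, modulo
  the elements whose order is smaller by a factor \<open>p\<close>, in a group of order \<open>p\<close>. Whenever some of them have
  a sum that loses a factor \<open>p\<close> of the order but is not zero, at most \<open>p\<close> of them can be
  contracted to this sum without lowering the cross number. If this is no longer possible, the terms of
  each order form a unique factorization sequence over a group of order \<open>p\<close>, so there are at
  most \<open>p\<close> of them, and deleting all of them costs slightly too much. The excess is absorbed by
  2-wideness if at most \<open>p - 2\<close> terms have order exactly \<open>p\<close>; if there are more, their
  subset sums cover the subgroup of order \<open>p\<close>, which can therefore be divided out.

  For the largest prime \<open>q\<close> the same contraction leaves the terms of order \<open>q\<close>, and one has to show
  that a unique factorization sequence over \<open>C\<^sub>q \<oplus> C\<^sub>q\<close> has at most \<open>2q\<close> terms. View the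
  terms as linear forms over the field with \<open>q\<close> elements. For \<open>2q - 2\<close> terms the number of
  zero-sum subsets, counted with signs, is up to a unit the coefficient of \<open>x ^ (q - 1) y ^ (q - 1)\<close> in
  the product of the forms. An argument with fully reducible lacunary polynomials shows that this
  coefficient is nonzero for some \<open>2q - 2\<close> of any \<open>2q - 1\<close> terms. If at least three terms remain
  outside, exchanging one of them with a term inside gives linear functionals that contradict each other.
\<close>

section \<open>Families with unique factorization\<close>

text \<open>For a prime power p^\<alpha> the summand of the formula is 1 + 1/p + ... +
  p^(1-\<alpha>), where p^(1-b) = p / p^b is the cross number of p terms of order p^b. Blocks of
  this shape give the lower bound, and the upper bound asks that no order p^b cost more. The trouble
  is that terms of order p^b d, with d > 1 dividing the part m of n made of larger primes, have to
  be deleted as well: at p terms per order the cost is the geometric sum times \<sigma>(m)/m. If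
  only p - 2 terms have the lowest order p^(s+1), the amount 2 / p^(s+1) is saved, and (p^2 + 2p -
  2) / p^2 = 1 + 2(p - 1) / p^2 is the value of \<sigma>(m)/m up to which this saving is sure to pay
  for the excess. The gap between p - 2 and p is harmless because p - 1 nonzero residues already
  have every residue modulo p as a subset sum. Group elements are represented by integer pairs, so
  that passing to a quotient changes only the subgroup \<open>H\<close>. The second summand C_q has
  order prime to every p < q, so those steps see a cyclic p-part and rank two occurs only for terms
  of order q.\<close>

text \<open>
  For a sequence without zero terms and the trivial subgroup \<open>H\<close>, this is unique factorization; the
  sequence itself need not be zero-sum.
\<close>

definition uf :: "'v::ab_group_add set \<Rightarrow> 'i set \<Rightarrow> ('i \<Rightarrow> 'v) \<Rightarrow> bool" where
  "uf H I f \<longleftrightarrow> (\<forall>X Y. X \<subseteq> I \<longrightarrow> Y \<subseteq> I \<longrightarrow> sum f X \<in> H \<longrightarrow> sum f Y \<in> H \<longrightarrow> sum f (X \<inter> Y) \<in> H)"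

definition add_subgroup :: "'v::ab_group_add set \<Rightarrow> bool" where
  "add_subgroup H \<longleftrightarrow> 0 \<in> H \<and> (\<forall>x\<in>H. \<forall>y\<in>H. x - y \<in> H)"

lemma add_subgroup_zero: "add_subgroup H \<Longrightarrow> 0 \<in> H"
  by (simp add: add_subgroup_def)

lemma add_subgroup_diff: "add_subgroup H \<Longrightarrow> x \<in> H \<Longrightarrow> y \<in> H \<Longrightarrow> x - y \<in> H"
  by (simp add: add_subgroup_def)

lemma add_subgroup_add: "add_subgroup H \<Longrightarrow> x \<in> H \<Longrightarrow> y \<in> H \<Longrightarrow> x + y \<in> H"
  using add_subgroup_diff[of H 0 y] add_subgroup_diff[of H x "0 - y"]
  by (simp add: add_subgroup_def)

lemma ufD: "uf H I f \<Longrightarrow> X \<subseteq> I \<Longrightarrow> Y \<subseteq> I \<Longrightarrow> sum f X \<in> H \<Longrightarrow> sum f Y \<in> H \<Longrightarrow> sum f (X \<inter> Y) \<in> H"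
  by (simp add: uf_def)

lemma uf_subset: "uf H I f \<Longrightarrow> J \<subseteq> I \<Longrightarrow> uf H J f"
  unfolding uf_def by (meson subset_trans)

lemma uf_cong_sums:
  assumes "uf H I f" "\<And>X. X \<subseteq> I \<Longrightarrow> sum g X \<in> H' \<longleftrightarrow> sum f X \<in> H"
  shows "uf H' I g"
  using assms unfolding uf_def by (metis le_infI1)

text \<open>A subset containing \<open>t\<close> stands for itself together with all of
  \<open>T\<close>. The map \<open>h\<close> that expands it keeps sums and commutes with
  intersections, so closure is inherited.\<close>

lemma uf_contract:
  assumes "uf H I f" "finite I" "T \<subseteq> I" "t \<in> T"
  shows "uf H (insert t (I - T)) (f(t := sum f T))"
proof -
  define h where "h X = (if t \<in> X then X \<union> T else X)" for X
  let ?f = "f(t := sum f T)"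
  have hs: "h X \<subseteq> I" if "X \<subseteq> insert t (I - T)" for X
    using that assms by (auto simp: h_def)
  have sm: "sum ?f X = sum f (h X)" if X: "X \<subseteq> insert t (I - T)" for X
  proof -
    have fin: "finite X" "finite T" using X assms by (auto dest: finite_subset)
    show ?thesis
    proof (cases "t \<in> X")
      case True
      have "sum ?f X = ?f t + sum ?f (X - {t})" using fin True by (simp add: sum.remove)
      also have "sum ?f (X - {t}) = sum f (X - {t})" by (rule sum.cong) auto
      also have "?f t + \<dots> = sum f (T \<union> (X - {t}))"
        using X fin assms by (subst sum.union_disjoint) auto
      also have "T \<union> (X - {t}) = h X" using True assms by (auto simp: h_def)
      finally show ?thesis .
    next
      case False
      then show ?thesis by (auto simp: h_def intro!: sum.cong)
    qed
  qed
  have hi: "h (X \<inter> Y) = h X \<inter> h Y" if "X \<subseteq> insert t (I - T)" "Y \<subseteq> insert t (I - T)" for X Y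
    using that assms by (auto simp: h_def)
  show ?thesis
    unfolding uf_def
  proof (intro allI impI)
    fix X Y assume X: "X \<subseteq> insert t (I - T)" and Y: "Y \<subseteq> insert t (I - T)"
      and "sum ?f X \<in> H" "sum ?f Y \<in> H"
    then have "sum f (h X \<inter> h Y) \<in> H"
      using ufD[OF assms(1) hs[OF X] hs[OF Y]] sm by metis
    moreover have "sum ?f (X \<inter> Y) = sum f (h (X \<inter> Y))" using X by (intro sm) auto
    ultimately show "sum ?f (X \<inter> Y) \<in> H" using hi[OF X Y] by simp
  qed
qed

section \<open>Subset sums and unique factorization modulo a prime\<close>

definition multiples :: "nat \<Rightarrow> int set" where
  "multiples p = {x. int p dvd x}"

text \<open>A Cauchy-Davenport bound for two-element summands. If a new residue \<open>a i\<close>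
  brings no new subset sum, the set of sums is stable under translation by \<open>a i\<close>, which
  generates the residues modulo \<open>p\<close>, and so contains all of them.\<close>

lemma card_subset_sums:
  fixes a :: "'i \<Rightarrow> int"
  assumes p: "prime p" and "finite I" and "\<And>i. i \<in> I \<Longrightarrow> \<not> int p dvd a i"
  shows "card ((\<lambda>X. sum a X mod int p) ` Pow I) \<ge> min p (card I + 1)"
  using assms(2,3)
proof (induction I rule: finite_induct)
  case empty
  then show ?case by simp
next
  case (insert i I)
  let ?S = "\<lambda>I. (\<lambda>X. sum a X mod int p) ` Pow I"
  have p0: "p > 0" using p prime_gt_0_nat by blast
  have mono: "?S I \<subseteq> ?S (insert i I)" by (intro image_mono Pow_mono) auto
  have fin: "finite (?S J)" if "finite J" for J using that by simp
  have IH: "card (?S I) \<ge> min p (card I + 1)" using insert by auto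
  show ?case
  proof (cases "?S (insert i I) = ?S I")
    case False
    then have "?S I \<subset> ?S (insert i I)" using mono by auto
    then have "card (?S I) < card (?S (insert i I))"
      using fin[of "insert i I"] insert.hyps by (intro psubset_card_mono) auto
    then show ?thesis using IH insert.hyps by simp
  next
    case True
    have step: "(y + a i) mod int p \<in> ?S I" if y: "y \<in> ?S I" for y
    proof -
      obtain X where X: "X \<subseteq> I" "y = sum a X mod int p" using y by auto
      have "i \<notin> X" "finite X" using X insert.hyps by (auto dest: finite_subset)
      then have "(y + a i) mod int p = sum a (insert i X) mod int p"
        using X by (simp add: mod_simps algebra_simps)
      moreover have "insert i X \<in> Pow (insert i I)" using X by auto
      ultimately show ?thesis using True by blast
    qed
    have "(int k * a i) mod int p \<in> ?S I" for k
    proof (induction k)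
      case 0
      have "sum a {} mod int p \<in> ?S I" by blast
      then show ?case by simp
    next
      case (Suc k)
      from step[OF this] show ?case by (simp add: mod_simps algebra_simps)
    qed
    then have sub: "(\<lambda>k. (int k * a i) mod int p) ` {..<p} \<subseteq> ?S I" by auto
    have "inj_on (\<lambda>k. (int k * a i) mod int p) {..<p}"
    proof (rule inj_onI)
      fix k l assume kl: "k \<in> {..<p}" "l \<in> {..<p}" "(int k * a i) mod int p = (int l * a i) mod int p"
      then have "int p dvd (int k - int l) * a i"
        by (metis mod_eq_dvd_iff left_diff_distrib)
      moreover have "prime (int p)" using p by simp
      ultimately have "int p dvd int k - int l"
        using insert.prems[of i] by (auto simp: prime_dvd_mult_iff)
      then have "int k mod int p = int l mod int p" by (simp add: mod_eq_dvd_iff)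
      then show "k = l" using kl by simp
    qed
    then have "p \<le> card (?S I)"
      using card_mono[OF _ sub] insert.hyps by (simp add: card_image)
    then show ?thesis using True by simp
  qed
qed

lemma subset_sums_cover:
  fixes a :: "'i \<Rightarrow> int"
  assumes p: "prime p" and "finite I" and "\<And>i. i \<in> I \<Longrightarrow> \<not> int p dvd a i" and "p \<le> card I + 1"
  obtains X where "X \<subseteq> I" "int p dvd c + sum a X"
proof -
  let ?S = "(\<lambda>X. sum a X mod int p) ` Pow I"
  have p0: "p > 0" using p prime_gt_0_nat by blast
  have "?S \<subseteq> {0..<int p}" using p0 by auto
  moreover have "card {0..<int p} \<le> card ?S"
    using card_subset_sums[of p I a] assms by simp
  ultimately have S: "?S = {0..<int p}"
    by (intro card_seteq) auto
  have "(- c) mod int p \<in> ?S" unfolding S using p0 by simp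
  then have "\<exists>X. X \<subseteq> I \<and> sum a X mod int p = (- c) mod int p"
    unfolding image_iff Pow_iff Bex_def by metis
  then obtain X where X: "X \<subseteq> I" "sum a X mod int p = (- c) mod int p" by blast
  then have "int p dvd sum a X - (- c)" by (simp add: mod_eq_dvd_iff)
  then show ?thesis using X that[of X] by (simp add: add.commute)
qed

text \<open>Fix a term \<open>i\<close>. With more than \<open>p\<close> terms, at least
  \<open>p - 1\<close> remain besides \<open>i\<close> and any \<open>j\<close>, so some zero-sum
  set contains \<open>i\<close> and avoids \<open>j\<close>. Intersecting these sets over all
  \<open>j\<close> would shrink them to \<open>{i}\<close>, which is not zero-sum; the proof does
  this with a smallest zero-sum set through \<open>i\<close>.\<close>

lemma uf_cyclic_card_le:
  fixes a :: "'i \<Rightarrow> int"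
  assumes p: "prime p" and fin: "finite I" and nz: "\<And>i. i \<in> I \<Longrightarrow> \<not> int p dvd a i"
    and uf: "uf (multiples p) I a"
  shows "card I \<le> p"
proof (rule ccontr)
  assume big: "\<not> card I \<le> p"
  then have "I \<noteq> {}" by auto
  then obtain i where i: "i \<in> I" by auto
  have ex: "\<exists>X. X \<subseteq> I \<and> i \<in> X \<and> j \<notin> X \<and> int p dvd sum a X" if j: "j \<in> I" "j \<noteq> i" for j
  proof -
    have "card (I - {i, j}) = card I - 2" using i j fin by (subst card_Diff_subset) auto
    then have "p \<le> card (I - {i, j}) + 1" using big by simp
    then obtain X where X: "X \<subseteq> I - {i, j}" "int p dvd a i + sum a X"
      by (rule subset_sums_cover[OF p, rotated 2]) (use fin nz in auto)
    then have "int p dvd sum a (insert i X)"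
      using fin by (subst sum.insert) (auto dest: finite_subset)
    then show ?thesis using X i j by (intro exI[of _ "insert i X"]) auto
  qed
  define P where "P X \<longleftrightarrow> X \<subseteq> I \<and> i \<in> X \<and> int p dvd sum a X" for X
  have "I \<noteq> {i}" using big prime_gt_0_nat[OF p] by auto
  then obtain j0 where j0: "j0 \<in> I" "j0 \<noteq> i" using i by blast
  obtain B0 where "P B0" using ex[OF j0] unfolding P_def by blast
  then obtain B where B: "P B" and min: "\<And>X. P X \<Longrightarrow> card B \<le> card X"
    using ex_has_least_nat[of P B0 card] by blast
  have "B \<noteq> {i}" using B nz[of i] i by (auto simp: P_def)
  then obtain j where j: "j \<in> B" "j \<noteq> i" using B by (auto simp: P_def)
  then obtain X where X: "X \<subseteq> I" "i \<in> X" "j \<notin> X" "int p dvd sum a X"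
    using ex[of j] B by (auto simp: P_def)
  have "P (B \<inter> X)"
    using ufD[OF uf, of B X] B X by (auto simp: P_def multiples_def)
  moreover have "card (B \<inter> X) < card B"
    using B fin j X by (intro psubset_card_mono) (auto simp: P_def dest: finite_subset)
  ultimately show False using min by force
qed

text \<open>Two terms \<open>i\<close>, \<open>j\<close> leave at least \<open>p - 1\<close> others,
  enough to complete \<open>i\<close> to a zero-sum set that misses \<open>j\<close>, hence is
  nonempty and proper.\<close>

lemma zero_sum_proper_subset:
  fixes a :: "'i \<Rightarrow> int"
  assumes p: "prime p" and fin: "finite T" and nz: "\<And>i. i \<in> T \<Longrightarrow> \<not> int p dvd a i" and "card T > p"
  obtains X where "X \<subset> T" "X \<noteq> {}" "int p dvd sum a X"
proof -
  have "2 \<le> card T" using assms(4) prime_ge_2_nat[OF p] by simp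
  then obtain U where U: "U \<subseteq> T" "card U = 2" by (rule obtain_subset_with_card_n)
  then obtain i j where ij: "i \<in> T" "j \<in> T" "i \<noteq> j" by (auto simp: card_2_iff)
  have "card (T - {i, j}) = card T - 2" using ij fin by (subst card_Diff_subset) auto
  then have "p \<le> card (T - {i, j}) + 1" using assms(4) by simp
  then obtain X where X: "X \<subseteq> T - {i, j}" "int p dvd a i + sum a X"
    by (rule subset_sums_cover[OF p, rotated 2]) (use fin nz in auto)
  then have "int p dvd sum a (insert i X)"
    using fin by (subst sum.insert) (auto dest: finite_subset)
  then show ?thesis using X ij by (intro that[of "insert i X"]) auto
qed

section \<open>Sequences over the square of a cyclic group of prime order\<close>

text \<open>The product of the linear forms \<open>a j\<close> x + \<open>b j\<close> y with y set
  to 1: its coefficient at \<open>i\<close> belongs to the monomial x^i y^(card J - i).\<close>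

definition lin_prod :: "('i \<Rightarrow> int) \<Rightarrow> ('i \<Rightarrow> int) \<Rightarrow> 'i set \<Rightarrow> int poly" where
  "lin_prod a b J = (\<Prod>j\<in>J. [:b j, a j:])"

lemma lin_prod_insert:
  "finite J \<Longrightarrow> g \<notin> J \<Longrightarrow> lin_prod a b (insert g J) = [:b g, a g:] * lin_prod a b J"
  by (simp add: lin_prod_def)

lemma degree_lin_prod: "finite J \<Longrightarrow> degree (lin_prod a b J) \<le> card J"
proof (induction J rule: finite_induct)
  case (insert g J)
  have "degree ([:b g, a g:] * lin_prod a b J) \<le> degree [:b g, a g:] + degree (lin_prod a b J)"
    by (rule degree_mult_le)
  also have "\<dots> \<le> 1 + card J" using insert by (intro add_mono) auto
  finally show ?case using insert by (simp add: lin_prod_insert)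
qed (simp add: lin_prod_def)

lemma coeff_linear_mult:
  "coeff ([:c, d:] * F) i = c * coeff F i + (if i = 0 then 0 else d * coeff F (i - 1))"
  for F :: "int poly"
  by (cases i) (simp_all add: mult_pCons_left)

text \<open>Up to the sign (-1)^card J, this is the iterated finite difference of x^i y^k along the
  vectors (\<open>a j\<close>, \<open>b j\<close>), taken at the point (\<open>\<alpha>\<close>,
  \<open>\<beta>\<close>).\<close>

definition alt_sum :: "('i \<Rightarrow> int) \<Rightarrow> ('i \<Rightarrow> int) \<Rightarrow> 'i set \<Rightarrow> nat \<Rightarrow> nat \<Rightarrow> int \<Rightarrow> int \<Rightarrow> int" where
  "alt_sum a b J i k \<alpha> \<beta> =
     (\<Sum>Y\<in>Pow J. (-1) ^ card Y * (\<alpha> + sum a Y) ^ i * (\<beta> + sum b Y) ^ k)"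

lemma alt_sum_insert:
  assumes "finite J" "g \<notin> J"
  shows "alt_sum a b (insert g J) i k \<alpha> \<beta> =
    alt_sum a b J i k \<alpha> \<beta> - alt_sum a b J i k (\<alpha> + a g) (\<beta> + b g)"
proof -
  have "alt_sum a b (insert g J) i k \<alpha> \<beta> = alt_sum a b J i k \<alpha> \<beta> +
    (\<Sum>Y\<in>insert g ` Pow J. (-1) ^ card Y * (\<alpha> + sum a Y) ^ i * (\<beta> + sum b Y) ^ k)"
    unfolding alt_sum_def Pow_insert using assms by (subst sum.union_disjoint) auto
  also have "(\<Sum>Y\<in>insert g ` Pow J. (-1) ^ card Y * (\<alpha> + sum a Y) ^ i * (\<beta> + sum b Y) ^ k) =
    (\<Sum>Y\<in>Pow J. (-1) ^ card (insert g Y) * (\<alpha> + sum a (insert g Y)) ^ i * (\<beta> + sum b (insert g Y)) ^ k)"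
    using assms by (subst sum.reindex) (auto intro!: inj_onI)
  also have "\<dots> = (\<Sum>Y\<in>Pow J. - ((-1) ^ card Y * (\<alpha> + a g + sum a Y) ^ i * (\<beta> + b g + sum b Y) ^ k))"
  proof (rule sum.cong[OF refl])
    fix Y assume "Y \<in> Pow J"
    then have "finite Y" "g \<notin> Y" using assms by (auto dest: finite_subset)
    then show "(-1) ^ card (insert g Y) * (\<alpha> + sum a (insert g Y)) ^ i * (\<beta> + sum b (insert g Y)) ^ k =
      - ((-1) ^ card Y * (\<alpha> + a g + sum a Y) ^ i * (\<beta> + b g + sum b Y) ^ k)"
      by (simp add: add.assoc)
  qed
  finally show ?thesis by (simp add: alt_sum_def sum_negf)
qed

lemma alt_sum_shift:
  assumes "finite J"
  shows "alt_sum a b J i k (\<alpha> + c) (\<beta> + d) =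
    (\<Sum>(r, s)\<in>{..i} \<times> {..k}. of_nat (i choose r) * of_nat (k choose s) * c ^ (i - r) * d ^ (k - s) * alt_sum a b J r s \<alpha> \<beta>)"
proof -
  have "alt_sum a b J i k (\<alpha> + c) (\<beta> + d) =
    (\<Sum>Y\<in>Pow J. \<Sum>(r, s)\<in>{..i} \<times> {..k}. of_nat (i choose r) * of_nat (k choose s) * c ^ (i - r) * d ^ (k - s) *
      ((-1) ^ card Y * (\<alpha> + sum a Y) ^ r * (\<beta> + sum b Y) ^ s))"
    unfolding alt_sum_def
  proof (rule sum.cong[OF refl])
    fix Y
    let ?x = "\<alpha> + sum a Y" and ?y = "\<beta> + sum b Y"
    have "(\<alpha> + c + sum a Y) ^ i = (?x + c) ^ i" by (simp add: algebra_simps)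
    also have "\<dots> = (\<Sum>r\<le>i. of_nat (i choose r) * ?x ^ r * c ^ (i - r))" by (rule binomial_ring)
    finally have 1: "(\<alpha> + c + sum a Y) ^ i = (\<Sum>r\<le>i. of_nat (i choose r) * ?x ^ r * c ^ (i - r))" .
    have "(\<beta> + d + sum b Y) ^ k = (?y + d) ^ k" by (simp add: algebra_simps)
    also have "\<dots> = (\<Sum>s\<le>k. of_nat (k choose s) * ?y ^ s * d ^ (k - s))" by (rule binomial_ring)
    finally have 2: "(\<beta> + d + sum b Y) ^ k = (\<Sum>s\<le>k. of_nat (k choose s) * ?y ^ s * d ^ (k - s))" .
    have "(-1) ^ card Y * (\<alpha> + c + sum a Y) ^ i * (\<beta> + d + sum b Y) ^ k =
      (-1) ^ card Y * ((\<alpha> + c + sum a Y) ^ i * (\<beta> + d + sum b Y) ^ k)" by simp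
    also have "\<dots> = (\<Sum>r\<le>i. \<Sum>s\<le>k. (-1) ^ card Y *
      (of_nat (i choose r) * ?x ^ r * c ^ (i - r) * (of_nat (k choose s) * ?y ^ s * d ^ (k - s))))"
      unfolding 1 2 sum_product unfolding sum_distrib_left ..
    also have "\<dots> = (\<Sum>(r, s)\<in>{..i} \<times> {..k}. of_nat (i choose r) * of_nat (k choose s) * c ^ (i - r) * d ^ (k - s) *
      ((-1) ^ card Y * ?x ^ r * ?y ^ s))"
      unfolding sum.cartesian_product by (rule sum.cong) (auto simp: algebra_simps)
    finally show "(-1) ^ card Y * (\<alpha> + c + sum a Y) ^ i * (\<beta> + d + sum b Y) ^ k =
      (\<Sum>(r, s)\<in>{..i} \<times> {..k}. of_nat (i choose r) * of_nat (k choose s) * c ^ (i - r) * d ^ (k - s) *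
      ((-1) ^ card Y * ?x ^ r * ?y ^ s))" .
  qed
  also have "\<dots> = (\<Sum>(r, s)\<in>{..i} \<times> {..k}. of_nat (i choose r) * of_nat (k choose s) * c ^ (i - r) * d ^ (k - s) * alt_sum a b J r s \<alpha> \<beta>)"
    unfolding alt_sum_def sum_distrib_left by (subst sum.swap) (simp add: case_prod_unfold)
  finally show ?thesis .
qed

text \<open>Each difference lowers the degree by one and acts on the top-degree part as the
  derivative along (\<open>a j\<close>, \<open>b j\<close>). More than \<open>i + k\<close>
  differences give 0; exactly \<open>i + k\<close> of them give the product of these derivations
  applied to x^i y^k, which is \<open>fact i * fact k\<close> times the coefficient of x^i y^k in
  the product of the forms.\<close>

lemma alt_sum_eq:
  assumes "finite J" "i + k \<le> card J"
  shows "alt_sum a b J i k \<alpha> \<beta> =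
    (if i + k < card J then 0 else (-1) ^ card J * fact i * fact k * coeff (lin_prod a b J) i)"
  using assms
proof (induction J arbitrary: i k \<alpha> \<beta> rule: finite_induct)
  case empty
  then show ?case by (simp add: alt_sum_def lin_prod_def)
next
  case (insert g J)
  let ?c = "\<lambda>r s. of_nat (i choose r) * of_nat (k choose s) * a g ^ (i - r) * b g ^ (k - s)"
  let ?T = "\<lambda>r s. ?c r s * alt_sum a b J r s \<alpha> \<beta>"
  let ?S = "{..i} \<times> {..k} - {(i, k)}"
  have "alt_sum a b (insert g J) i k \<alpha> \<beta> = - (\<Sum>(r, s)\<in>?S. ?T r s)"
    unfolding alt_sum_insert[OF insert.hyps(1,2)] alt_sum_shift[OF insert.hyps(1)]
    by (subst sum.remove[of _ "(i, k)"]) auto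
  also have "(\<Sum>(r, s)\<in>?S. ?T r s) =
    (\<Sum>(r, s)\<in>?S. if r + s < card J then 0 else ?c r s * ((-1) ^ card J * fact r * fact s * coeff (lin_prod a b J) r))"
  proof (rule sum.cong[OF refl])
    fix x assume x: "x \<in> ?S"
    obtain r s where rs: "x = (r, s)" by force
    then have "r \<le> i" "s \<le> k" "\<not> (r = i \<and> s = k)" using x by auto
    then have "r + s < i + k" by linarith
    then have "r + s \<le> card J" using insert by simp
    from insert.IH[OF this, of \<alpha> \<beta>] rs
    show "(case x of (r, s) \<Rightarrow> ?T r s) = (case x of (r, s) \<Rightarrow>
      if r + s < card J then 0 else ?c r s * ((-1) ^ card J * fact r * fact s * coeff (lin_prod a b J) r))"
      by simp
  qed
  also have "\<dots> = (if i + k < card (insert g J) then 0 else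
     (-1) ^ card J * fact i * fact k * coeff (lin_prod a b (insert g J)) i)"
  proof (cases "i + k < card (insert g J)")
    case True
    have *: "r + s < card J" if "(r, s) \<in> ?S" for r s
    proof -
      have "r + s < i + k" using that by auto
      then show ?thesis using True insert.hyps by simp
    qed
    have "\<forall>x\<in>?S. (case x of (r, s) \<Rightarrow> if r + s < card J then 0
        else ?c r s * ((-1) ^ card J * fact r * fact s * coeff (lin_prod a b J) r)) = 0"
    proof
      fix x assume x: "x \<in> ?S"
      obtain r s where rs: "x = (r, s)" by force
      then have "r + s < card J" using x * by blast
      then show "(case x of (r, s) \<Rightarrow> if r + s < card J then 0
        else ?c r s * ((-1) ^ card J * fact r * fact s * coeff (lin_prod a b J) r)) = 0"
        using rs by simp
    qed
    then have "(\<Sum>(r, s)\<in>?S. if r + s < card J then 0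
        else ?c r s * ((-1) ^ card J * fact r * fact s * coeff (lin_prod a b J) r)) = 0"
      by (rule sum.neutral)
    then show ?thesis using True by presburger
  next
    case False
    then have ik: "i + k = Suc (card J)" using insert by simp
    \<comment> \<open>By the induction hypothesis only pairs with r + s = card J survive.
      \<open>A\<close> and \<open>B\<close> hold the two neighbours of (\<open>i\<close>,
      \<open>k\<close>), and are empty when the exponent to be lowered is already 0.\<close>
    define A where "A = (if i = 0 then {} else {(i - 1, k)})"
    define B where "B = (if k = 0 then {} else {(i, k - 1)})"
    let ?F = "\<lambda>(r, s). if r + s < card J then 0 else ?c r s * ((-1) ^ card J * fact r * fact s * coeff (lin_prod a b J) r)"
    have "sum ?F ?S = sum ?F (A \<union> B)"
    proof (rule sum.mono_neutral_right)
      show "A \<union> B \<subseteq> ?S" by (auto simp: A_def B_def)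
      show "\<forall>x\<in>?S - (A \<union> B). ?F x = 0"
      proof
        fix x assume x: "x \<in> ?S - (A \<union> B)"
        obtain r s where rs: "x = (r, s)" by force
        have "r + s < card J"
        proof (rule ccontr)
          assume "\<not> r + s < card J"
          then have "r + s + 1 \<ge> i + k" using ik by simp
          moreover have "r \<le> i" "s \<le> k" "\<not> (r = i \<and> s = k)" using x rs by auto
          ultimately have "(r = i \<and> s + 1 = k) \<or> (r + 1 = i \<and> s = k)" by linarith
          then have "x \<in> A \<union> B" using rs by (auto simp: A_def B_def)
          then show False using x by simp
        qed
        then show "?F x = 0" using rs by simp
      qed
    qed simp
    also have "\<dots> = sum ?F A + sum ?F B"
      by (rule sum.union_disjoint) (auto simp: A_def B_def)
    also have "sum ?F A = (-1) ^ card J * fact i * fact k * (if i = 0 then 0 else a g * coeff (lin_prod a b J) (i - 1))"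
    proof (cases i)
      case (Suc i')
      then show ?thesis using ik by (simp add: A_def algebra_simps)
    qed (simp add: A_def)
    also have "sum ?F B = (-1) ^ card J * fact i * fact k * (b g * coeff (lin_prod a b J) i)"
    proof (cases k)
      case 0
      then have "coeff (lin_prod a b J) i = 0"
        using degree_lin_prod[OF insert.hyps(1), of a b] ik by (intro coeff_eq_0) simp
      then show ?thesis using 0 by (simp add: B_def)
    next
      case (Suc k')
      then show ?thesis using ik by (simp add: B_def algebra_simps)
    qed
    finally have E: "sum ?F ?S = (-1) ^ card J * fact i * fact k *
        (if i = 0 then 0 else a g * coeff (lin_prod a b J) (i - 1)) +
        (-1) ^ card J * fact i * fact k * (b g * coeff (lin_prod a b J) i)" .
    have C: "coeff (lin_prod a b (insert g J)) i =
        b g * coeff (lin_prod a b J) i + (if i = 0 then 0 else a g * coeff (lin_prod a b J) (i - 1))"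
      by (simp only: lin_prod_insert[OF insert.hyps(1,2)] coeff_linear_mult)
    show ?thesis
      unfolding E C using False by (simp add: algebra_simps)
  qed
  finally show ?case using insert.hyps by simp
qed

definition null_count :: "nat \<Rightarrow> ('i \<Rightarrow> int) \<Rightarrow> ('i \<Rightarrow> int) \<Rightarrow> 'i set \<Rightarrow> int" where
  "null_count p a b J =
     (\<Sum>Y\<in>{Y \<in> Pow J. int p dvd sum a Y \<and> int p dvd sum b Y}. (-1) ^ card Y)"

lemma fermat_int:
  assumes "prime p" "\<not> int p dvd x"
  shows "int p dvd 1 - x ^ (p - 1)"
proof -
  define y where "y = nat (x mod int p)"
  have p0: "p > 0" using assms prime_gt_0_nat by blast
  have y: "int y = x mod int p" using p0 by (simp add: y_def)
  have "\<not> p dvd y" using assms(2) y by (metis dvd_mod_iff dvd_refl int_dvd_int_iff)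
  then have "[y ^ (p - 1) = 1] (mod p)" using assms(1) by (rule fermat_theorem[rotated])
  then have "[int y ^ (p - 1) = 1] (mod int p)"
    by (metis cong_int_iff of_nat_1 of_nat_power)
  then have "[x ^ (p - 1) = 1] (mod int p)"
    unfolding y cong_def by (simp add: power_mod)
  then show ?thesis by (metis cong_iff_dvd_diff cong_sym)
qed

text \<open>By Fermat, (1 - x^(p-1)) (1 - y^(p-1)) is the indicator of (0, 0) modulo
  \<open>p\<close>. Summed over all subsets, only its x^(p-1) y^(p-1) part remains, since the other
  monomials have degree below the number of differences.\<close>

lemma null_count_cong:
  assumes p: "prime p" and fin: "finite J" and big: "2 * (p - 1) \<le> card J"
  shows "int p dvd null_count p a b J - alt_sum a b J (p - 1) (p - 1) 0 0"
proof -
  let ?s = "\<lambda>Y. (-1 :: int) ^ card Y"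
  let ?e = "\<lambda>Y. ?s Y * (1 - sum a Y ^ (p - 1)) * (1 - sum b Y ^ (p - 1))"
  have p2: "p \<ge> 2" using p by (rule prime_ge_2_nat)
  have z: "alt_sum a b J 0 0 0 0 = 0" "alt_sum a b J (p - 1) 0 0 0 = 0" "alt_sum a b J 0 (p - 1) 0 0 = 0"
    using p2 big alt_sum_eq[OF fin, of _ _ a b 0 0] by auto
  have "(\<Sum>Y\<in>Pow J. ?e Y) = alt_sum a b J 0 0 0 0 - alt_sum a b J (p - 1) 0 0 0 -
      alt_sum a b J 0 (p - 1) 0 0 + alt_sum a b J (p - 1) (p - 1) 0 0"
    by (simp add: alt_sum_def sum_subtractf[symmetric] sum.distrib[symmetric] algebra_simps)
  then have e: "(\<Sum>Y\<in>Pow J. ?e Y) = alt_sum a b J (p - 1) (p - 1) 0 0" using z by simp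
  have "null_count p a b J = (\<Sum>Y\<in>Pow J. if int p dvd sum a Y \<and> int p dvd sum b Y then ?s Y else 0)"
    unfolding null_count_def using fin by (subst sum.inter_filter) auto
  then have "null_count p a b J - alt_sum a b J (p - 1) (p - 1) 0 0 =
     (\<Sum>Y\<in>Pow J. (if int p dvd sum a Y \<and> int p dvd sum b Y then ?s Y else 0) - ?e Y)"
    unfolding e[symmetric] by (simp add: sum_subtractf)
  moreover have "int p dvd (if int p dvd sum a Y \<and> int p dvd sum b Y then ?s Y else 0) - ?e Y" for Y
  proof (cases "int p dvd sum a Y")
    case False
    then have "int p dvd 1 - sum a Y ^ (p - 1)" by (rule fermat_int[OF p])
    then show ?thesis using False by (simp add: dvd_mult dvd_mult2)
  next
    case A: True
    show ?thesis
    proof (cases "int p dvd sum b Y")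
      case False
      then have "int p dvd 1 - sum b Y ^ (p - 1)" by (rule fermat_int[OF p])
      then show ?thesis using False by simp
    next
      case B: True
      obtain c d where cd: "sum a Y ^ (p - 1) = int p * c" "sum b Y ^ (p - 1) = int p * d"
        using A B p2 by (metis dvdE dvd_power_same dvd_trans dvd_power zero_less_diff less_le_trans one_less_numeral_iff semiring_norm(76))
      have "?s Y - ?s Y * (1 - int p * c) * (1 - int p * d) = int p * (?s Y * (c + d - int p * c * d))"
        by (simp add: algebra_simps)
      then show ?thesis using A B cd by simp
    qed
  qed
  ultimately show ?thesis by (simp add: dvd_sum)
qed

lemma prime_not_dvd_fact:
  assumes "prime p" shows "\<not> int p dvd fact (p - 1)"
proof
  assume "int p dvd fact (p - 1)"
  then have "int p dvd int (fact (p - 1))" by simp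
  then have "p dvd fact (p - 1)" by (simp only: int_dvd_int_iff)
  then show False using assms prime_gt_0_nat[OF assms] by (simp add: prime_dvd_fact_iff)
qed

lemma null_count_top:
  assumes p: "prime p" and fin: "finite J" and card: "card J = 2 * (p - 1)"
  shows "int p dvd null_count p a b J \<longleftrightarrow> int p dvd coeff (lin_prod a b J) (p - 1)"
proof -
  have "alt_sum a b J (p - 1) (p - 1) 0 0 =
      (-1) ^ card J * fact (p - 1) * fact (p - 1) * coeff (lin_prod a b J) (p - 1)"
    using card by (subst alt_sum_eq[OF fin]) auto
  then have "int p dvd alt_sum a b J (p - 1) (p - 1) 0 0 \<longleftrightarrow> int p dvd coeff (lin_prod a b J) (p - 1)"
    using p prime_not_dvd_fact[OF p] card by (simp add: prime_dvd_mult_iff power_mult)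
  moreover have "int p dvd null_count p a b J \<longleftrightarrow> int p dvd alt_sum a b J (p - 1) (p - 1) 0 0"
    using null_count_cong[OF p fin, of a b] card
    dvd_add_right_iff[of "int p" "null_count p a b J - alt_sum a b J (p - 1) (p - 1) 0 0"
      "alt_sum a b J (p - 1) (p - 1) 0 0"] by simp
  ultimately show ?thesis by simp
qed

text \<open>The empty set contributes 1 to the count, so more than \<open>2 * (p - 1)\<close> terms
  always have a nonempty zero-sum subset: the upper bound 2p - 1 for the Davenport constant of C_p +
  C_p.\<close>

lemma null_count_large:
  assumes p: "prime p" and fin: "finite J" and card: "card J > 2 * (p - 1)"
  shows "int p dvd null_count p a b J"
proof -
  have "alt_sum a b J (p - 1) (p - 1) 0 0 = 0"
    using card by (subst alt_sum_eq[OF fin]) auto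
  then show ?thesis using null_count_cong[OF p fin, of a b] card by simp
qed

section \<open>Integer polynomials modulo p: Wronskians and lacunary polynomials\<close>

abbreviation pdvd :: "nat \<Rightarrow> int poly \<Rightarrow> bool" where
  "pdvd p F \<equiv> [:int p:] dvd F"

lemma pdvd_iff: "pdvd p F \<longleftrightarrow> (\<forall>i. int p dvd coeff F i)"
  by (rule const_poly_dvd_iff)

lemma pdvd_poly: "pdvd p F \<Longrightarrow> int p dvd poly F u"
  by (auto elim!: dvdE)

lemma pdvd_pderiv: "pdvd p F \<Longrightarrow> pdvd p (pderiv F)"
  by (simp add: pdvd_iff coeff_pderiv)

lemma pdvd_mult_cancel:
  assumes "prime p" "pdvd p (F * G)" "\<not> pdvd p F"
  shows "pdvd p G"
proof -
  have "prime_elem [:int p:]" using assms(1) by (simp add: prime_elem_const_poly_iff)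
  then show ?thesis using assms(2,3) by (auto simp: prime_elem_dvd_mult_iff)
qed

lemma not_pdvd_monic: "prime p \<Longrightarrow> lead_coeff F = 1 \<Longrightarrow> \<not> pdvd p F"
  using pdvd_iff[of p F] prime_gt_1_nat[of p] by (metis not_prime_unit of_nat_1 int_dvd_int_iff prime_nat_int_transfer)

lemma monic_linear_power: "lead_coeff ([:- u, 1:] ^ k) = (1 :: int)"
  by (simp add: lead_coeff_power)

lemma pdvd_root:
  assumes "int p dvd poly A u"
  shows "\<exists>A'. pdvd p (A - [:- u, 1:] * A')"
proof -
  have "A - [:poly A u:] = [:- u, 1:] * synthetic_div A u"
    using synthetic_div_correct'[of u A] by (simp add: algebra_simps)
  then have "A - [:- u, 1:] * synthetic_div A u = [:poly A u:]" by (simp add: algebra_simps)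
  moreover have "pdvd p [:poly A u:]" using assms by (simp add: const_poly_dvd_const_poly_iff)
  ultimately show ?thesis by metis
qed

text \<open>Multiplication by \<open>x\<close> turns the derivative of a power of \<open>x\<close>
  into a scalar multiple of that power, so that \<open>x ^ (e + k)\<close> can be factored out. The
  cofactor is (k - e) F A modulo \<open>x\<close>.\<close>

lemma wronskian_power:
  fixes u :: int and F A :: "int poly" and e k :: nat
  defines "x \<equiv> [:- u, 1:]"
  shows "x * (x ^ e * F * pderiv (x ^ k * A) - pderiv (x ^ e * F) * (x ^ k * A)) =
    x ^ (e + k) * (smult (int k - int e) (F * A) + x * (F * pderiv A - pderiv F * A))"
proof -
  have dx: "x * pderiv (x ^ j) = of_nat j * x ^ j" for j
  proof (cases j)
    case (Suc j')
    have "pderiv x = 1" by (simp add: x_def pderiv_pCons)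
    then have "x * pderiv (x ^ j) = smult (of_nat j) (x * x ^ j')"
      unfolding Suc pderiv_power_Suc by simp
    then show ?thesis using Suc by (simp add: of_nat_poly)
  qed simp
  have "x * (x ^ e * F * pderiv (x ^ k * A) - pderiv (x ^ e * F) * (x ^ k * A)) =
     x ^ e * F * ((x * pderiv (x ^ k)) * A + x * x ^ k * pderiv A)
     - ((x * pderiv (x ^ e)) * F + x * x ^ e * pderiv F) * (x ^ k * A)"
    by (simp add: pderiv_mult algebra_simps)
  also have "\<dots> = x ^ (e + k) * ((of_nat k - of_nat e) * (F * A) + x * (F * pderiv A - pderiv F * A))"
    unfolding dx by (simp add: power_add algebra_simps)
  also have "(of_nat k - of_nat e) * (F * A) = smult (int k - int e) (F * A)"
    by (simp add: of_nat_poly smult_diff_left algebra_simps)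
  finally show ?thesis .
qed

lemma wronskian_pdvd_cong:
  assumes "pdvd p (A - B)" "pdvd p (F * pderiv A - pderiv F * A)"
  shows "pdvd p (F * pderiv B - pderiv F * B)"
proof -
  have "pdvd p (pderiv A - pderiv B)" using pdvd_pderiv[OF assms(1)] by (simp add: pderiv_diff)
  then have "pdvd p (F * (pderiv A - pderiv B) - pderiv F * (A - B))"
    using assms(1) by (rule dvd_diff[OF dvd_mult dvd_mult])
  then have "pdvd p ((F * pderiv A - pderiv F * A) - (F * (pderiv A - pderiv B) - pderiv F * (A - B)))"
    by (rule dvd_diff[OF assms(2)])
  then show ?thesis by (simp add: algebra_simps)
qed

text \<open>Suppose \<open>x ^ k\<close> with k < e has been split off from \<open>A\<close>,
  leaving B. Evaluating the cofactor of the Wronskian at \<open>u\<close> gives (k - e) F(u) B(u) =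
  0 modulo \<open>p\<close>, and k - e is invertible because \<open>e < p\<close>; so another factor
  \<open>x\<close> splits off. At k = e the scalar term vanishes and the Wronskian of F and B is
  left.\<close>

lemma wronskian_root:
  fixes u :: int
  defines "x \<equiv> [:- u, 1:]"
  assumes p: "prime p" and e: "e < p" and F: "\<not> int p dvd poly F u"
    and W: "pdvd p (x ^ e * F * pderiv A - pderiv (x ^ e * F) * A)"
  shows "\<exists>B. pdvd p (A - x ^ e * B) \<and> pdvd p (F * pderiv B - pderiv F * B)"
proof -
  have xk: "\<not> pdvd p (x ^ k)" for k
    unfolding x_def by (rule not_pdvd_monic[OF p monic_linear_power])
  have cancel: "pdvd p (smult (int k - int e) (F * B) + x * (F * pderiv B - pderiv F * B))"
    if "pdvd p (A - x ^ k * B)" for k B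
  proof -
    have "pdvd p (x ^ e * F * pderiv (x ^ k * B) - pderiv (x ^ e * F) * (x ^ k * B))"
      by (rule wronskian_pdvd_cong[OF that W])
    then have "pdvd p (x * (x ^ e * F * pderiv (x ^ k * B) - pderiv (x ^ e * F) * (x ^ k * B)))"
      by (rule dvd_mult)
    then have "pdvd p (x ^ (e + k) * (smult (int k - int e) (F * B) + x * (F * pderiv B - pderiv F * B)))"
      unfolding x_def wronskian_power .
    then show ?thesis using pdvd_mult_cancel[OF p] xk by blast
  qed
  have "\<exists>B. pdvd p (A - x ^ k * B)" if "k \<le> e" for k
    using that
  proof (induction k)
    case 0
    show ?case by (intro exI[of _ A]) simp
  next
    case (Suc k)
    then obtain B where B: "pdvd p (A - x ^ k * B)" by auto
    have xu: "poly x u = 0" by (simp add: x_def)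
    have "poly (smult (int k - int e) (F * B) + x * (F * pderiv B - pderiv F * B)) u =
        (int k - int e) * (poly F u * poly B u)"
      by (simp add: xu)
    then have "int p dvd (int k - int e) * (poly F u * poly B u)"
      using pdvd_poly[OF cancel[OF B], of u] by metis
    moreover have "\<not> int p dvd int k - int e"
    proof
      assume "int p dvd int k - int e"
      then have "int p dvd int e - int k" using dvd_diff_commute by blast
      then have "int p \<le> int e - int k" using Suc by (intro zdvd_imp_le) auto
      then show False using e by simp
    qed
    ultimately have "int p dvd poly B u" using p F by (simp add: prime_dvd_mult_iff)
    then obtain C where C: "pdvd p (B - x * C)" using pdvd_root[of p B u] unfolding x_def by blast
    have "A - x ^ Suc k * C = (A - x ^ k * B) + x ^ k * (B - x * C)" by (simp add: algebra_simps)
    then show ?case using B C by (metis dvd_add dvd_mult)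
  qed
  then obtain B where B: "pdvd p (A - x ^ e * B)" by blast
  from cancel[OF B] have "pdvd p (x * (F * pderiv B - pderiv F * B))" by simp
  moreover have "\<not> pdvd p x" using xk[of 1] by simp
  ultimately have "pdvd p (F * pderiv B - pderiv F * B)" by (rule pdvd_mult_cancel[OF p])
  then show ?thesis using B by blast
qed

definition root_prod :: "int set \<Rightarrow> (int \<Rightarrow> nat) \<Rightarrow> int poly" where
  "root_prod V m = (\<Prod>u\<in>V. [:- u, 1:] ^ m u)"

lemma root_prod_insert:
  "finite V \<Longrightarrow> u \<notin> V \<Longrightarrow> root_prod (insert u V) m = [:- u, 1:] ^ m u * root_prod V m"
  by (simp add: root_prod_def)

lemma lead_coeff_root_prod: "lead_coeff (root_prod V m) = 1"
  by (simp add: root_prod_def lead_coeff_prod lead_coeff_power)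

lemma degree_root_prod: "finite V \<Longrightarrow> degree (root_prod V m) = sum m V"
  unfolding root_prod_def by (subst degree_prod_eq_sum_degree) (simp_all add: degree_linear_power)

text \<open>A vanishing Wronskian says that A / F has derivative 0, i.e. is a rational function of
  x^p modulo \<open>p\<close>. Poles of order below \<open>p\<close> are then impossible, so F
  divides A. The proof removes the roots one at a time.\<close>

lemma wronskian_root_prod:
  assumes p: "prime p" and "finite V" and "\<And>u. u \<in> V \<Longrightarrow> m u < p"
    and "\<And>u v. u \<in> V \<Longrightarrow> v \<in> V \<Longrightarrow> int p dvd u - v \<Longrightarrow> u = v"
    and "pdvd p (root_prod V m * pderiv A - pderiv (root_prod V m) * A)"
  shows "\<exists>C. pdvd p (A - root_prod V m * C)"
  using assms(2-5)
proof (induction V arbitrary: A rule: finite_induct)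
  case empty
  then show ?case by (intro exI[of _ A]) (simp add: root_prod_def)
next
  case (insert u V)
  let ?F = "root_prod V m"
  have "poly ?F u = (\<Prod>v\<in>V. (u - v) ^ m v)" by (simp add: root_prod_def poly_prod)
  moreover have "\<not> int p dvd (u - v) ^ m v" if "v \<in> V" for v
    using insert.prems(2)[of u v] that insert.hyps p
    by (metis insertCI prime_dvd_power prime_nat_int_transfer)
  ultimately have Fu: "\<not> int p dvd poly ?F u"
    using p insert.hyps(1) by (simp add: prime_dvd_prod_iff)
  obtain B where B: "pdvd p (A - [:- u, 1:] ^ m u * B)" "pdvd p (?F * pderiv B - pderiv ?F * B)"
    using wronskian_root[OF p _ Fu, of "m u" A] insert.prems(1)[of u] insert.prems(3) insert.hyps
    unfolding root_prod_insert[OF insert.hyps] by auto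
  obtain C where C: "pdvd p (B - ?F * C)"
    using insert.IH[OF _ _ B(2)] insert.prems(1,2) by blast
  have "A - root_prod (insert u V) m * C = (A - [:- u, 1:] ^ m u * B) + [:- u, 1:] ^ m u * (B - ?F * C)"
    unfolding root_prod_insert[OF insert.hyps] by (simp add: algebra_simps)
  then show ?case using B(1) C by (metis dvd_add dvd_mult)
qed

text \<open>The top coefficients of \<open>C\<close> divisible by \<open>p\<close> are cut off. If
  anything remains, its multiple by the monic \<open>F\<close> has a leading coefficient not
  divisible by \<open>p\<close>, in a degree that \<open>A\<close> does not reach.\<close>

lemma pdvd_small_multiple:
  assumes "lead_coeff F = 1" "degree A < degree F" "pdvd p (A - F * C)"
  shows "pdvd p A"
proof (cases "pdvd p C")
  case True
  then have "pdvd p (F * C)" by (rule dvd_mult)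
  then have "pdvd p ((A - F * C) + F * C)" using assms(3) by (rule dvd_add[rotated])
  then show ?thesis by simp
next
  case False
  define S where "S = {j. \<not> int p dvd coeff C j}"
  have "S \<subseteq> {..degree C}" by (auto simp: S_def intro: le_degree)
  then have fin: "finite S" by (rule finite_subset) simp
  have "S \<noteq> {}" using False by (auto simp: S_def pdvd_iff)
  define j where "j = Max S"
  have j: "j \<in> S" unfolding j_def using fin \<open>S \<noteq> {}\<close> by (rule Max_in)
  have above: "int p dvd coeff C i" if "i > j" for i
  proof -
    have "i \<notin> S" using that Max_ge[OF fin, of i] by (auto simp: j_def)
    then show ?thesis by (simp add: S_def)
  qed
  define C0 where "C0 = poly_cutoff (Suc j) C"
  have "pdvd p (C - C0)"
    using above by (auto simp: pdvd_iff C0_def coeff_poly_cutoff)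
  then have "pdvd p ((A - F * C) + F * (C - C0))" using assms(3) by (metis dvd_add dvd_mult)
  then have d: "pdvd p (A - F * C0)" by (simp add: algebra_simps)
  have cj: "coeff C0 j = coeff C j" by (simp add: C0_def coeff_poly_cutoff)
  have "degree C0 = j"
  proof (rule antisym)
    show "degree C0 \<le> j" by (rule degree_le) (simp add: C0_def coeff_poly_cutoff)
    show "j \<le> degree C0" using j cj by (intro le_degree) (auto simp: S_def)
  qed
  then have "coeff (F * C0) (degree F + j) = coeff C j"
    using coeff_mult_degree_sum[of F C0] assms(1) cj by simp
  moreover have "coeff A (degree F + j) = 0" using assms(2) by (intro coeff_eq_0) simp
  ultimately have "int p dvd - coeff C j" using d unfolding pdvd_iff by (metis coeff_diff diff_0)
  then show ?thesis using j by (simp add: S_def)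
qed

text \<open>
  A binary form of degree \<open>n\<close>, dehomogenised, belongs to the ideal generated by the \<open>p\<close>-th powers
  of the two variables modulo \<open>p\<close> iff all its coefficients with both exponents below \<open>p\<close> vanish.
\<close>

definition frob_form :: "nat \<Rightarrow> nat \<Rightarrow> int poly \<Rightarrow> bool" where
  "frob_form p n F \<longleftrightarrow> (\<forall>i<p. n < i + p \<longrightarrow> int p dvd coeff F i)"

text \<open>The argument for fully reducible lacunary polynomials; \<open>t\<close> is the
  multiplicity of the root at infinity. Membership in the ideal writes F modulo \<open>p\<close> as
  x^p A + B with B below degree n + 1 - p. Let R be the product of the distinct linear factors, so
  that R F' = g F. Differentiation treats x^p as a constant, whence x^p X + Y = 0 for X = R A' - g A
  and Y = R B' - g B. The bound \<open>small\<close> keeps Y below degree \<open>p\<close>, so X =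
  0; then the Wronskian of F and A vanishes, F divides A, and A = 0 for reasons of degree, although
  F is monic.\<close>

lemma not_frob_form_root_prod:
  assumes p: "prime p" and V: "finite V" and m: "\<And>u. u \<in> V \<Longrightarrow> 0 < m u \<and> m u < p"
    and inj: "\<And>u v. u \<in> V \<Longrightarrow> v \<in> V \<Longrightarrow> int p dvd u - v \<Longrightarrow> u = v"
    and t: "t < p" and n: "n = sum m V + t" and small: "n + card V \<le> 2 * p"
  shows "\<not> frob_form p n (root_prod V m)"
proof
  assume frob: "frob_form p n (root_prod V m)"
  define F where "F = root_prod V m"
  define g where "g = (\<Sum>u\<in>V. smult (int (m u)) (\<Prod>w\<in>V - {u}. [:- w, 1:]))"
  define R where "R = (\<Prod>u\<in>V. [:- u, 1 :: int:])"
  define A where "A = poly_shift p F"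
  define B where "B = poly_cutoff (n + 1 - p) F"
  define x where "x = monom (1 :: int) p"
  have p0: "p > 0" using p prime_gt_0_nat by blast
  have lF: "lead_coeff F = 1" unfolding F_def by (rule lead_coeff_root_prod)
  have dF: "degree F = sum m V" unfolding F_def by (rule degree_root_prod[OF V])
  have lR: "lead_coeff R = 1" by (simp add: R_def lead_coeff_prod)
  have dR: "degree R = card V"
    unfolding R_def by (subst degree_prod_eq_sum_degree) auto
  \<comment> \<open>The exponents of B stay below \<open>p\<close>, so that x^p A and B do not
    overlap.\<close>
  have n2: "n + 1 - p \<le> p"
  proof (cases "V = {}")
    case True
    then show ?thesis using n t by simp
  next
    case False
    then have "card V \<ge> 1" using V by (simp add: Suc_leI card_gt_0_iff)
    then show ?thesis using small by simp
  qed
  have coeff_x: "coeff (x * G) i = (if i < p then 0 else coeff G (i - p))" for G i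
    unfolding x_def by (simp add: coeff_monom_mult)
  have FB: "pdvd p (F - (x * A + B))"
    unfolding pdvd_iff
  proof
    fix i
    show "int p dvd coeff (F - (x * A + B)) i"
    proof (cases "i < p")
      case True
      then show ?thesis
        using frob n2 by (auto simp: coeff_x B_def coeff_poly_cutoff frob_form_def F_def)
    next
      case False
      then show ?thesis using n2 by (simp add: coeff_x A_def coeff_poly_shift B_def coeff_poly_cutoff)
    qed
  qed
  have RF: "R * pderiv F = g * F"
  proof -
    have "pderiv F = (\<Sum>u\<in>V. (\<Prod>w\<in>V - {u}. [:- w, 1:] ^ m w) * pderiv ([:- u, 1:] ^ m u))"
      unfolding F_def root_prod_def by (rule pderiv_prod)
    then have "R * pderiv F = (\<Sum>u\<in>V. R * ((\<Prod>w\<in>V - {u}. [:- w, 1:] ^ m w) * pderiv ([:- u, 1:] ^ m u)))"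
      by (simp add: sum_distrib_left)
    also have "\<dots> = (\<Sum>u\<in>V. smult (int (m u)) (\<Prod>w\<in>V - {u}. [:- w, 1:]) * F)"
    proof (rule sum.cong[OF refl])
      fix u assume u: "u \<in> V"
      obtain k where k: "m u = Suc k" using m[OF u] by (metis gr0_implies_Suc)
      have R: "R = [:- u, 1:] * (\<Prod>w\<in>V - {u}. [:- w, 1:])"
        unfolding R_def using V u by (rule prod.remove)
      have F: "F = [:- u, 1:] ^ m u * (\<Prod>w\<in>V - {u}. [:- w, 1:] ^ m w)"
        unfolding F_def root_prod_def using V u by (rule prod.remove)
      have d: "pderiv ([:- u, 1:] ^ m u) = smult (int (m u)) ([:- u, 1:] ^ k)"
        unfolding k pderiv_power_Suc by (simp add: pderiv_pCons)
      show "R * ((\<Prod>w\<in>V - {u}. [:- w, 1:] ^ m w) * pderiv ([:- u, 1:] ^ m u)) =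
          smult (int (m u)) (\<Prod>w\<in>V - {u}. [:- w, 1:]) * F"
        unfolding R F d using k by (simp add: algebra_simps del: mult_pCons_left mult_pCons_right)
    qed
    finally show ?thesis by (simp add: g_def sum_distrib_right)
  qed
  define X where "X = R * pderiv A - g * A"
  define Y where "Y = R * pderiv B - g * B"
  have dx: "pdvd p (pderiv x)"
    unfolding x_def pderiv_monom by (simp add: pdvd_iff)
  have XY: "pdvd p (x * X + Y)"
  proof -
    have "pdvd p (R * pderiv (F - (x * A + B)) - g * (F - (x * A + B)))"
      by (rule dvd_diff[OF dvd_mult[OF pdvd_pderiv[OF FB]] dvd_mult[OF FB]])
    moreover have "R * pderiv (F - (x * A + B)) - g * (F - (x * A + B)) =
        - (x * X + Y) - R * A * pderiv x"
      using RF by (simp add: X_def Y_def pderiv_diff pderiv_add pderiv_mult algebra_simps)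
    ultimately have "pdvd p (- (x * X + Y) - R * A * pderiv x + R * A * pderiv x)"
      using dx by (metis dvd_add dvd_mult)
    then have "pdvd p (- (x * X + Y))" by (simp only: diff_add_cancel)
    then show ?thesis unfolding dvd_minus_iff .
  qed
  have Y: "coeff Y i = 0" if i: "i \<ge> p" for i
  proof (cases "n < p")
    case True
    then show ?thesis by (simp add: Y_def B_def poly_cutoff_def zero_poly_def[symmetric])
  next
    case False
    have dB: "degree B \<le> n - p"
      by (rule degree_le) (use False in \<open>auto simp: B_def coeff_poly_cutoff\<close>)
    have V1: "card V \<ge> 1"
    proof -
      have "V \<noteq> {}" using False n t by auto
      then show ?thesis using V by (simp add: Suc_leI card_gt_0_iff)
    qed
    have dg: "degree g \<le> card V - 1"
      unfolding g_def
    proof (rule degree_sum_le[OF V])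
      fix u assume u: "u \<in> V"
      have "degree (\<Prod>w\<in>V - {u}. [:- w, 1 :: int:]) = card V - 1"
        using V u by (subst degree_prod_eq_sum_degree) auto
      then show "degree (smult (int (m u)) (\<Prod>w\<in>V - {u}. [:- w, 1:])) \<le> card V - 1"
        by (metis degree_smult_le)
    qed
    have "coeff (g * B) i = 0"
    proof (rule coeff_eq_0)
      have "degree (g * B) \<le> (card V - 1) + (n - p)"
        using degree_mult_le[of g B] dg dB by linarith
      then show "degree (g * B) < i" using i small V1 False by linarith
    qed
    moreover have "coeff (R * pderiv B) i = 0"
    proof (cases "degree B = 0")
      case True
      then have "pderiv B = 0" by (simp add: pderiv_eq_0_iff)
      then show ?thesis by simp
    next
      case B0: False
      show ?thesis
      proof (rule coeff_eq_0)
        have "degree (R * pderiv B) \<le> card V + (degree B - 1)"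
          using degree_mult_le[of R "pderiv B"] dR degree_pderiv[of B] by linarith
        then show "degree (R * pderiv B) < i" using i small B0 dB False by linarith
      qed
    qed
    ultimately show ?thesis by (simp add: Y_def)
  qed
  have "pdvd p X"
    unfolding pdvd_iff
  proof
    fix i
    have "coeff (x * X + Y) (i + p) = coeff X i" using Y[of "i + p"] by (simp add: coeff_x)
    then show "int p dvd coeff X i" using XY unfolding pdvd_iff by metis
  qed
  then have "pdvd p (F * X)" by (rule dvd_mult)
  moreover have "F * X = R * (F * pderiv A - pderiv F * A)"
    using RF by (simp add: X_def algebra_simps)
  ultimately have "pdvd p (R * (F * pderiv A - pderiv F * A))" by simp
  then have "pdvd p (F * pderiv A - pderiv F * A)"
    by (rule pdvd_mult_cancel[OF p _ not_pdvd_monic[OF p lR]])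
  then obtain C where C: "pdvd p (A - F * C)"
    using wronskian_root_prod[OF p V _ inj, of m A] m unfolding F_def by blast
  have notp: "\<not> int p dvd 1" using p by (metis not_prime_unit prime_nat_int_transfer)
  show False
  \<comment> \<open>Below degree \<open>p\<close> there is no part A to use. There the leading
    coefficient 1 itself has an index at which \<open>frob_form\<close> requires divisibility by
    \<open>p\<close>, because \<open>t < p\<close>.\<close>
  proof (cases "sum m V < p")
    case True
    then have "int p dvd coeff F (sum m V)"
      using frob n t unfolding frob_form_def F_def by simp
    then show False using lF dF notp by simp
  next
    case False
    have "degree A < degree F"
    proof -
      have "degree A \<le> sum m V - p"
        by (rule degree_le) (use dF False in \<open>auto simp: A_def coeff_poly_shift intro!: coeff_eq_0\<close>)
      then show ?thesis using False p0 dF by simp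
    qed
    then have "pdvd p A" using pdvd_small_multiple[OF lF _ C] by simp
    then have "int p dvd coeff A (sum m V - p)" unfolding pdvd_iff by blast
    moreover have "coeff A (sum m V - p) = 1"
      using False lF dF by (simp add: A_def coeff_poly_shift)
    ultimately show False using notp by simp
  qed
qed

text \<open>This expresses that the truncated polynomial ring in two variables has its socle in the top degree.\<close>

lemma frob_form_two_multiples:
  assumes p: "prime p" and n: "n < 2 * (p - 1)"
    and 1: "frob_form p (Suc n) ([:b, a:] * F)" and 2: "frob_form p (Suc n) ([:b', a':] * F)"
    and det: "\<not> int p dvd a * b' - a' * b"
  shows "frob_form p n F"
  unfolding frob_form_def
proof (intro allI impI)
  \<comment> \<open>Each coefficient of the two products combines two neighbouring coefficients of
    \<open>F\<close>; by Cramer's rule both of them vanish modulo \<open>p\<close>.\<close>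
  have key: "int p dvd coeff F i \<and> (i > 0 \<longrightarrow> int p dvd coeff F (i - 1))" if i: "i < p" "Suc n < i + p" for i
  proof -
    define x where "x = coeff F i"
    define y where "y = (if i = 0 then 0 else coeff F (i - 1))"
    have X: "int p dvd b * x + a * y" "int p dvd b' * x + a' * y"
      using 1 2 i unfolding frob_form_def coeff_linear_mult by (auto simp: x_def y_def split: if_splits)
    have "int p dvd a * (b' * x + a' * y) - a' * (b * x + a * y)"
      using X by (intro dvd_diff dvd_mult)
    moreover have "a * (b' * x + a' * y) - a' * (b * x + a * y) = (a * b' - a' * b) * x"
      by (simp add: algebra_simps)
    ultimately have "int p dvd x" using p det by (simp add: prime_dvd_mult_iff)
    moreover have "int p dvd b' * (b * x + a * y) - b * (b' * x + a' * y)"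
      using X by (intro dvd_diff dvd_mult)
    moreover have "b' * (b * x + a * y) - b * (b' * x + a' * y) = (a * b' - a' * b) * y"
      by (simp add: algebra_simps)
    ultimately show ?thesis using p det by (auto simp: prime_dvd_mult_iff x_def y_def)
  qed
  fix i assume i: "i < p" "n < i + p"
  show "int p dvd coeff F i"
  \<comment> \<open>Index \<open>i\<close> is reached as the lower neighbour of
    \<open>Suc i\<close>, except for i = p - 1, where \<open>n < 2 * (p - 1)\<close> admits it as
    the upper one.\<close>
  proof (cases "Suc i < p")
    case True
    then show ?thesis using key[of "Suc i"] i by simp
  next
    case False
    then show ?thesis using key[of i] i n by simp
  qed
qed

lemma frob_form_cong: "pdvd p (F - G) \<Longrightarrow> frob_form p n F \<Longrightarrow> frob_form p n G"
  unfolding frob_form_def pdvd_iff coeff_diff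
  by (meson dvd_diff_right_iff dvd_diff_commute dvd_diff_left_iff)

lemma frob_form_smult: "prime p \<Longrightarrow> \<not> int p dvd c \<Longrightarrow> frob_form p n (smult c F) \<Longrightarrow> frob_form p n F"
  by (auto simp: frob_form_def prime_dvd_mult_iff)

section \<open>Directions in the plane over the field with p elements\<close>

text \<open>The zero of the form \<open>fst v\<close> x + \<open>snd v\<close> y on the projective
  line, normalised to 0, ..., p - 1. The value -1 encodes the point at infinity and cannot collide
  with a finite zero.\<close>

definition slope :: "nat \<Rightarrow> int \<times> int \<Rightarrow> int" where
  "slope p v = (if int p dvd fst v then -1 else SOME u. 0 \<le> u \<and> u < int p \<and> int p dvd snd v + fst v * u)"

lemma slope_finite:
  assumes p: "prime p" and "\<not> int p dvd fst v"
  shows "0 \<le> slope p v" "slope p v < int p" "int p dvd snd v + fst v * slope p v"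
proof -
  have "coprime (fst v) (int p)"
    using prime_imp_coprime[of "int p" "fst v"] p assms(2) by (simp add: coprime_commute)
  then obtain x where x: "[fst v * x = 1] (mod int p)" using cong_solve_coprime_int by blast
  define u where "u = (- snd v * x) mod int p"
  have "[snd v + fst v * u = snd v + fst v * (- snd v * x)] (mod int p)"
    unfolding u_def by (intro cong_add cong_mult cong_refl) (simp add: cong_def)
  also have "snd v + fst v * (- snd v * x) = snd v + (- snd v) * (fst v * x)" by simp
  also have "[\<dots> = snd v + (- snd v) * 1] (mod int p)"
    by (intro cong_add cong_mult cong_refl x)
  finally have "int p dvd snd v + fst v * u" by (simp add: cong_0_iff)
  moreover have "0 \<le> u" "u < int p" unfolding u_def using prime_gt_0_nat[OF p] by simp_all
  ultimately have "\<exists>u. 0 \<le> u \<and> u < int p \<and> int p dvd snd v + fst v * u" by blast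
  from someI_ex[OF this] show "0 \<le> slope p v" "slope p v < int p" "int p dvd snd v + fst v * slope p v"
    using assms(2) by (auto simp: slope_def)
qed

text \<open>The zero class of the plane over the field with \<open>p\<close> elements, not the plane
  itself.\<close>

definition plane :: "nat \<Rightarrow> (int \<times> int) set" where
  "plane p = {v. int p dvd fst v \<and> int p dvd snd v}"

lemma slope_infinite_iff: "prime p \<Longrightarrow> slope p v = -1 \<longleftrightarrow> int p dvd fst v"
  using slope_finite(1)[of p v] by (auto simp: slope_def)

lemma slope_det:
  assumes p: "prime p" and v: "v \<notin> plane p" and w: "w \<notin> plane p" and ne: "slope p v \<noteq> slope p w"
  shows "\<not> int p dvd fst v * snd w - fst w * snd v"
proof
  assume det: "int p dvd fst v * snd w - fst w * snd v"
  show False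
  proof (cases "int p dvd fst v")
    case True
    then have "\<not> int p dvd snd v" using v by (simp add: plane_def)
    moreover have "\<not> int p dvd fst w" using True ne by (auto simp: slope_def)
    moreover have "int p dvd fst w * snd v"
      using det True by (meson dvd_diff_right_iff dvd_mult2)
    ultimately show False using p by (simp add: prime_dvd_mult_iff)
  next
    case fv: False
    note sv = slope_finite[OF p fv]
    show False
    proof (cases "int p dvd fst w")
      case True
      then have "\<not> int p dvd snd w" using w by (simp add: plane_def)
      moreover have "int p dvd fst v * snd w"
        using det True by (meson dvd_diff_left_iff dvd_mult2)
      ultimately show False using p fv by (simp add: prime_dvd_mult_iff)
    next
      case fw: False
      note sw = slope_finite[OF p fw]
      have "int p dvd (fst v * snd w - fst w * snd v) + (fst w * (snd v + fst v * slope p v)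
          - fst v * (snd w + fst w * slope p w))"
        by (rule dvd_add[OF det dvd_diff[OF dvd_mult[OF sv(3)] dvd_mult[OF sw(3)]]])
      moreover have "(fst v * snd w - fst w * snd v) + (fst w * (snd v + fst v * slope p v)
          - fst v * (snd w + fst w * slope p w)) = fst v * fst w * (slope p v - slope p w)"
        by (simp add: algebra_simps)
      ultimately have "int p dvd slope p v - slope p w"
        using p fv fw by (simp add: prime_dvd_mult_iff)
      then have "slope p v mod int p = slope p w mod int p" by (simp add: mod_eq_dvd_iff)
      then show False using ne sv sw by simp
    qed
  qed
qed

text \<open>A form of finite slope is \<open>a j\<close> times x - slope modulo \<open>p\<close>; a
  form of slope -1 has become the constant \<open>b j\<close> on setting y = 1 and affects only the
  scalar.\<close>

lemma lin_prod_slopes: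
  assumes p: "prime p" and "finite R" and "\<And>i. i \<in> R \<Longrightarrow> (a i, b i) \<notin> plane p"
  defines "s \<equiv> \<lambda>i. slope p (a i, b i)"
  shows "\<exists>c. \<not> int p dvd c \<and>
    pdvd p (lin_prod a b R - smult c (root_prod (s ` R - {-1}) (\<lambda>u. card {i \<in> R. s i = u})))"
  using assms(2,3)
proof (induction R rule: finite_induct)
  case empty
  then show ?case using p by (intro exI[of _ 1]) (auto simp: lin_prod_def root_prod_def one_pCons)
next
  case (insert j R)
  let ?m = "\<lambda>R u. card {i \<in> R. s i = u}"
  let ?F = "\<lambda>R. root_prod (s ` R - {-1}) (?m R)"
  obtain c where c: "\<not> int p dvd c" "pdvd p (lin_prod a b R - smult c (?F R))"
    using insert by blast
  have grow: "?m (insert j R) u = (if u = s j then Suc (?m R u) else ?m R u)" for u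
  proof -
    have "{i \<in> insert j R. s i = u} = (if u = s j then insert j {i \<in> R. s i = u} else {i \<in> R. s i = u})"
      by auto
    then show ?thesis using insert.hyps by simp
  qed
  show ?case
  proof (cases "int p dvd a j")
    case True
    then have sj: "s j = -1" by (simp add: s_def slope_def)
    have bj: "\<not> int p dvd b j" using True insert.prems[of j] by (simp add: plane_def)
    have "?F (insert j R) = ?F R"
      unfolding root_prod_def grow by (rule prod.cong) (auto simp: sj)
    moreover have "pdvd p (lin_prod a b (insert j R) - smult (b j * c) (?F R))"
    proof -
      have "lin_prod a b (insert j R) - smult (b j * c) (?F R) =
          [:0, a j:] * lin_prod a b R + smult (b j) (lin_prod a b R - smult c (?F R))"
        by (simp add: lin_prod_insert[OF insert.hyps] smult_diff_right)
      moreover have "pdvd p [:0, a j:]" using True by (simp add: pdvd_iff coeff_pCons split: nat.split)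
      ultimately show ?thesis using c(2) by (simp only: dvd_add dvd_mult2 dvd_smult)
    qed
    ultimately show ?thesis using c bj p by (intro exI[of _ "b j * c"]) (simp add: prime_dvd_mult_iff)
  next
    case False
    have sl: "0 \<le> s j" "int p dvd b j + a j * s j"
      using slope_finite[OF p, of "(a j, b j)"] False by (simp_all add: s_def)
    let ?u = "s j"
    have F: "?F (insert j R) = [:- ?u, 1:] * ?F R"
    proof -
      have u: "?u \<noteq> -1" using sl by simp
      have fin: "finite (s ` R - {-1})" using insert.hyps by simp
      have rem: "root_prod W m = [:- ?u, 1:] ^ m ?u * root_prod (W - {?u}) m" if "finite W" "?u \<in> W" for W m
        using that unfolding root_prod_def by (rule prod.remove)
      have same: "root_prod (s ` R - {-1} - {?u}) (?m (insert j R)) = root_prod (s ` R - {-1} - {?u}) (?m R)"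
        unfolding root_prod_def grow by (rule prod.cong) auto
      have "?F (insert j R) = [:- ?u, 1:] ^ Suc (?m R ?u) * root_prod (s ` R - {-1} - {?u}) (?m R)"
      proof -
        have W: "s ` insert j R - {-1} = insert ?u (s ` R - {-1} - {?u})" using u by auto
        have "?F (insert j R) = [:- ?u, 1:] ^ ?m (insert j R) ?u *
            root_prod (s ` R - {-1} - {?u}) (?m (insert j R))"
          unfolding W using fin by (subst rem) auto
        then show ?thesis unfolding same unfolding grow by simp
      qed
      also have "\<dots> = [:- ?u, 1:] * ([:- ?u, 1:] ^ ?m R ?u * root_prod (s ` R - {-1} - {?u}) (?m R))"
        by (simp only: power_Suc mult.assoc)
      also have "[:- ?u, 1:] ^ ?m R ?u * root_prod (s ` R - {-1} - {?u}) (?m R) = ?F R"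
      proof (cases "?u \<in> s ` R")
        case True
        then show ?thesis using u fin by (subst rem[of "s ` R - {-1}"]) auto
      next
        case False
        then have "{i \<in> R. s i = ?u} = {}" by (auto simp: image_iff)
        then have "?m R ?u = 0" by (simp only: card.empty)
        moreover have "s ` R - {-1} - {?u} = s ` R - {-1}" using False by auto
        ultimately show ?thesis by (simp only: power_0 mult_1)
      qed
      finally show ?thesis .
    qed
    have "pdvd p (lin_prod a b (insert j R) - smult (a j * c) (?F (insert j R)))"
    proof -
      have "lin_prod a b (insert j R) - smult (a j * c) (?F (insert j R)) =
          [:b j + a j * ?u:] * lin_prod a b R +
          smult (a j) ([:- ?u, 1:] * (lin_prod a b R - smult c (?F R)))"
        unfolding F by (simp add: lin_prod_insert[OF insert.hyps] algebra_simps smult_diff_right smult_add_left smult_add_right)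
      moreover have "pdvd p [:b j + a j * ?u:]" using sl by (simp add: const_poly_dvd_const_poly_iff)
      ultimately show ?thesis using c(2) by (simp only: dvd_add dvd_mult2 dvd_mult dvd_smult)
    qed
    then show ?thesis using c False p by (intro exI[of _ "a j * c"]) (simp add: prime_dvd_mult_iff)
  qed
qed

text \<open>One vector of each slope is removed; let \<open>R\<close> be the rest. If the product
  over R were outside the ideal of \<open>frob_form\<close>, take a largest set J between R and I
  with this property. At degree 2p - 2 it would be the wanted set. Below, at least two vectors are
  left outside J; they were removed, so their slopes differ, and since multiplying by either form
  leads into the ideal, J would be in it too. Hence the product over R is in the ideal. But its
  roots have multiplicity below \<open>p\<close>, and card R plus the number of its slopes is at
  most 2p - 1, which the lacunary argument excludes.\<close>

lemma ex_nonzero_top_coeff: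
  assumes p: "prime p" and fin: "finite I" and card: "card I = 2 * (p - 1) + 1"
    and nz: "\<And>i. i \<in> I \<Longrightarrow> (a i, b i) \<notin> plane p"
    and lines: "\<And>c. card {i \<in> I. slope p (a i, b i) = c} \<le> p"
  shows "\<exists>J\<subseteq>I. card J = 2 * (p - 1) \<and> \<not> int p dvd coeff (lin_prod a b J) (p - 1)"
proof (rule ccontr)
  assume none: "\<not> ?thesis"
  define s where "s i = slope p (a i, b i)" for i
  define rep where "rep c = (SOME i. i \<in> I \<and> s i = c)" for c
  have rep: "rep c \<in> I \<and> s (rep c) = c" if "c \<in> s ` I" for c
    unfolding rep_def by (rule someI_ex) (use that in auto)
  define K where "K = rep ` s ` I"
  have KI: "K \<subseteq> I" using rep by (auto simp: K_def)
  have injK: "inj_on s K" using rep by (auto simp: K_def intro!: inj_onI)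
  have finK: "finite K" using fin by (simp add: K_def)
  have "s ` K = (\<lambda>c. s (rep c)) ` (s ` I)" unfolding K_def by (rule image_image)
  also have "\<dots> = id ` (s ` I)" by (rule image_cong) (use rep in auto)
  finally have sK: "s ` K = s ` I" by simp
  define R where "R = I - K"
  have finR: "finite R" using fin by (simp add: R_def)
  have p2: "p \<ge> 2" using p by (rule prime_ge_2_nat)
  have frobR: "frob_form p (card R) (lin_prod a b R)"
  proof (rule ccontr)
    assume bad: "\<not> frob_form p (card R) (lin_prod a b R)"
    define Q where "Q J \<longleftrightarrow> R \<subseteq> J \<and> J \<subseteq> I \<and> \<not> frob_form p (card J) (lin_prod a b J)" for J
    have QR: "Q R" using bad by (auto simp: Q_def R_def)
    have bound: "\<forall>J. Q J \<longrightarrow> card J < Suc (card I)"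
      using fin by (auto simp: Q_def less_Suc_eq_le intro: card_mono)
    obtain J where "Q J \<and> (\<forall>J'. Q J' \<longrightarrow> card J' \<le> card J)"
      using ex_has_greatest_nat[OF QR bound] by (elim exE)
    then have J: "Q J" and max: "\<And>J'. Q J' \<Longrightarrow> card J' \<le> card J" by simp_all
    have finJ: "finite J" using J fin by (auto simp: Q_def dest: finite_subset)
    have JI: "J \<subseteq> I" "R \<subseteq> J" using J by (auto simp: Q_def)
    have ext: "frob_form p (Suc (card J)) ([:b j, a j:] * lin_prod a b J)" if j: "j \<in> I - J" for j
    proof (rule ccontr)
      assume "\<not> ?thesis"
      then have "Q (insert j J)"
        using j J finJ by (auto simp: Q_def lin_prod_insert)
      then show False using max[of "insert j J"] j finJ by auto
    qed
    have small: "card J < 2 * (p - 1)"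
    proof (rule ccontr)
      assume "\<not> ?thesis"
      then consider "card J = 2 * (p - 1)" | "card J > 2 * (p - 1)" by linarith
      then show False
      proof cases
        case 1
        then have "int p dvd coeff (lin_prod a b J) (p - 1)" using none JI by blast
        moreover have "i = p - 1" if "i < p" "card J < i + p" for i using that 1 by linarith
        ultimately have "frob_form p (card J) (lin_prod a b J)" unfolding frob_form_def by blast
        then show False using J by (simp add: Q_def)
      next
        case 2
        then have "frob_form p (card J) (lin_prod a b J)" using p2 by (auto simp: frob_form_def)
        then show False using J by (simp add: Q_def)
      qed
    qed
    have "card (I - J) = card I - card J" using JI finJ by (simp add: card_Diff_subset)
    then have "2 \<le> card (I - J)" using small card by linarith
    then obtain U where U: "U \<subseteq> I - J" "card U = 2" by (rule obtain_subset_with_card_n)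
    then obtain i j where ij: "i \<in> I - J" "j \<in> I - J" "i \<noteq> j" by (auto simp: card_2_iff)
    then have "i \<in> K" "j \<in> K" using JI by (auto simp: R_def)
    then have "s i \<noteq> s j" using injK ij by (auto dest: inj_onD)
    then have "\<not> int p dvd a i * b j - a j * b i"
      using slope_det[OF p nz[of i] nz[of j]] ij by (simp add: s_def)
    then have "frob_form p (card J) (lin_prod a b J)"
      using frob_form_two_multiples[OF p small ext[OF ij(1)] ext[OF ij(2)]] by simp
    then show False using J by (simp add: Q_def)
  qed
  define V where "V = s ` R - {-1}"
  define m where "m u = card {i \<in> R. s i = u}" for u
  obtain c where c: "\<not> int p dvd c" "pdvd p (lin_prod a b R - smult c (root_prod V m))"
    using lin_prod_slopes[OF p finR, of a b] nz unfolding V_def m_def s_def R_def by blast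
  have frob: "frob_form p (card R) (root_prod V m)"
    by (rule frob_form_smult[OF p c(1)]) (rule frob_form_cong[OF c(2) frobR])
  have m_lt: "m u < p" if "u \<in> s ` I" for u
  proof -
    have "{i \<in> R. s i = u} \<subset> {i \<in> I. s i = u}" using rep[OF that] that by (auto simp: R_def K_def)
    then have "m u < card {i \<in> I. s i = u}" unfolding m_def using fin by (intro psubset_card_mono) auto
    then show ?thesis using lines[of u] by (simp add: s_def)
  qed
  have "\<not> frob_form p (card R) (root_prod V m)"
  proof (rule not_frob_form_root_prod[OF p, where t = "m (-1)"])
    show "finite V" using finR by (simp add: V_def)
    show "0 < m u \<and> m u < p" if "u \<in> V" for u
    proof -
      have "{i \<in> R. s i = u} \<noteq> {}" using that by (auto simp: V_def)
      then have "0 < m u" unfolding m_def using finR by (simp add: card_gt_0_iff)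
      moreover have "u \<in> s ` I" using that by (auto simp: V_def R_def)
      ultimately show ?thesis using m_lt by blast
    qed
    show "u = v" if "u \<in> V" "v \<in> V" "int p dvd u - v" for u v
    proof -
      have range: "0 \<le> w \<and> w < int p" if "w \<in> V" for w
        using that slope_finite[OF p] by (force simp: V_def s_def slope_def split: if_splits)
      have "u mod int p = v mod int p" using that(3) by (simp add: mod_eq_dvd_iff)
      then show ?thesis using range[OF that(1)] range[OF that(2)] by simp
    qed
    show "m (-1) < p"
    proof (cases "-1 \<in> s ` I")
      case False
      then have "{i \<in> R. s i = -1} = {}" by (auto simp: R_def image_iff)
      then have "m (-1) = 0" by (simp only: m_def card.empty)
      then show ?thesis using p2 by simp
    qed (rule m_lt)
    show "card R = sum m V + m (-1)"
    proof -
      have "s ` R \<subseteq> insert (-1) V" by (auto simp: V_def)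
      moreover have "finite (insert (-1) V)" using finR by (simp add: V_def)
      ultimately have "(\<Sum>u\<in>insert (-1) V. sum (\<lambda>_. 1) {i \<in> R. s i = u}) = sum (\<lambda>_. 1 :: nat) R"
        using finR by (intro sum.group) auto
      then have "card R = (\<Sum>u\<in>insert (-1) V. card {i \<in> R. s i = u})" by simp
      then have "card R = sum m (insert (-1) V)" by (simp add: m_def[abs_def])
      moreover have "finite V" "-1 \<notin> V" using finR by (simp_all add: V_def)
      ultimately show ?thesis by simp
    qed
    have "card R = card I - card K" using KI finK by (simp add: R_def card_Diff_subset)
    moreover have "card K \<le> card I" using KI fin by (rule card_mono[rotated])
    moreover have "card V \<le> card K"
    proof -
      have "V \<subseteq> s ` K" unfolding sK by (auto simp: V_def R_def)
      then show ?thesis using finK by (meson card_image_le card_mono finite_imageI le_trans)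
    qed
    ultimately show "card R + card V \<le> 2 * p" using card p2 by linarith
  qed
  then show False using frob by blast
qed

section \<open>Blocks of a unique factorization sequence and the exchange argument\<close>

definition null_set :: "nat \<Rightarrow> ('i \<Rightarrow> int) \<Rightarrow> ('i \<Rightarrow> int) \<Rightarrow> 'i set \<Rightarrow> bool" where
  "null_set p a b Y \<longleftrightarrow> int p dvd sum a Y \<and> int p dvd sum b Y"

lemma null_set_diff:
  assumes "null_set p a b X" "null_set p a b Y" "Y \<subseteq> X" "finite X"
  shows "null_set p a b (X - Y)"
  using assms by (simp add: null_set_def sum_diff)

text \<open>Under unique factorization these are the atoms: the minimal nonempty zero-sum subsets,
  which are pairwise disjoint.\<close>

definition block :: "nat \<Rightarrow> ('i \<Rightarrow> int) \<Rightarrow> ('i \<Rightarrow> int) \<Rightarrow> 'i set \<Rightarrow> 'i set \<Rightarrow> bool" where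
  "block p a b I B \<longleftrightarrow> B \<subseteq> I \<and> B \<noteq> {} \<and> null_set p a b B \<and>
     (\<forall>Y\<subseteq>I. null_set p a b Y \<longrightarrow> Y \<inter> B = {} \<or> B \<subseteq> Y)"

lemma blockD: "block p a b I B \<Longrightarrow> Y \<subseteq> I \<Longrightarrow> null_set p a b Y \<Longrightarrow> Y \<inter> B = {} \<or> B \<subseteq> Y"
  by (simp add: block_def)

lemma null_count_alt:
  "null_count p a b J = (\<Sum>Y\<in>{Y. Y \<subseteq> J \<and> null_set p a b Y}. (-1) ^ card Y)"
  unfolding null_count_def null_set_def by (rule sum.cong) auto

lemma null_count_block_not_subset:
  assumes "block p a b I B" "R \<subseteq> I" "\<not> B \<subseteq> R"
  shows "null_count p a b R = null_count p a b (R - B)"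
proof -
  have "Y \<inter> B = {}" if "Y \<subseteq> R" "null_set p a b Y" for Y
    using blockD[OF assms(1) subset_trans[OF that(1) assms(2)] that(2)] that(1) assms(3) by blast
  then have "{Y. Y \<subseteq> R \<and> null_set p a b Y} = {Y. Y \<subseteq> R - B \<and> null_set p a b Y}" by blast
  then show ?thesis by (simp only: null_count_alt)
qed

text \<open>The zero-sum subsets of \<open>R\<close> are those of \<open>R - B\<close>, each taken
  with or without \<open>B\<close>; adding \<open>B\<close> multiplies the sign by (-1)^card
  B.\<close>

lemma null_count_block_subset:
  assumes B: "block p a b I B" and R: "R \<subseteq> I" "finite R" and BR: "B \<subseteq> R"
  shows "null_count p a b R = null_count p a b (R - B) * (1 + (-1) ^ card B)"
proof -
  let ?N = "\<lambda>R. {Y. Y \<subseteq> R \<and> null_set p a b Y}"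
  have finB: "finite B" using R BR by (auto dest: finite_subset)
  have B0: "B \<noteq> {}" "null_set p a b B" using B by (auto simp: block_def)
  have split: "?N R = ?N (R - B) \<union> (\<lambda>Y. Y \<union> B) ` ?N (R - B)"
  proof (intro equalityI subsetI)
    fix Y assume Y: "Y \<in> ?N R"
    then consider "Y \<inter> B = {}" | "B \<subseteq> Y" using blockD[OF B, of Y] R by auto
    then show "Y \<in> ?N (R - B) \<union> (\<lambda>Y. Y \<union> B) ` ?N (R - B)"
    proof cases
      case 2
      have "finite Y" using Y R by (auto dest: finite_subset)
      then have "Y - B \<in> ?N (R - B)" using Y 2 B0 null_set_diff[of p a b Y B] by auto
      moreover have "Y = (Y - B) \<union> B" using 2 by auto
      ultimately show ?thesis by blast
    qed (use Y in auto)
  next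
    fix Y assume "Y \<in> ?N (R - B) \<union> (\<lambda>Y. Y \<union> B) ` ?N (R - B)"
    then consider "Y \<in> ?N (R - B)" | Z where "Z \<in> ?N (R - B)" "Y = Z \<union> B" by blast
    then show "Y \<in> ?N R"
    proof cases
      case 2
      have "finite Z" using 2 R by (auto dest: finite_subset)
      then have "sum f (Z \<union> B) = sum f Z + sum f B" for f :: "'a \<Rightarrow> int"
        using 2 finB by (intro sum.union_disjoint) auto
      then show ?thesis using 2 B0 BR by (auto simp: null_set_def)
    qed auto
  qed
  have finN: "finite (?N (R - B))" using R by (auto intro: finite_subset[of _ "Pow R"])
  have inj: "inj_on (\<lambda>Y. Y \<union> B) (?N (R - B))" by (auto intro!: inj_onI)
  have "null_count p a b R = (\<Sum>Y\<in>?N (R - B). (-1) ^ card Y) +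
      (\<Sum>Y\<in>(\<lambda>Y. Y \<union> B) ` ?N (R - B). (-1) ^ card Y)"
    unfolding null_count_alt split using finN B0 by (intro sum.union_disjoint) auto
  also have "(\<Sum>Y\<in>(\<lambda>Y. Y \<union> B) ` ?N (R - B). (-1) ^ card Y) =
      (\<Sum>Y\<in>?N (R - B). (-1) ^ card (Y \<union> B) :: int)"
    using inj by (simp add: sum.reindex)
  also have "\<dots> = (\<Sum>Y\<in>?N (R - B). (-1) ^ card Y * (-1) ^ card B)"
  proof (rule sum.cong[OF refl])
    fix Y assume Y: "Y \<in> ?N (R - B)"
    then have "finite Y" using R by (auto dest: finite_subset)
    then have "card (Y \<union> B) = card Y + card B" using Y finB by (intro card_Un_disjoint) auto
    then show "(-1 :: int) ^ card (Y \<union> B) = (-1) ^ card Y * (-1) ^ card B" by (simp add: power_add)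
  qed
  finally show ?thesis
    by (simp add: null_count_alt sum_distrib_right[symmetric] algebra_simps)
qed

text \<open>A smallest zero-sum set through \<open>d\<close> works: a zero-sum set cutting it
  properly would leave a smaller one through \<open>d\<close>, either the intersection or its
  complement.\<close>

lemma block_exists:
  assumes fin: "finite I" and uf: "\<And>X Y. X \<subseteq> I \<Longrightarrow> Y \<subseteq> I \<Longrightarrow> null_set p a b X \<Longrightarrow> null_set p a b Y \<Longrightarrow> null_set p a b (X \<inter> Y)"
    and Y0: "Y0 \<subseteq> I" "null_set p a b Y0" "d \<in> Y0"
  shows "\<exists>B\<subseteq>Y0. d \<in> B \<and> block p a b I B"
proof -
  define Q where "Q Y \<longleftrightarrow> Y \<subseteq> Y0 \<and> null_set p a b Y \<and> d \<in> Y" for Y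
  have Q0: "Q Y0" using Y0 by (simp add: Q_def)
  obtain B where B: "Q B \<and> (\<forall>Y. Q Y \<longrightarrow> card B \<le> card Y)"
    using ex_has_least_nat[where P = Q and m = card, OF Q0] by (elim exE)
  then have QB: "Q B" and min: "\<And>Y. Q Y \<Longrightarrow> card B \<le> card Y" by simp_all
  have BI: "B \<subseteq> I" "finite B" using QB Y0 fin by (auto simp: Q_def dest: finite_subset)
  have "Y \<inter> B = {} \<or> B \<subseteq> Y" if Y: "Y \<subseteq> I" "null_set p a b Y" for Y
  proof (cases "d \<in> Y")
    case True
    have "null_set p a b (Y \<inter> B)" using uf Y BI QB by (simp add: Q_def)
    then have "Q (Y \<inter> B)" using QB True by (auto simp: Q_def)
    then have "card B \<le> card (Y \<inter> B)" by (rule min)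
    then have "Y \<inter> B = B" using BI by (intro card_seteq) auto
    then show ?thesis by blast
  next
    case False
    have "null_set p a b (Y \<inter> B)" using uf Y BI QB by (simp add: Q_def)
    then have "null_set p a b (B - (Y \<inter> B))" using QB BI by (intro null_set_diff) (auto simp: Q_def)
    then have "Q (B - (Y \<inter> B))" using QB False by (auto simp: Q_def)
    then have "card B \<le> card (B - (Y \<inter> B))" by (rule min)
    then have "B - (Y \<inter> B) = B" using BI by (intro card_seteq) auto
    then show ?thesis by blast
  qed
  then have "block p a b I B" using QB BI by (auto simp: block_def Q_def)
  then show ?thesis using QB by (auto simp: Q_def)
qed

text \<open>Once \<open>d\<close> is added, the signed count vanishes modulo \<open>p\<close>; for
  \<open>J\<close> it does not, so a zero-sum set and hence a block B passes through
  \<open>d\<close>. The count for \<open>insert d J\<close> is that for \<open>J - B\<close> times 1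
  + (-1)^card B, and the first factor equals the count for \<open>J\<close> because B is not inside
  \<open>J\<close>.\<close>

lemma zero_block:
  assumes p: "prime p" and fin: "finite I" and uf: "\<And>X Y. X \<subseteq> I \<Longrightarrow> Y \<subseteq> I \<Longrightarrow> null_set p a b X \<Longrightarrow> null_set p a b Y \<Longrightarrow> null_set p a b (X \<inter> Y)"
    and J: "J \<subseteq> I" "card J = 2 * (p - 1)" "\<not> int p dvd null_count p a b J" and d: "d \<in> I - J"
  obtains B where "block p a b I B" "B \<subseteq> insert d J" "d \<in> B" "int p dvd 1 + (-1) ^ card B"
    "null_count p a b (J - B) = null_count p a b J"
proof -
  have finJ: "finite J" using J fin by (auto dest: finite_subset)
  have big: "int p dvd null_count p a b (insert d J)"
    using d finJ J by (intro null_count_large[OF p]) auto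
  have "\<exists>Y. Y \<subseteq> insert d J \<and> null_set p a b Y \<and> d \<in> Y"
  proof (rule ccontr)
    assume "\<not> ?thesis"
    then have "{Y. Y \<subseteq> insert d J \<and> null_set p a b Y} = {Y. Y \<subseteq> J \<and> null_set p a b Y}" by blast
    then have "null_count p a b (insert d J) = null_count p a b J" by (simp only: null_count_alt)
    then show False using big J by simp
  qed
  then obtain Y0 where Y0: "Y0 \<subseteq> insert d J" "null_set p a b Y0" "d \<in> Y0" by blast
  have Y0I: "Y0 \<subseteq> I" using Y0 J d by blast
  obtain B where B: "B \<subseteq> Y0" "d \<in> B" "block p a b I B"
    using block_exists[OF fin uf Y0I Y0(2,3)] by blast
  have BJ: "B \<subseteq> insert d J" using B Y0 by blast
  have "\<not> B \<subseteq> J" using B d by blast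
  then have 1: "null_count p a b J = null_count p a b (J - B)"
    using null_count_block_not_subset[OF B(3) J(1)] by blast
  have "insert d J - B = J - B" using B by blast
  then have "null_count p a b (insert d J) = null_count p a b (J - B) * (1 + (-1) ^ card B)"
    using null_count_block_subset[OF B(3) _ _ BJ] d J finJ by simp
  then have "int p dvd 1 + (-1) ^ card B"
    using big J(3) p by (simp add: 1 prime_dvd_mult_iff)
  then show ?thesis using that B BJ 1 by simp
qed

text \<open>A term \<open>d'\<close> of the block B of \<open>d\<close> is dropped from
  \<open>J\<close>. The count after inserting \<open>e\<close> in its place is, up to a unit modulo
  \<open>p\<close>, linear in (\<open>a e\<close>, \<open>b e\<close>); this is the functional. For
  e = d the block B is still incomplete, so the count is that for \<open>J - B\<close>, which is
  nonzero. For any other e the block C of \<open>e\<close> is disjoint from B, survives the removal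
  of \<open>d'\<close>, and its factor 1 + (-1)^card C makes the count vanish.\<close>

lemma null_count_swap_functional:
  assumes p: "prime p" and fin: "finite I" and uf: "\<And>X Y. X \<subseteq> I \<Longrightarrow> Y \<subseteq> I \<Longrightarrow> null_set p a b X \<Longrightarrow> null_set p a b Y \<Longrightarrow> null_set p a b (X \<inter> Y)"
    and nz: "\<And>i. i \<in> I \<Longrightarrow> (a i, b i) \<notin> plane p"
    and J: "J \<subseteq> I" "card J = 2 * (p - 1)" "\<not> int p dvd null_count p a b J" and d: "d \<in> I - J"
  shows "\<exists>u v. \<not> int p dvd u * a d + v * b d \<and> (\<forall>e\<in>I - J - {d}. int p dvd u * a e + v * b e)"
proof -
  have finJ: "finite J" using J fin by (auto dest: finite_subset)
  have p2: "p \<ge> 2" using p by (rule prime_ge_2_nat)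
  obtain B where B: "block p a b I B" "B \<subseteq> insert d J" "d \<in> B" "int p dvd 1 + (-1) ^ card B"
    "null_count p a b (J - B) = null_count p a b J"
    by (rule zero_block[OF p fin uf J d])
  have "B \<noteq> {d}"
    using B(1) nz[of d] d by (auto simp: block_def null_set_def plane_def)
  then obtain d' where d': "d' \<in> B" "d' \<noteq> d" using B(3) by blast
  then have d'J: "d' \<in> J" using B(2) by blast
  define R where "R = J - {d'}"
  have R: "finite R" "R \<subseteq> I" "card R = 2 * (p - 1) - 1"
    using finJ J d'J by (auto simp: R_def)
  define u where "u = coeff (lin_prod a b R) (p - 2)"
  define v where "v = coeff (lin_prod a b R) (p - 1)"
  have fun_iff: "int p dvd null_count p a b (insert e R) \<longleftrightarrow> int p dvd u * a e + v * b e"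
    if e: "e \<notin> R" for e
  proof -
    have "card (insert e R) = 2 * (p - 1)" using R e p2 by simp
    then have "int p dvd null_count p a b (insert e R) \<longleftrightarrow>
        int p dvd coeff (lin_prod a b (insert e R)) (p - 1)"
      using R by (intro null_count_top[OF p]) auto
    also have "coeff (lin_prod a b (insert e R)) (p - 1) = b e * v + a e * u"
      unfolding lin_prod_insert[OF R(1) e] coeff_linear_mult u_def v_def
      using p2 by (simp add: numeral_2_eq_2)
    finally show ?thesis by (simp add: algebra_simps)
  qed
  have 1: "\<not> int p dvd u * a d + v * b d"
  proof -
    have "\<not> B \<subseteq> insert d R" using d' by (auto simp: R_def)
    then have "null_count p a b (insert d R) = null_count p a b (insert d R - B)"
      using null_count_block_not_subset[OF B(1), of "insert d R"] d R by blast
    also have "insert d R - B = J - B" using d' B(3) by (auto simp: R_def)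
    finally have "\<not> int p dvd null_count p a b (insert d R)" using B(5) J(3) by simp
    then show ?thesis using fun_iff[of d] d by (auto simp: R_def)
  qed
  have 2: "int p dvd u * a e + v * b e" if e: "e \<in> I - J" "e \<noteq> d" for e
  proof -
    obtain C where C: "block p a b I C" "C \<subseteq> insert e J" "e \<in> C" "int p dvd 1 + (-1) ^ card C"
      by (rule zero_block[OF p fin uf J e(1)])
    have "C \<subseteq> I" "null_set p a b C" using C(1) by (simp_all add: block_def)
    then have "C \<inter> B = {} \<or> B \<subseteq> C" by (rule blockD[OF B(1)])
    moreover have "d \<notin> C" using C(2) d e by blast
    ultimately have "C \<inter> B = {}" using B(3) by blast
    then have CR: "C \<subseteq> insert e R" using C(2) d' by (auto simp: R_def)
    have "null_count p a b (insert e R) = null_count p a b (insert e R - C) * (1 + (-1) ^ card C)"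
      using null_count_block_subset[OF C(1) _ _ CR] e R by simp
    then have "int p dvd null_count p a b (insert e R)" using C(4) by simp
    then show ?thesis using fun_iff[of e] e by (auto simp: R_def)
  qed
  show ?thesis using 1 2 by blast
qed

text \<open>Each line through 0 carries at most \<open>p\<close> terms by the cyclic case, so a set
  J of 2p - 2 terms with nonzero coefficient exists. With three terms x, y, z outside it, the
  functional of x kills y and z, so these are linearly dependent; that of y kills z but not y, so z
  would be 0.\<close>

lemma uf_rank_two_card_le:
  fixes f :: "'i \<Rightarrow> int \<times> int"
  assumes p: "prime p" and fin: "finite I" and nz: "\<And>i. i \<in> I \<Longrightarrow> f i \<notin> plane p"
    and uf: "uf (plane p) I f"
  shows "card I \<le> 2 * p"
proof (rule ccontr)
  assume big: "\<not> card I \<le> 2 * p"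
  define a where "a i = fst (f i)" for i
  define b where "b i = snd (f i)" for i
  have f: "f i = (a i, b i)" for i by (simp add: a_def b_def)
  have null: "null_set p a b X \<longleftrightarrow> sum f X \<in> plane p" for X
    by (simp add: null_set_def plane_def fst_sum snd_sum a_def b_def)
  have uf': "null_set p a b (X \<inter> Y)" if "X \<subseteq> I" "Y \<subseteq> I" "null_set p a b X" "null_set p a b Y" for X Y
    using ufD[OF uf that(1,2)] that(3,4) by (simp add: null)
  have nz': "(a i, b i) \<notin> plane p" if "i \<in> I" for i using nz[OF that] by (simp add: f)
  have lines: "card {i \<in> I. slope p (a i, b i) = c} \<le> p" for c
  proof (cases "c = -1")
    case True
    let ?I = "{i \<in> I. slope p (a i, b i) = c}"
    have a: "int p dvd a i" if "i \<in> ?I" for i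
      using that True slope_infinite_iff[OF p, of "(a i, b i)"] by simp
    show ?thesis
    proof (rule uf_cyclic_card_le[OF p, of _ b])
      show "\<not> int p dvd b i" if "i \<in> ?I" for i using nz'[of i] a[OF that] that by (auto simp: plane_def)
      have "sum b X \<in> multiples p \<longleftrightarrow> sum f X \<in> plane p" if "X \<subseteq> ?I" for X
      proof -
        have "int p dvd sum a X" by (rule dvd_sum) (use that a in blast)
        then show ?thesis by (simp add: null[symmetric] null_set_def multiples_def)
      qed
      then show "uf (multiples p) ?I b"
        by (intro uf_cong_sums[OF uf_subset[OF uf]]) auto
    qed (use fin in auto)
  next
    case False
    let ?I = "{i \<in> I. slope p (a i, b i) = c}"
    have a: "\<not> int p dvd a i \<and> int p dvd b i + a i * c" if "i \<in> ?I" for i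
      using that False slope_infinite_iff[OF p, of "(a i, b i)"] slope_finite(3)[OF p, of "(a i, b i)"] by auto
    show ?thesis
    proof (rule uf_cyclic_card_le[OF p, of _ a])
      show "\<not> int p dvd a i" if "i \<in> ?I" for i using a[OF that] by simp
      have "sum a X \<in> multiples p \<longleftrightarrow> sum f X \<in> plane p" if "X \<subseteq> ?I" for X
      proof -
        have "int p dvd (\<Sum>i\<in>X. b i + a i * c)" using that a by (intro dvd_sum) auto
        then have "int p dvd sum b X + sum a X * c" by (simp add: sum.distrib sum_distrib_right)
        then have "int p dvd sum b X" if "int p dvd sum a X"
          using that by (meson dvd_add_left_iff dvd_mult2)
        then show ?thesis by (auto simp: null[symmetric] null_set_def multiples_def)
      qed
      then show "uf (multiples p) ?I a"
        by (intro uf_cong_sums[OF uf_subset[OF uf]]) auto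
    qed (use fin in auto)
  qed
  have p2: "p \<ge> 2" using p by (rule prime_ge_2_nat)
  have "2 * (p - 1) + 1 \<le> card I" using big by simp
  then obtain I0 where I0: "I0 \<subseteq> I" "card I0 = 2 * (p - 1) + 1" by (rule obtain_subset_with_card_n)
  have finI0: "finite I0" using I0 fin by (auto dest: finite_subset)
  have "card {i \<in> I0. slope p (a i, b i) = c} \<le> p" for c
    using lines[of c] card_mono[of "{i \<in> I. slope p (a i, b i) = c}" "{i \<in> I0. slope p (a i, b i) = c}"] I0 fin
    by fastforce
  then obtain J where J0: "J \<subseteq> I0" "card J = 2 * (p - 1)" "\<not> int p dvd coeff (lin_prod a b J) (p - 1)"
    using ex_nonzero_top_coeff[OF p finI0 I0(2), of a b] nz' I0(1) by blast
  have J: "J \<subseteq> I" using J0 I0 by blast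
  have finJ: "finite J" using J fin by (auto dest: finite_subset)
  have N: "\<not> int p dvd null_count p a b J" using null_count_top[OF p finJ J0(2), of a b] J0(3) by simp
  have "card (I - J) = card I - card J" using J finJ by (simp add: card_Diff_subset)
  then have "3 \<le> card (I - J)" using big J0(2) p2 by linarith
  then obtain U where U: "U \<subseteq> I - J" "card U = 3" by (rule obtain_subset_with_card_n)
  then obtain x y z where xyz: "x \<in> I - J" "y \<in> I - J" "z \<in> I - J" "x \<noteq> y" "y \<noteq> z" "x \<noteq> z"
    unfolding card_3_iff by auto
  have "\<exists>u v. \<not> int p dvd u * a x + v * b x \<and>
    (\<forall>e\<in>I - J - {x}. int p dvd u * a e + v * b e)"
    by (rule null_count_swap_functional[OF p fin _ _ J J0(2) N xyz(1)]) (rule uf' nz'; assumption)+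
  then obtain u v where "\<not> int p dvd u * a x + v * b x \<and>
    (\<forall>e\<in>I - J - {x}. int p dvd u * a e + v * b e)" by (elim exE)
  then have uv: "\<not> int p dvd u * a x + v * b x"
    "\<forall>e\<in>I - J - {x}. int p dvd u * a e + v * b e" by simp_all
  have "\<exists>u' v'. \<not> int p dvd u' * a y + v' * b y \<and>
    (\<forall>e\<in>I - J - {y}. int p dvd u' * a e + v' * b e)"
    by (rule null_count_swap_functional[OF p fin _ _ J J0(2) N xyz(2)]) (rule uf' nz'; assumption)+
  then obtain u' v' where "\<not> int p dvd u' * a y + v' * b y \<and>
    (\<forall>e\<in>I - J - {y}. int p dvd u' * a e + v' * b e)" by (elim exE)
  then have uv': "\<not> int p dvd u' * a y + v' * b y"
    "\<forall>e\<in>I - J - {y}. int p dvd u' * a e + v' * b e" by simp_all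
  have y: "int p dvd u * a y + v * b y" and z: "int p dvd u * a z + v * b z"
    using uv(2) xyz by auto
  have z': "int p dvd u' * a z + v' * b z" using uv'(2) xyz by auto
  define D where "D = a y * b z - a z * b y"
  have "int p dvd u * D"
  proof -
    have "int p dvd b z * (u * a y + v * b y) - b y * (u * a z + v * b z)"
      by (rule dvd_diff[OF dvd_mult[OF y] dvd_mult[OF z]])
    then show ?thesis by (simp add: D_def algebra_simps)
  qed
  moreover have "int p dvd v * D"
  proof -
    have "int p dvd a y * (u * a z + v * b z) - a z * (u * a y + v * b y)"
      by (rule dvd_diff[OF dvd_mult[OF z] dvd_mult[OF y]])
    then show ?thesis by (simp add: D_def algebra_simps)
  qed
  moreover have "\<not> (int p dvd u \<and> int p dvd v)" using uv(1) by auto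
  ultimately have D: "int p dvd D" using p by (auto simp: prime_dvd_mult_iff)
  have "int p dvd a z * (u' * a y + v' * b y)"
  proof -
    have "int p dvd a y * (u' * a z + v' * b z) - v' * D"
      by (rule dvd_diff[OF dvd_mult[OF z'] dvd_mult[OF D]])
    then show ?thesis by (simp add: D_def algebra_simps)
  qed
  moreover have "int p dvd b z * (u' * a y + v' * b y)"
  proof -
    have "int p dvd b y * (u' * a z + v' * b z) + u' * D"
      by (rule dvd_add[OF dvd_mult[OF z'] dvd_mult[OF D]])
    then show ?thesis by (simp add: D_def algebra_simps)
  qed
  ultimately have "int p dvd a z \<and> int p dvd b z" using p uv'(1) by (simp add: prime_dvd_mult_iff)
  then show False using nz'[of z] xyz by (simp add: plane_def)
qed

section \<open>Quotients of the plane lattice\<close>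

definition smul :: "nat \<Rightarrow> int \<times> int \<Rightarrow> int \<times> int" where
  "smul m v = (int m * fst v, int m * snd v)"

lemma fst_smul [simp]: "fst (smul m v) = int m * fst v"
  and snd_smul [simp]: "snd (smul m v) = int m * snd v"
  by (simp_all add: smul_def)

lemma smul_one [simp]: "smul 1 v = v" "smul (Suc 0) v = v"
  by (simp_all add: smul_def)

lemma smul_smul: "smul m (smul l v) = smul (m * l) v"
  by (simp add: smul_def)

lemma smul_sum: "smul m (sum f X) = (\<Sum>i\<in>X. smul m (f i))"
  by (simp add: prod_eq_iff fst_sum snd_sum sum_distrib_left)

lemma smul_diff: "smul m (u - v) = smul m u - smul m v"
  by (simp add: prod_eq_iff algebra_simps)

text \<open>A model of C_n + C_k as integer pairs modulo \<open>lat\<close>; the cyclic group is the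
  case \<open>k = 1\<close>. Subgroups become lattices containing \<open>lat\<close>.\<close>

locale pair_lattice =
  fixes n k :: nat
  assumes n_pos: "n > 0" and k_pos: "k > 0"
begin

definition lat :: "(int \<times> int) set" where
  "lat = {v. int n dvd fst v \<and> int k dvd snd v}"

lemma add_subgroup_lat: "add_subgroup lat"
  by (auto simp: add_subgroup_def lat_def)

lemma zero_in_lat [simp]: "0 \<in> lat"
  by (simp add: lat_def)

lemma sum_in_lat: "(\<And>i. i \<in> X \<Longrightarrow> f i \<in> lat) \<Longrightarrow> sum f X \<in> lat"
  by (auto simp: lat_def fst_sum snd_sum intro!: dvd_sum)

lemma smul_in_lat: "v \<in> lat \<Longrightarrow> smul m v \<in> lat"
  by (auto simp: lat_def)

definition lord :: "int \<times> int \<Rightarrow> nat" where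
  "lord v = (LEAST m. 0 < m \<and> smul m v \<in> lat)"

abbreviation cross :: "'i set \<Rightarrow> ('i \<Rightarrow> int \<times> int) \<Rightarrow> real" where
  "cross I f \<equiv> \<Sum>i\<in>I. 1 / real (lord (f i))"

lemma lord_pos: "0 < lord v" and smul_lord: "smul (lord v) v \<in> lat"
proof -
  have "0 < n * k \<and> smul (n * k) v \<in> lat" using n_pos k_pos by (auto simp: lat_def)
  from LeastI[of "\<lambda>m. 0 < m \<and> smul m v \<in> lat", OF this]
  show "0 < lord v" "smul (lord v) v \<in> lat" by (simp_all add: lord_def)
qed

lemma smul_in_lat_iff: "smul m v \<in> lat \<longleftrightarrow> lord v dvd m"
proof
  assume m: "smul m v \<in> lat"
  let ?r = "m mod lord v"
  have "smul ?r v = smul m v - smul (m div lord v) (smul (lord v) v)"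
  proof -
    have "int ?r * x = int m * x - int (m div lord v) * (int (lord v) * x)" for x
      by (metis add_diff_cancel_left' left_diff_distrib mult.assoc of_nat_add of_nat_mult div_mult_mod_eq)
    then show ?thesis by (simp add: prod_eq_iff)
  qed
  then have r: "smul ?r v \<in> lat"
    using m smul_in_lat[OF smul_lord] add_subgroup_diff[OF add_subgroup_lat] by simp
  show "lord v dvd m"
  proof (rule ccontr)
    assume "\<not> lord v dvd m"
    then have "0 < ?r" by (simp add: mod_greater_zero_iff_not_dvd)
    then have "lord v \<le> ?r" unfolding lord_def[of v] using r by (intro Least_le) (simp add: lord_def)
    then show False using mod_less_divisor[OF lord_pos, of m v] by simp
  qed
next
  assume "lord v dvd m"
  then obtain c where "m = c * lord v" by (metis dvdE mult.commute)
  then show "smul m v \<in> lat" using smul_in_lat[OF smul_lord] by (simp add: smul_smul[symmetric])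
qed

lemma lord_eq_1_iff: "lord v = 1 \<longleftrightarrow> v \<in> lat"
  using smul_in_lat_iff[of 1 v] by simp

text \<open>
  Modulo a prime divisor \<open>p\<close> of \<open>N\<close>, this is the coordinate of \<open>v\<close> in the quotient, of order
  \<open>p\<close>, of the \<open>N\<close>-torsion by the \<open>N / p\<close>-torsion.
\<close>

definition chi :: "nat \<Rightarrow> int \<times> int \<Rightarrow> int" where
  "chi N v = (int N * fst v) div int n"

lemma chi_mult: "int n dvd int N * fst v \<Longrightarrow> chi N v * int n = int N * fst v"
  by (simp add: chi_def)

lemma chi_dvd_iff:
  assumes "int n dvd int (p * M) * fst v" "p > 0"
  shows "int p dvd chi (p * M) v \<longleftrightarrow> int n dvd int M * fst v"
proof
  note c = chi_mult[OF assms(1)]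
  assume "int p dvd chi (p * M) v"
  then obtain d where "chi (p * M) v = int p * d" ..
  then have "int p * (d * int n) = int p * (int M * fst v)" using c by (simp add: algebra_simps)
  then have "int M * fst v = int n * d" using assms(2) by (simp add: mult.commute)
  then show "int n dvd int M * fst v" by simp
next
  note c = chi_mult[OF assms(1)]
  assume "int n dvd int M * fst v"
  then obtain d where "int M * fst v = int n * d" ..
  then have "chi (p * M) v * int n = (int p * d) * int n" using c by (simp add: algebra_simps)
  then show "int p dvd chi (p * M) v" using n_pos by simp
qed

lemma chi_sum:
  assumes "\<And>i. i \<in> X \<Longrightarrow> int n dvd int N * fst (f i)"
  shows "chi N (sum f X) = (\<Sum>i\<in>X. chi N (f i))"
proof -
  have "(\<Sum>i\<in>X. chi N (f i)) * int n = (\<Sum>i\<in>X. int N * fst (f i))"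
    unfolding sum_distrib_right by (rule sum.cong) (use assms chi_mult in auto)
  also have "\<dots> = int N * fst (sum f X)" by (simp add: fst_sum sum_distrib_left)
  also have "\<dots> = chi N (sum f X) * int n"
    by (rule chi_mult[symmetric]) (use assms in \<open>auto simp: fst_sum sum_distrib_left intro!: dvd_sum\<close>)
  finally show ?thesis using n_pos by simp
qed

text \<open>The third assumption says that the second coordinate does not separate N-torsion from
  M-torsion, so that \<open>chi\<close> alone decides. It holds if \<open>p\<close> is a prime not
  dividing \<open>k\<close>, and also if \<open>k\<close> divides \<open>M\<close>.\<close>

lemma chi_sum_dvd_iff:
  assumes p: "p > 0" and N: "N = p * M"
    and k: "\<And>y. int k dvd int N * y \<Longrightarrow> int k dvd int M * y"
    and f: "\<And>i. i \<in> X \<Longrightarrow> smul N (f i) \<in> lat"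
  shows "int p dvd (\<Sum>i\<in>X. chi N (f i)) \<longleftrightarrow> smul M (sum f X) \<in> lat"
proof -
  have f': "int n dvd int N * fst (f i)" if "i \<in> X" for i using f[OF that] by (simp add: lat_def)
  have s: "smul N (sum f X) \<in> lat" unfolding smul_sum by (rule sum_in_lat[OF f])
  then have "int k dvd int M * snd (sum f X)" by (intro k) (simp add: lat_def)
  moreover have "int n dvd int N * fst (sum f X)" using s by (simp add: lat_def)
  moreover have "chi N (sum f X) = (\<Sum>i\<in>X. chi N (f i))" by (rule chi_sum[OF f'])
  ultimately show ?thesis
    using chi_dvd_iff[OF _ p, of M "sum f X"] by (simp add: lat_def N)
qed

text \<open>If there is no such \<open>T\<close>, every subset of \<open>W\<close> with sum in the
  M-torsion has its sum in \<open>H\<close>: small ones by assumption, larger ones by splitting off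
  a proper zero-sum subset modulo \<open>p\<close>. Then \<open>uf\<close> modulo \<open>H\<close>
  is \<open>uf\<close> of the coordinates \<open>chi\<close> modulo \<open>p\<close>, and the cyclic
  case applies.\<close>

lemma class_dichotomy:
  assumes p: "prime p" and N: "N = p * M"
    and k: "\<And>y. int k dvd int N * y \<Longrightarrow> int k dvd int M * y"
    and fin: "finite W" and f: "\<And>i. i \<in> W \<Longrightarrow> smul N (f i) \<in> lat \<and> smul M (f i) \<notin> lat"
    and H: "add_subgroup H" "\<And>v. v \<in> H \<Longrightarrow> smul M v \<in> lat" and uf: "uf H W f"
  shows "card W \<le> p \<or> (\<exists>T\<subseteq>W. T \<noteq> {} \<and> card T \<le> p \<and> smul M (sum f T) \<in> lat \<and> sum f T \<notin> H)"
proof (rule disjCI)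
  assume none: "\<not> (\<exists>T\<subseteq>W. T \<noteq> {} \<and> card T \<le> p \<and> smul M (sum f T) \<in> lat \<and> sum f T \<notin> H)"
  define a where "a i = chi N (f i)" for i
  have p0: "p > 0" using p by (rule prime_gt_0_nat)
  have a: "int p dvd sum a T \<longleftrightarrow> smul M (sum f T) \<in> lat" if "T \<subseteq> W" for T
    unfolding a_def by (rule chi_sum_dvd_iff[OF p0 N k]) (use that f in auto)
  have a_nz: "\<not> int p dvd a i" if "i \<in> W" for i using a[of "{i}"] f[OF that] that by simp
  have all: "sum f T \<in> H" if "T \<subseteq> W" "int p dvd sum a T" for T
    using that
  proof (induction "card T" arbitrary: T rule: less_induct)
    case less
    have finT: "finite T" using less.prems fin by (auto dest: finite_subset)
    consider "T = {}" | "T \<noteq> {}" "card T \<le> p" | "card T > p" by linarith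
    then show ?case
    proof cases
      case 1
      then show ?thesis using add_subgroup_zero[OF H(1)] by simp
    next
      case 2
      then show ?thesis using none less.prems a by auto
    next
      case 3
      obtain X where X: "X \<subset> T" "X \<noteq> {}" "int p dvd sum a X"
        by (rule zero_sum_proper_subset[OF p finT _ 3, of a]) (use a_nz less.prems in auto)
      have split: "sum g T = sum g X + sum g (T - X)" for g :: "'a \<Rightarrow> 'b::ab_group_add"
        using X finT by (metis sum.subset_diff psubset_imp_subset add.commute)
      have "int p dvd sum a (T - X)"
        using split[of a] X less.prems by (metis dvd_add_right_iff)
      moreover have "card (T - X) < card T" "card X < card T"
        using X finT by (auto intro!: psubset_card_mono)
      ultimately have "sum f X \<in> H" "sum f (T - X) \<in> H"
        using less.hyps[of X] less.hyps[of "T - X"] X less.prems by auto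
      then show ?thesis using split[of f] add_subgroup_add[OF H(1)] by simp
    qed
  qed
  have "sum a X \<in> multiples p \<longleftrightarrow> sum f X \<in> H" if "X \<subseteq> W" for X
    using all[OF that] a[OF that] H(2)[of "sum f X"] by (auto simp: multiples_def)
  then have "uf (multiples p) W a" by (rule uf_cong_sums[OF uf])
  then show "card W \<le> p" using a_nz by (intro uf_cyclic_card_le[OF p fin]) auto
qed

end

lemma contract_weight_le:
  fixes w :: "'v::ab_group_add \<Rightarrow> real"
  assumes "finite I" "T \<subseteq> I" "t \<in> T" "(\<Sum>i\<in>T. w (f i)) \<le> w (sum f T)"
  shows "(\<Sum>i\<in>I. w (f i)) \<le> (\<Sum>i\<in>insert t (I - T). w ((f(t := sum f T)) i))"
proof -
  have finT: "finite T" using assms by (auto dest: finite_subset)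
  have "(\<Sum>i\<in>I. w (f i)) = (\<Sum>i\<in>I - T. w (f i)) + (\<Sum>i\<in>T. w (f i))"
    using assms by (intro sum.subset_diff) auto
  also have "\<dots> \<le> (\<Sum>i\<in>I - T. w (f i)) + w (sum f T)" using assms(4) by simp
  also have "(\<Sum>i\<in>I - T. w (f i)) = (\<Sum>i\<in>I - T. w ((f(t := sum f T)) i))"
    using assms(3) by (intro sum.cong) auto
  finally show ?thesis using assms by simp
qed

lemma card_contract_less:
  assumes "finite I" "T \<subseteq> I" "t \<in> T" "T \<noteq> {t}"
  shows "card (insert t (I - T)) < card I"
proof -
  obtain u where u: "u \<in> T" "u \<noteq> t" using assms by blast
  then have "insert t (I - T) \<subset> I" using assms by blast
  then show ?thesis using assms(1) by (rule psubset_card_mono[rotated])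
qed

section \<open>Adding a prime to the order\<close>

lemma dvd_prime_power_times:
  fixes p m x s a :: nat
  assumes "prime p" "x dvd p ^ a * m" "\<not> p ^ Suc s dvd x"
  shows "x dvd p ^ s * m"
proof -
  obtain u v where uv: "x = u * v" "u dvd p ^ a" "v dvd m"
    using division_decomp[OF assms(2)] by blast
  then obtain j where j: "u = p ^ j" using assms(1) by (auto simp: divides_primepow_nat)
  have "j \<le> s"
  proof (rule ccontr)
    assume "\<not> j \<le> s"
    then have "p ^ Suc s dvd u" unfolding j by (intro le_imp_power_dvd) simp
    then show False using assms(3) uv(1) by simp
  qed
  then show ?thesis unfolding uv(1) j using uv(3) by (intro mult_dvd_mono le_imp_power_dvd)
qed

lemma prime_power_divisor:
  fixes p m x :: nat
  assumes "prime p" "x dvd p ^ a * m"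
  obtains b d where "x = p ^ b * d" "b \<le> a" "d dvd m"
  using division_decomp[OF assms(2)] assms(1) by (auto simp: divides_primepow_nat)

lemma inverse_powers_sum:
  fixes x :: real
  assumes "s \<le> a"
  shows "(1 - x) * (\<Sum>j\<in>{s..<a}. x ^ j) = x ^ s - x ^ a"
  using assms
proof (induction a rule: dec_induct)
  case (step a)
  have "(1 - x) * (\<Sum>j\<in>{s..<Suc a}. x ^ j) = (1 - x) * (\<Sum>j\<in>{s..<a}. x ^ j) + (1 - x) * x ^ a"
    using step.hyps by (simp add: distrib_left)
  then show ?case using step.IH by (simp add: algebra_simps)
qed simp

text \<open>For s = 0 and a > 0 this is the summand of the formula for p^a; the lower limit
  \<open>s\<close> is the number of layers of the p-part already divided out.\<close>

definition geom :: "nat \<Rightarrow> nat \<Rightarrow> nat \<Rightarrow> real" where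
  "geom p s a = (\<Sum>j\<in>{s..<a}. (1 / real p) ^ j)"

lemma geom_shift:
  assumes "p > 0"
  shows "(\<Sum>b\<in>{Suc s..a}. real p / real (p ^ b)) = geom p s a"
proof -
  have "(\<Sum>b\<in>{Suc s..a}. real p / real (p ^ b)) = (\<Sum>j\<in>{s..<a}. real p / real (p ^ Suc j))"
    by (subst atLeastLessThanSuc_atLeastAtMost[symmetric], subst sum.shift_bounds_Suc_ivl) simp
  also have "\<dots> = geom p s a"
    unfolding geom_def using assms by (intro sum.cong) (simp_all add: power_one_over)
  finally show ?thesis .
qed

lemma geom_le:
  assumes "p \<ge> 2" "s \<le> a"
  shows "geom p s a \<le> (1 / real p) ^ s * (real p / (real p - 1))"
proof -
  have p: "real p > 1" using assms by simp
  have "(1 - 1 / real p) * geom p s a \<le> (1 / real p) ^ s"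
    unfolding geom_def inverse_powers_sum[OF assms(2)] by simp
  then show ?thesis using p by (simp add: field_simps)
qed

lemma geom_Suc_left: "s < a \<Longrightarrow> geom p s a = (1 / real p) ^ s + geom p (Suc s) a"
  by (simp add: geom_def sum.atLeast_Suc_lessThan)

lemma smul_zero: "smul m 0 = 0"
  by (simp add: smul_def zero_prod_def)

context pair_lattice
begin

definition tors :: "nat \<Rightarrow> (int \<times> int) set" where
  "tors m = {v. smul m v \<in> lat}"

lemma add_subgroup_tors: "add_subgroup (tors m)"
  using add_subgroup_diff[OF add_subgroup_lat] by (simp add: add_subgroup_def tors_def smul_diff smul_zero)

lemma tors_iff: "v \<in> tors m \<longleftrightarrow> lord v dvd m"
  by (simp add: tors_def smul_in_lat_iff)

lemma sum_in_tors: "(\<And>i. i \<in> X \<Longrightarrow> f i \<in> tors m) \<Longrightarrow> sum f X \<in> tors m"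
  unfolding tors_def mem_Collect_eq smul_sum by (rule sum_in_lat) auto

lemma lord_smul_dvd: "lord (smul c v) dvd lord v"
  using smul_in_lat_iff[of "lord v" "smul c v"] smul_in_lat[OF smul_lord[of v], of c]
  by (simp add: smul_smul mult.commute)

text \<open>
  The weight of \<open>v\<close> when the part of \<open>p\<close>-order at most \<open>p ^ s\<close> has been divided out: a component
  that has become invisible is removed from the order.
\<close>

definition wt :: "nat \<Rightarrow> nat \<Rightarrow> nat \<Rightarrow> int \<times> int \<Rightarrow> real" where
  "wt p a s v = (if p ^ Suc s dvd lord v then 1 / real (lord v) else 1 / real (lord (smul (p ^ a) v)))"

lemma wt_ge:
  assumes "lord v dvd M" "M > 0"
  shows "1 / real M \<le> wt p a s v"
proof -
  have "lord v \<le> M" using assms by (rule dvd_imp_le)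
  moreover have "lord (smul (p ^ a) v) \<le> lord v" by (rule dvd_imp_le[OF lord_smul_dvd lord_pos])
  ultimately show ?thesis
    using lord_pos[of v] lord_pos[of "smul (p ^ a) v"] unfolding wt_def by (auto intro!: divide_left_mono)
qed

end

text \<open>In the application \<open>m\<close> collects the larger primes of \<open>n\<close>, and
  \<open>C\<close> is the bound known for orders dividing \<open>m\<close>. As \<open>p\<close> does
  not divide \<open>k\<close>, the p-part of the group is cyclic.\<close>

locale prime_step = pair_lattice +
  fixes p a m :: nat and C :: real
  assumes p: "prime p" and pk: "\<not> p dvd k" and pm: "\<not> p dvd m" and m_pos: "m > 0"
begin

lemma p_pos: "p > 0" and p2: "p \<ge> 2"
  using p prime_ge_2_nat[of p] by auto

lemma dvd_k_cancel: "int k dvd int (p * M) * y \<Longrightarrow> int k dvd int M * y"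
proof -
  assume h: "int k dvd int (p * M) * y"
  have "coprime k p" using prime_imp_coprime[OF p pk] by (simp add: coprime_commute)
  then have "coprime (int k) (int p)" by simp
  moreover have "int k dvd int p * (int M * y)" using h by (simp add: algebra_simps)
  ultimately show ?thesis by (simp add: coprime_dvd_mult_right_iff)
qed

definition family :: "nat \<Rightarrow> 'i set \<Rightarrow> ('i \<Rightarrow> int \<times> int) \<Rightarrow> bool" where
  "family s I f \<longleftrightarrow> finite I \<and> uf (tors (p ^ s)) I f \<and>
     (\<forall>i\<in>I. f i \<notin> tors (p ^ s) \<and> f i \<in> tors (p ^ a * m))"

text \<open>The index type is passed explicitly, since the quantified families must have a fixed
  one.\<close>

definition bound :: "'i itself \<Rightarrow> nat \<Rightarrow> bool" where
  "bound _ s \<longleftrightarrow> (\<forall>(I :: 'i set) f. family s I f \<longrightarrow> (\<Sum>i\<in>I. wt p a s (f i)) \<le> geom p s a + C)"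

text \<open>For s = a the whole p-part is invisible: multiplication by p^a yields a family of orders
  dividing \<open>m\<close>, and \<open>wt\<close> is the inverse order of the images.\<close>

lemma bound_top:
  assumes C: "\<And>(I :: 'i set) f. finite I \<Longrightarrow> uf lat I f \<Longrightarrow> (\<And>i. i \<in> I \<Longrightarrow> f i \<notin> lat \<and> f i \<in> tors m) \<Longrightarrow>
    cross I f \<le> C"
  shows "bound TYPE('i) a"
  unfolding bound_def
proof (intro allI impI)
  fix I :: "'i set" and f assume fam: "family a I f"
  let ?g = "\<lambda>i. smul (p ^ a) (f i)"
  have "cross I ?g \<le> C"
  proof (rule C)
    show "finite I" using fam by (simp add: family_def)
    show "uf lat I ?g"
    proof (rule uf_cong_sums)
      show "uf (tors (p ^ a)) I f" using fam by (simp add: family_def)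
    qed (simp add: tors_def smul_sum)
    show "?g i \<notin> lat \<and> ?g i \<in> tors m" if "i \<in> I" for i
      using fam that by (simp add: family_def tors_def smul_smul mult.commute[of m])
  qed
  also have "cross I ?g = (\<Sum>i\<in>I. wt p a a (f i))"
  proof (rule sum.cong[OF refl])
    fix i assume i: "i \<in> I"
    have "\<not> p ^ Suc a dvd lord (f i)"
    proof
      assume "p ^ Suc a dvd lord (f i)"
      also have "lord (f i) dvd p ^ a * m" using fam i by (simp add: family_def tors_iff)
      finally have "p dvd m" using p_pos by simp
      then show False using pm by simp
    qed
    then show "1 / real (lord (?g i)) = wt p a a (f i)" by (simp add: wt_def)
  qed
  finally show "(\<Sum>i\<in>I. wt p a a (f i)) \<le> geom p a a + C" by (simp add: geom_def)
qed

lemma tors_power_mono: "s \<le> t \<Longrightarrow> tors (p ^ s) \<subseteq> tors (p ^ t)"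
  using le_imp_power_dvd[of s t p] by (auto simp: tors_iff intro: dvd_trans)

lemma tors_coprime:
  assumes "v \<in> tors (p ^ t)" "v \<in> tors (p ^ s * m)"
  shows "v \<in> tors (p ^ s)"
proof -
  obtain j where j: "lord v = p ^ j" using assms(1) p by (auto simp: tors_iff divides_primepow_nat)
  have "p ^ j dvd p ^ s * m" using assms(2) j by (simp add: tors_iff)
  moreover have "coprime (p ^ j) m" using prime_imp_coprime[OF p pm] by simp
  ultimately show ?thesis by (simp add: tors_iff j coprime_dvd_mult_left_iff)
qed

text \<open>All terms \<open>X\<close> of order divisible by p^(s+1) are deleted. Each order p^b d
  occurs at most p times, and p^(s+1) at most p - 2 times, so they weigh at most geom p s a *
  \<sigma>(m)/m - 2 / p^(s+1), which by \<open>D\<close> is no more than geom p s a. The sums of the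
  remaining terms \<open>Y\<close> cannot tell p^s-torsion from p^a-torsion, so these form a family
  for s = a with unchanged weights.\<close>

lemma bound_small:
  fixes I :: "'i set"
  assumes top: "bound TYPE('i) a" and s: "s < a" and fam: "family s I f"
    and D: "(\<Sum>d\<in>{d. d dvd m}. 1 / real d) \<le> 1 + 2 * (real p - 1) / (real p)\<^sup>2"
    and cls: "\<And>N. N dvd p ^ a * m \<Longrightarrow> p ^ Suc s dvd N \<Longrightarrow> card {i \<in> I. lord (f i) = N} \<le> p"
    and small: "card {i \<in> I. lord (f i) = p ^ Suc s} + 2 \<le> p"
  shows "(\<Sum>i\<in>I. wt p a s (f i)) \<le> geom p s a + C"
proof -
  define X where "X = {i \<in> I. p ^ Suc s dvd lord (f i)}"
  define Y where "Y = {i \<in> I. \<not> p ^ Suc s dvd lord (f i)}"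
  have fin: "finite I" and uf: "uf (tors (p ^ s)) I f"
    and nz: "\<And>i. i \<in> I \<Longrightarrow> f i \<notin> tors (p ^ s)" and tor: "\<And>i. i \<in> I \<Longrightarrow> f i \<in> tors (p ^ a * m)"
    using fam by (auto simp: family_def)
  have finX: "finite X" "finite Y" using fin by (simp_all add: X_def Y_def)
  have Ytor: "f i \<in> tors (p ^ s * m)" if "i \<in> Y" for i
    using that tor[of i] dvd_prime_power_times[OF p, of "lord (f i)" a m s] by (auto simp: Y_def tors_iff)
  have "family a Y f"
    unfolding family_def
  proof (intro conjI ballI)
    have "sum f Z \<in> tors (p ^ a) \<longleftrightarrow> sum f Z \<in> tors (p ^ s)" if "Z \<subseteq> Y" for Z
    proof
      assume "sum f Z \<in> tors (p ^ a)"
      moreover have "sum f Z \<in> tors (p ^ s * m)" using that Ytor by (intro sum_in_tors) auto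
      ultimately show "sum f Z \<in> tors (p ^ s)" by (rule tors_coprime)
    qed (use tors_power_mono[of s a] s in auto)
    then show "uf (tors (p ^ a)) Y f"
      by (intro uf_cong_sums[OF uf_subset[OF uf]]) (auto simp: Y_def)
    fix i assume i: "i \<in> Y"
    show "f i \<notin> tors (p ^ a)"
      using tors_coprime[OF _ Ytor[OF i], of a] nz[of i] i by (auto simp: Y_def)
    show "f i \<in> tors (p ^ a * m)" using tor i by (simp add: Y_def)
  qed (rule finX)
  then have "(\<Sum>i\<in>Y. wt p a a (f i)) \<le> C"
    using top by (auto simp: bound_def geom_def)
  also have "(\<Sum>i\<in>Y. wt p a a (f i)) = (\<Sum>i\<in>Y. wt p a s (f i))"
  proof (rule sum.cong[OF refl])
    fix i assume i: "i \<in> Y"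
    then have "\<not> p ^ Suc s dvd lord (f i)" by (simp add: Y_def)
    moreover have "p ^ Suc s dvd p ^ Suc a" using s by (intro le_imp_power_dvd) simp
    ultimately have "\<not> p ^ Suc a dvd lord (f i)" by (meson dvd_trans)
    then show "wt p a a (f i) = wt p a s (f i)" using i by (simp add: wt_def Y_def)
  qed
  finally have boundY: "(\<Sum>i\<in>Y. wt p a s (f i)) \<le> C" .
  define NN where "NN = {N. N dvd p ^ a * m \<and> p ^ Suc s dvd N}"
  define c where "c N = (if N = p ^ Suc s then real p - 2 else real p)" for N
  have finNN: "finite NN"
    using p_pos m_pos by (intro finite_subset[OF _ finite_divisors_nat[of "p ^ a * m"]]) (auto simp: NN_def)
  have c_ge: "real (card {i \<in> I. lord (f i) = N}) \<le> c N" if "N \<in> NN" for N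
    using that cls[of N] small by (auto simp: NN_def c_def)
  have "(\<Sum>i\<in>X. wt p a s (f i)) = cross X f"
    by (rule sum.cong) (auto simp: X_def wt_def)
  also have "\<dots> = (\<Sum>N\<in>NN. \<Sum>i\<in>{i \<in> X. lord (f i) = N}. 1 / real (lord (f i)))"
    using finX finNN tor by (intro sum.group[symmetric]) (auto simp: X_def NN_def tors_iff)
  also have "\<dots> = (\<Sum>N\<in>NN. real (card {i \<in> I. lord (f i) = N}) * (1 / real N))"
  proof (rule sum.cong[OF refl])
    fix N assume N: "N \<in> NN"
    have "{i \<in> X. lord (f i) = N} = {i \<in> I. lord (f i) = N}" using N by (auto simp: X_def NN_def)
    then have "cross ({i \<in> X. lord (f i) = N}) f = (\<Sum>i\<in>{i \<in> I. lord (f i) = N}. 1 / real N)"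
      by (intro sum.cong) auto
    then show "cross ({i \<in> X. lord (f i) = N}) f = real (card {i \<in> I. lord (f i) = N}) * (1 / real N)"
      by simp
  qed
  also have "\<dots> \<le> (\<Sum>N\<in>NN. c N * (1 / real N))"
    using c_ge by (intro sum_mono mult_right_mono) auto
  also have "\<dots> \<le> (\<Sum>N\<in>(\<lambda>(b, d). p ^ b * d) ` ({Suc s..a} \<times> {d. d dvd m}). c N * (1 / real N))"
  proof (rule sum_mono2)
    show "finite ((\<lambda>(b, d). p ^ b * d) ` ({Suc s..a} \<times> {d. d dvd m}))"
      using m_pos by simp
    show "NN \<subseteq> (\<lambda>(b, d). p ^ b * d) ` ({Suc s..a} \<times> {d. d dvd m})"
    proof
      fix N assume N: "N \<in> NN"
      then obtain b d where bd: "N = p ^ b * d" "b \<le> a" "d dvd m"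
        using prime_power_divisor[OF p, of N a m] by (auto simp: NN_def)
      have "\<not> p dvd d" using pm bd(3) dvd_trans by blast
      then have "coprime p d" by (rule prime_imp_coprime[OF p])
      then have "coprime (p ^ Suc s) d" by (simp del: power_Suc)
      moreover have "p ^ Suc s dvd p ^ b * d" using N bd(1) by (simp add: NN_def del: power_Suc)
      ultimately have "p ^ Suc s dvd p ^ b" using coprime_dvd_mult_left_iff by blast
      then have "Suc s \<le> b" using p2 by (simp add: power_dvd_imp_le)
      then show "N \<in> (\<lambda>(b, d). p ^ b * d) ` ({Suc s..a} \<times> {d. d dvd m})" using bd by force
    qed
    show "0 \<le> c N * (1 / real N)" for N using p2 by (simp add: c_def)
  qed
  also have "\<dots> \<le> (\<Sum>(b, d)\<in>{Suc s..a} \<times> {d. d dvd m}. c (p ^ b * d) * (1 / real (p ^ b * d)))"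
  proof -
    have "sum (\<lambda>N. c N * (1 / real N)) ((\<lambda>(b, d). p ^ b * d) ` ({Suc s..a} \<times> {d. d dvd m})) \<le>
      sum ((\<lambda>N. c N * (1 / real N)) \<circ> (\<lambda>(b, d). p ^ b * d)) ({Suc s..a} \<times> {d. d dvd m})"
      using m_pos p2 by (intro sum_image_le) (auto simp: c_def)
    then show ?thesis by (simp add: comp_def case_prod_unfold)
  qed
  also have "\<dots> \<le> (\<Sum>x\<in>{Suc s..a} \<times> {d. d dvd m}.
      real p / real (p ^ fst x) * (1 / real (snd x)) - (if x = (Suc s, 1) then 2 / real (p ^ Suc s) else 0))"
  proof (rule sum_mono)
    fix x assume x: "x \<in> {Suc s..a} \<times> {d. d dvd m}"
    obtain b d where bd: "x = (b, d)" by force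
    show "(case x of (b, d) \<Rightarrow> c (p ^ b * d) * (1 / real (p ^ b * d))) \<le>
      real p / real (p ^ fst x) * (1 / real (snd x)) - (if x = (Suc s, 1) then 2 / real (p ^ Suc s) else 0)"
    proof (cases "x = (Suc s, 1)")
      case True
      then show ?thesis by (simp add: c_def diff_divide_distrib)
    next
      case False
      have "c (p ^ b * d) \<le> real p" by (simp add: c_def)
      then have "c (p ^ b * d) * (1 / real (p ^ b * d)) \<le> real p * (1 / real (p ^ b * d))"
        by (rule mult_right_mono) simp
      then show ?thesis unfolding if_not_P[OF False] unfolding bd by simp
    qed
  qed
  also have "\<dots> = (\<Sum>x\<in>{Suc s..a} \<times> {d. d dvd m}. real p / real (p ^ fst x) * (1 / real (snd x)))
      - 2 / real (p ^ Suc s)"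
    unfolding sum_subtractf using m_pos s by (subst sum.delta) auto
  also have "(\<Sum>x\<in>{Suc s..a} \<times> {d. d dvd m}. real p / real (p ^ fst x) * (1 / real (snd x))) =
      geom p s a * (\<Sum>d\<in>{d. d dvd m}. 1 / real d)"
    unfolding geom_shift[OF p_pos, symmetric] sum_product sum.cartesian_product
    by (rule sum.cong) auto
  finally have "(\<Sum>i\<in>X. wt p a s (f i)) \<le> geom p s a * (\<Sum>d\<in>{d. d dvd m}. 1 / real d) - 2 / real (p ^ Suc s)" .
  also have "\<dots> \<le> geom p s a"
  proof -
    \<comment> \<open>The excess is at most geom p s a * e with geom p s a at most p^(-s) p / (p -
      1), and \<open>e\<close> is the factor that turns this into the saved 2 / p^(s+1).\<close>
    define e where "e = 2 * (real p - 1) / (real p)\<^sup>2"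
    have e0: "0 \<le> e" using p2 by (simp add: e_def)
    have g0: "0 \<le> geom p s a" by (simp add: geom_def sum_nonneg)
    have "geom p s a * (\<Sum>d\<in>{d. d dvd m}. 1 / real d) \<le> geom p s a * (1 + e)"
      using D g0 unfolding e_def by (intro mult_left_mono)
    moreover have "geom p s a * e \<le> (1 / real p) ^ s * (real p / (real p - 1)) * e"
      using geom_le[of p s a] p2 s e0 by (intro mult_right_mono) auto
    moreover have "(1 / real p) ^ s * (real p / (real p - 1)) * e = 2 / real (p ^ Suc s)"
      unfolding e_def using p2 by (simp add: field_simps power2_eq_square)
    ultimately show ?thesis by (simp add: algebra_simps)
  qed
  finally have boundX: "(\<Sum>i\<in>X. wt p a s (f i)) \<le> geom p s a" .
  have "(\<Sum>i\<in>I. wt p a s (f i)) = (\<Sum>i\<in>X \<union> Y. wt p a s (f i))"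
    by (rule sum.cong) (auto simp: X_def Y_def)
  also have "\<dots> = (\<Sum>i\<in>X. wt p a s (f i)) + (\<Sum>i\<in>Y. wt p a s (f i))"
    using finX by (intro sum.union_disjoint) (auto simp: X_def Y_def)
  finally show ?thesis using boundX boundY by simp
qed

text \<open>
  When at least \<open>p - 1\<close> terms have order \<open>p ^ Suc s\<close>, their subset sums cover the subgroup
  \<open>tors (p ^ Suc s)\<close> modulo \<open>tors (p ^ s)\<close>; the other terms therefore remain a family modulo the larger subgroup.
\<close>

lemma bound_large:
  fixes I :: "'i set"
  assumes IH: "bound TYPE('i) (Suc s)" and s: "s < a" and fam: "family s I f"
    and le: "card {i \<in> I. lord (f i) = p ^ Suc s} \<le> p"
    and large: "p \<le> card {i \<in> I. lord (f i) = p ^ Suc s} + 1"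
  shows "(\<Sum>i\<in>I. wt p a s (f i)) \<le> geom p s a + C"
proof -
  define W where "W = {i \<in> I. lord (f i) = p ^ Suc s}"
  let ?N = "p ^ Suc s"
  have fin: "finite I" and uf: "uf (tors (p ^ s)) I f"
    and nz: "\<And>i. i \<in> I \<Longrightarrow> f i \<notin> tors (p ^ s)" and tor: "\<And>i. i \<in> I \<Longrightarrow> f i \<in> tors (p ^ a * m)"
    using fam by (auto simp: family_def)
  have finW: "finite W" and WI: "W \<subseteq> I" using fin by (auto simp: W_def)
  have N: "?N = p * p ^ s" by simp
  have Wtor: "smul ?N (f i) \<in> lat" if "i \<in> W" for i
    using that by (simp add: W_def smul_in_lat_iff)
  have chi_iff: "int p dvd (\<Sum>i\<in>X. chi ?N (g i)) \<longleftrightarrow> sum g X \<in> tors (p ^ s)"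
    if "\<And>i. i \<in> X \<Longrightarrow> smul ?N (g i) \<in> lat" for X :: "'x set" and g
    unfolding tors_def mem_Collect_eq
    by (rule chi_sum_dvd_iff[OF p_pos N]) (use dvd_k_cancel[of "p ^ s"] that in auto)
  have W_nz: "\<not> int p dvd chi ?N (f i)" if "i \<in> W" for i
    using chi_iff[of "{i}" f] Wtor[OF that] nz[of i] that WI by auto
  have cover: "\<exists>F\<subseteq>W. v + sum f F \<in> tors (p ^ s)" if v: "v \<in> tors ?N" for v
  proof -
    obtain F where F: "F \<subseteq> W" "int p dvd chi ?N v + (\<Sum>i\<in>F. chi ?N (f i))"
      by (rule subset_sums_cover[OF p finW, of "\<lambda>i. chi ?N (f i)" "chi ?N v"])
        (use W_nz large in \<open>auto simp: W_def\<close>)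
    have finF: "finite F" using F finW by (auto dest: finite_subset)
    \<comment> \<open>\<open>v\<close> joins the terms of \<open>F\<close> as one more term with
      index \<open>None\<close>, so that additivity of \<open>chi\<close> applies to the whole
      sum.\<close>
    define g where "g = case_option v f"
    let ?O = "insert None (Some ` F)"
    have "(\<Sum>i\<in>?O. chi ?N (g i)) = chi ?N v + (\<Sum>i\<in>F. chi ?N (f i))"
      using finF by (simp add: g_def sum.reindex)
    moreover have "sum g ?O = v + sum f F" using finF by (simp add: g_def sum.reindex)
    moreover have "smul ?N (g i) \<in> lat" if "i \<in> ?O" for i
      using that v F Wtor by (auto simp: g_def tors_def)
    ultimately have "v + sum f F \<in> tors (p ^ s)" using chi_iff[of ?O g] F by simp
    then show ?thesis using F by blast
  qed
  have sub: "tors (p ^ s) \<subseteq> tors ?N" by (rule tors_power_mono) simp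
  have "family (Suc s) (I - W) f"
    unfolding family_def
  proof (intro conjI ballI)
    show "finite (I - W)" using fin by simp
    show "uf (tors ?N) (I - W) f"
      unfolding uf_def
    proof (intro allI impI)
      fix X Y assume X: "X \<subseteq> I - W" and Y: "Y \<subseteq> I - W" and sX: "sum f X \<in> tors ?N" and sY: "sum f Y \<in> tors ?N"
      obtain F where F: "F \<subseteq> W" "sum f X + sum f F \<in> tors (p ^ s)" using cover[OF sX] by blast
      obtain G where G: "G \<subseteq> W" "sum f Y + sum f G \<in> tors (p ^ s)" using cover[OF sY] by blast
      have un: "sum f (A \<union> B) = sum f A + sum f B" if "A \<subseteq> I - W" "B \<subseteq> W" for A B
      proof -
        have "finite A" "finite B" using that fin finW by (auto dest: finite_subset)
        then show ?thesis using that by (intro sum.union_disjoint) auto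
      qed
      \<comment> \<open>Completing X and Y inside \<open>W\<close> and intersecting leaves X
        \<inter> Y together with F \<inter> G; the latter has its sum in the larger subgroup
        anyway.\<close>
      have "sum f ((X \<union> F) \<inter> (Y \<union> G)) \<in> tors (p ^ s)"
        by (rule ufD[OF uf]) (use X Y F G WI un in auto)
      also have "(X \<union> F) \<inter> (Y \<union> G) = (X \<inter> Y) \<union> (F \<inter> G)" using X Y F G by blast
      also have "sum f \<dots> = sum f (X \<inter> Y) + sum f (F \<inter> G)" using X F by (intro un) auto
      finally have "sum f (X \<inter> Y) + sum f (F \<inter> G) \<in> tors ?N" using sub by blast
      moreover have "sum f (F \<inter> G) \<in> tors ?N"
        using F Wtor by (intro sum_in_tors) (auto simp: tors_def)
      ultimately show "sum f (X \<inter> Y) \<in> tors ?N"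
        using add_subgroup_diff[OF add_subgroup_tors] by fastforce
    qed
    fix i assume i: "i \<in> I - W"
    show "f i \<notin> tors ?N"
    proof
      assume "f i \<in> tors ?N"
      then have "lord (f i) dvd p ^ Suc s" by (simp add: tors_iff)
      then obtain j where j: "j \<le> Suc s" "lord (f i) = p ^ j"
        using divides_primepow_nat[OF p] by blast
      then have "j \<noteq> Suc s" using i by (auto simp: W_def)
      then have "lord (f i) dvd p ^ s" unfolding j(2) using j(1) by (intro le_imp_power_dvd) simp
      then show False using nz[of i] i by (simp add: tors_iff)
    qed
    show "f i \<in> tors (p ^ a * m)" using tor i by simp
  qed
  then have "(\<Sum>i\<in>I - W. wt p a (Suc s) (f i)) \<le> geom p (Suc s) a + C"
    using IH by (simp add: bound_def)
  moreover have "(\<Sum>i\<in>I - W. wt p a s (f i)) \<le> (\<Sum>i\<in>I - W. wt p a (Suc s) (f i))"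
  proof (rule sum_mono)
    fix i
    have "lord (smul (p ^ a) (f i)) \<le> lord (f i)" by (rule dvd_imp_le[OF lord_smul_dvd lord_pos])
    then have "1 / real (lord (f i)) \<le> 1 / real (lord (smul (p ^ a) (f i)))"
      using lord_pos by (intro divide_left_mono) auto
    moreover have "p ^ Suc s dvd lord (f i)" if "p ^ Suc (Suc s) dvd lord (f i)"
      using that by (meson dvd_trans le_imp_power_dvd le_SucI order_refl)
    ultimately show "wt p a s (f i) \<le> wt p a (Suc s) (f i)" by (auto simp: wt_def)
  qed
  moreover have "(\<Sum>i\<in>W. wt p a s (f i)) \<le> (1 / real p) ^ s"
  proof -
    have "(\<Sum>i\<in>W. wt p a s (f i)) = (\<Sum>i\<in>W. 1 / real ?N)"
      by (rule sum.cong) (auto simp: W_def wt_def)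
    also have "\<dots> = real (card W) / real ?N" by simp
    also have "\<dots> \<le> real p / real ?N" using le by (intro divide_right_mono) (auto simp: W_def)
    also have "\<dots> = (1 / real p) ^ s" using p_pos by (simp add: power_one_over)
    finally show ?thesis .
  qed
  moreover have "(\<Sum>i\<in>I. wt p a s (f i)) = (\<Sum>i\<in>I - W. wt p a s (f i)) + (\<Sum>i\<in>W. wt p a s (f i))"
    using fin WI by (intro sum.subset_diff) auto
  ultimately show ?thesis using geom_Suc_left[OF s, of p] by simp
qed

text \<open>While some order N divisible by p^(s+1) occurs more than p times, contract: at most p
  terms of weight 1 / N give way to a sum killed by M = N / p, whose weight is at least 1 / M, and
  the number of terms drops. Once this stops, the number of terms of order p^(s+1) selects one of
  the two preceding cases.\<close>

lemma bound_step:
  assumes top: "bound TYPE('i) a" and IH: "bound TYPE('i) (Suc s)" and s: "s < a"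
    and D: "(\<Sum>d\<in>{d. d dvd m}. 1 / real d) \<le> 1 + 2 * (real p - 1) / (real p)\<^sup>2"
  shows "bound TYPE('i) s"
  unfolding bound_def
proof (intro allI impI)
  fix I :: "'i set" and f assume "family s I f"
  then show "(\<Sum>i\<in>I. wt p a s (f i)) \<le> geom p s a + C"
  proof (induction "card I" arbitrary: I f rule: less_induct)
    case less
    note fam = less.prems
    have fin: "finite I" and uf: "uf (tors (p ^ s)) I f"
      and nz: "\<And>i. i \<in> I \<Longrightarrow> f i \<notin> tors (p ^ s)" and tor: "\<And>i. i \<in> I \<Longrightarrow> f i \<in> tors (p ^ a * m)"
      using fam by (auto simp: family_def)
    show ?case
    proof (cases "\<forall>N. N dvd p ^ a * m \<longrightarrow> p ^ Suc s dvd N \<longrightarrow> card {i \<in> I. lord (f i) = N} \<le> p")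
      case True
      then have le: "card {i \<in> I. lord (f i) = p ^ Suc s} \<le> p"
        using s by (simp add: dvd_mult2 le_imp_power_dvd del: power_Suc)
      show ?thesis
      proof (cases "card {i \<in> I. lord (f i) = p ^ Suc s} + 2 \<le> p")
        case small: True
        show ?thesis by (rule bound_small[OF top s fam D _ small]) (use True in blast)
      next
        case False
        then show ?thesis by (intro bound_large[OF IH s fam le]) simp
      qed
    next
      case False
      then obtain N where N: "N dvd p ^ a * m" "p ^ Suc s dvd N" "\<not> card {i \<in> I. lord (f i) = N} \<le> p"
        by blast
      define M where "M = N div p"
      have NM: "N = p * M" using N(2) unfolding M_def by (metis dvd_mult_div_cancel dvd_mult_left power_Suc)
      have N0: "N > 0" using N(1) p_pos m_pos by (auto intro!: Nat.gr0I)
      then have M0: "M > 0" using NM by simp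
      have Ms: "p ^ s dvd M" using N(2) p_pos by (simp add: NM)
      define W where "W = {i \<in> I. lord (f i) = N}"
      have "\<not> N dvd M" using NM M0 p2 by (auto dest!: dvd_imp_le)
      then have W: "smul N (f i) \<in> lat \<and> smul M (f i) \<notin> lat" if "i \<in> W" for i
        using that by (simp add: W_def smul_in_lat_iff)
      have H: "smul M v \<in> lat" if "v \<in> tors (p ^ s)" for v
        using that Ms by (auto simp: tors_iff smul_in_lat_iff intro: dvd_trans)
      have "card W \<le> p \<or> (\<exists>T\<subseteq>W. T \<noteq> {} \<and> card T \<le> p \<and> smul M (sum f T) \<in> lat \<and> sum f T \<notin> tors (p ^ s))"
        by (rule class_dichotomy[OF p NM _ _ W add_subgroup_tors H uf_subset[OF uf]])
          (use dvd_k_cancel[of M] NM fin in \<open>auto simp: W_def\<close>)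
      then obtain T where T: "T \<subseteq> W" "T \<noteq> {}" "card T \<le> p" "smul M (sum f T) \<in> lat" "sum f T \<notin> tors (p ^ s)"
        using N(3) by (auto simp: W_def)
      then obtain t where t: "t \<in> T" by blast
      have TI: "T \<subseteq> I" using T by (auto simp: W_def)
      have "T \<noteq> {t}" using T(1,4) W[of t] by auto
      then have less_card: "card (insert t (I - T)) < card I"
        using fin TI t by (rule card_contract_less[rotated 3])
      let ?f = "f(t := sum f T)" and ?I = "insert t (I - T)"
      have "family s ?I ?f"
        unfolding family_def
      proof (intro conjI ballI)
        show "finite ?I" using fin by simp
        show "uf (tors (p ^ s)) ?I ?f" by (rule uf_contract[OF uf fin TI t])
        fix i assume i: "i \<in> ?I"
        show "?f i \<notin> tors (p ^ s)" using i nz T by auto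
        have "sum f T \<in> tors (p ^ a * m)" using tor TI by (intro sum_in_tors) auto
        then show "?f i \<in> tors (p ^ a * m)" using i tor by auto
      qed
      then have "(\<Sum>i\<in>?I. wt p a s (?f i)) \<le> geom p s a + C" by (rule less.hyps[OF less_card])
      moreover have "(\<Sum>i\<in>T. wt p a s (f i)) \<le> wt p a s (sum f T)"
      proof -
        have "(\<Sum>i\<in>T. wt p a s (f i)) = (\<Sum>i\<in>T. 1 / real N)"
          using T(1) N(2) by (intro sum.cong) (auto simp: W_def wt_def)
        also have "\<dots> = real (card T) / real N" by simp
        also have "\<dots> \<le> real p / real N" using T(3) by (intro divide_right_mono) auto
        also have "\<dots> = 1 / real M" using p_pos by (simp add: NM)
        also have "\<dots> \<le> wt p a s (sum f T)" using T(4) M0 by (intro wt_ge) (simp_all add: smul_in_lat_iff)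
        finally show ?thesis .
      qed
      ultimately show ?thesis
        using contract_weight_le[OF fin TI t, of "wt p a s" f] by linarith
    qed
  qed
qed

text \<open>Downward induction on \<open>s\<close> ends at s = 0, where \<open>tors (p ^ 0)\<close>
  is \<open>lat\<close> and \<open>wt\<close> is the inverse order: if \<open>p\<close> does not
  divide an order, multiplying by p^a preserves it.\<close>

lemma prime_step_bound:
  assumes C: "\<And>(I :: 'i set) f. finite I \<Longrightarrow> uf lat I f \<Longrightarrow> (\<And>i. i \<in> I \<Longrightarrow> f i \<notin> lat \<and> f i \<in> tors m) \<Longrightarrow>
      cross I f \<le> C"
    and D: "(\<Sum>d\<in>{d. d dvd m}. 1 / real d) \<le> 1 + 2 * (real p - 1) / (real p)\<^sup>2"
    and I: "finite (I :: 'i set)" "uf lat I f" "\<And>i. i \<in> I \<Longrightarrow> f i \<notin> lat \<and> f i \<in> tors (p ^ a * m)"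
  shows "cross I f \<le> geom p 0 a + C"
proof -
  have top: "bound TYPE('i) a" by (rule bound_top[OF C])
  have "bound TYPE('i) 0"
    using le0[of a]
  proof (induction rule: inc_induct)
    case base
    show ?case by (rule top)
  next
    case (step s)
    show ?case by (rule bound_step[OF top step.IH step.hyps(2) D])
  qed
  moreover have "tors (p ^ 0) = lat" by (simp add: tors_def)
  ultimately have "(\<Sum>i\<in>I. wt p a 0 (f i)) \<le> geom p 0 a + C"
    using I unfolding bound_def family_def by (metis (no_types, lifting))
  moreover have "wt p a 0 (f i) = 1 / real (lord (f i))" if "i \<in> I" for i
  proof (cases "p dvd lord (f i)")
    case False
    have "lord (f i) dvd lord (smul (p ^ a) (f i))"
    proof -
      have "lord (f i) dvd lord (smul (p ^ a) (f i)) * p ^ a"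
        using smul_lord[of "smul (p ^ a) (f i)"] by (simp add: smul_smul smul_in_lat_iff)
      moreover have "coprime (lord (f i)) (p ^ a)"
        using prime_imp_coprime[OF p False] by (simp add: coprime_commute)
      ultimately show ?thesis by (simp add: coprime_dvd_mult_left_iff)
    qed
    then have "lord (smul (p ^ a) (f i)) = lord (f i)" using lord_smul_dvd by (intro dvd_antisym)
    then show ?thesis using False by (simp add: wt_def)
  qed (simp add: wt_def)
  ultimately show ?thesis by simp
qed

end

section \<open>The largest prime\<close>

context pair_lattice
begin

text \<open>For k = 1 the second alternative of the dichotomy with M = 1 and H = lat contradicts
  itself. For k = q, \<open>chi\<close> and the second component are the two coordinates modulo
  \<open>q\<close> on the elements killed by \<open>q\<close>.\<close>

lemma order_prime_class_card_le:
  assumes q: "prime q" and k: "k = 1 \<or> k = q" and fin: "finite W" and uf: "uf lat W f"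
    and f: "\<And>i. i \<in> W \<Longrightarrow> smul q (f i) \<in> lat \<and> f i \<notin> lat"
  shows "card W \<le> (if k = 1 then q else 2 * q)"
proof (cases "k = 1")
  case True
  have "card W \<le> q \<or> (\<exists>T\<subseteq>W. T \<noteq> {} \<and> card T \<le> q \<and> smul 1 (sum f T) \<in> lat \<and> sum f T \<notin> lat)"
    by (rule class_dichotomy[OF q _ _ fin _ add_subgroup_lat _ uf]) (use True f in auto)
  then show ?thesis using True by auto
next
  case False
  then have kq: "k = q" using k by simp
  have q0: "q > 0" using q by (rule prime_gt_0_nat)
  define g where "g i = (chi (q * 1) (f i), snd (f i))" for i
  have g: "sum g X \<in> plane q \<longleftrightarrow> sum f X \<in> lat" if "X \<subseteq> W" for X
  proof -
    have fX: "int n dvd int (q * 1) * fst (f i)" if "i \<in> X" for i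
      using f[of i] that \<open>X \<subseteq> W\<close> by (auto simp: lat_def)
    have "fst (sum g X) = chi (q * 1) (sum f X)"
      using chi_sum[OF fX, of X] by (simp add: g_def fst_sum)
    moreover have "snd (sum g X) = snd (sum f X)" by (simp add: g_def snd_sum)
    moreover have "int n dvd int (q * 1) * fst (sum f X)"
      unfolding fst_sum sum_distrib_left by (rule dvd_sum[OF fX])
    moreover have "sum f X \<in> lat \<longleftrightarrow> int n dvd fst (sum f X) \<and> int q dvd snd (sum f X)"
      unfolding lat_def using kq by simp
    ultimately show ?thesis
      using chi_dvd_iff[of q 1 "sum f X"] q0 by (simp add: plane_def)
  qed
  have "card W \<le> 2 * q"
  proof (rule uf_rank_two_card_le[OF q fin])
    show "g i \<notin> plane q" if "i \<in> W" for i using g[of "{i}"] f[OF that] that by simp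
    show "uf (plane q) W g" by (rule uf_cong_sums[OF uf g])
  qed
  then show ?thesis using False by simp
qed

text \<open>For b at least 2, q^(b-1) annihilates the second summand, so the layer between
  q^(b-1)-torsion and q^b-torsion is cyclic even if k = q, and contraction works. Only order q can
  have rank two; up to 2q terms of order q account for the constant 2.\<close>

lemma prime_power_bound:
  fixes I :: "'i set"
  assumes q: "prime q" and k: "k = 1 \<or> k = q"
    and I: "finite I" "uf lat I f" "\<And>i. i \<in> I \<Longrightarrow> f i \<notin> lat \<and> f i \<in> tors (q ^ a)"
  shows "cross I f \<le> geom q 1 a + (if k = 1 then 1 else 2)"
  using I
proof (induction "card I" arbitrary: I f rule: less_induct)
  case less
  note fin = less.prems(1) and uf = less.prems(2)
  have nz: "f i \<notin> lat" and tor: "f i \<in> tors (q ^ a)" if "i \<in> I" for i using less.prems(3)[OF that] by auto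
  have q2: "q \<ge> 2" using q by (rule prime_ge_2_nat)
  show ?case
  proof (cases "\<forall>b\<in>{2..a}. card {i \<in> I. lord (f i) = q ^ b} \<le> q")
    case True
    define c where "c b = (if b = 1 then (if k = 1 then real q else 2 * real q) else real q)" for b :: nat
    have c_ge: "real (card {i \<in> I. lord (f i) = q ^ b}) \<le> c b" if b: "b \<in> {1..a}" for b
    proof (cases "b = 1")
      case False
      then have "b \<in> {2..a}" using b by auto
      then have "card {i \<in> I. lord (f i) = q ^ b} \<le> q" using True by blast
      then show ?thesis using False by (simp add: c_def)
    next
      case b1: True
      have "card {i \<in> I. lord (f i) = q ^ 1} \<le> (if k = 1 then q else 2 * q)"
        using fin nz smul_lord by (intro order_prime_class_card_le[OF q k _ uf_subset[OF uf]]) (auto simp: smul_in_lat_iff)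
      then show ?thesis using b1 by (auto simp: c_def split: if_splits)
    qed
    define e where "e v = (THE b. lord v = q ^ b)" for v
    have e: "e v = b" if "lord v = q ^ b" for v b
      unfolding e_def using that q2 by (intro the_equality) auto
    have ord: "\<exists>b\<in>{1..a}. lord (f i) = q ^ b" if i: "i \<in> I" for i
    proof -
      obtain b where b: "b \<le> a" "lord (f i) = q ^ b"
        using tor[OF i] divides_primepow_nat[OF q] by (auto simp: tors_iff)
      have "b \<noteq> 0" using b(2) nz[OF i] lord_eq_1_iff[of "f i"] by auto
      then show ?thesis using b by (intro bexI[of _ b]) auto
    qed
    have e_iff: "e (f i) = b \<longleftrightarrow> lord (f i) = q ^ b" if "i \<in> I" for i b
    proof -
      obtain b' where "lord (f i) = q ^ b'" using ord[OF \<open>i \<in> I\<close>] by auto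
      then show ?thesis using e[of "f i" b'] e[of "f i" b] by auto
    qed
    have e_ran: "e (f i) \<in> {1..a}" if "i \<in> I" for i
    proof -
      from ord[OF that] obtain b where b: "b \<in> {1..a}" "lord (f i) = q ^ b" by blast
      then show ?thesis using e[OF b(2)] by simp
    qed
    have "cross I f = (\<Sum>b\<in>{1..a}. \<Sum>i\<in>{i \<in> I. e (f i) = b}. 1 / real (lord (f i)))"
      using fin e_ran by (intro sum.group[symmetric]) blast+
    also have "\<dots> = (\<Sum>b\<in>{1..a}. real (card {i \<in> I. lord (f i) = q ^ b}) * (1 / real (q ^ b)))"
    proof (rule sum.cong[OF refl])
      fix b assume "b \<in> {1..a}"
      have "{i \<in> I. e (f i) = b} = {i \<in> I. lord (f i) = q ^ b}" using e_iff by blast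
      then have "(\<Sum>i\<in>{i \<in> I. e (f i) = b}. 1 / real (lord (f i))) = (\<Sum>i\<in>{i \<in> I. lord (f i) = q ^ b}. 1 / real (q ^ b))"
        by (intro sum.cong) auto
      then show "(\<Sum>i\<in>{i \<in> I. e (f i) = b}. 1 / real (lord (f i))) = real (card {i \<in> I. lord (f i) = q ^ b}) * (1 / real (q ^ b))"
        by simp
    qed
    also have "\<dots> \<le> (\<Sum>b\<in>{1..a}. c b * (1 / real (q ^ b)))"
      using c_ge by (intro sum_mono mult_right_mono) auto
    also have "\<dots> \<le> geom q 1 a + (if k = 1 then 1 else 2)"
    proof (cases "a = 0")
      case False
      have "{1..a} = insert 1 {Suc 1..a}" using False by auto
      then have "(\<Sum>b\<in>{1..a}. c b * (1 / real (q ^ b))) =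
          c 1 * (1 / real (q ^ 1)) + (\<Sum>b\<in>{Suc 1..a}. c b * (1 / real (q ^ b)))"
        by simp
      also have "(\<Sum>b\<in>{Suc 1..a}. c b * (1 / real (q ^ b))) = (\<Sum>b\<in>{Suc 1..a}. real q / real (q ^ b))"
        by (rule sum.cong) (auto simp: c_def)
      also have "\<dots> = geom q 1 a" using q2 by (intro geom_shift) simp
      also have "c 1 * (1 / real (q ^ 1)) = (if k = 1 then 1 else 2)" using q2 by (simp add: c_def)
      finally show ?thesis by simp
    qed (simp add: geom_def)
    finally show ?thesis .
  next
    case False
    then obtain b where b: "b \<in> {2..a}" "\<not> card {i \<in> I. lord (f i) = q ^ b} \<le> q" by blast
    define M where "M = q ^ (b - 1)"
    have NM: "q ^ b = q * M" using b(1) unfolding M_def by (cases b) auto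
    have M0: "M > 0" using q2 by (simp add: M_def)
    have qM: "q dvd M" using b(1) by (auto simp: M_def)
    define W where "W = {i \<in> I. lord (f i) = q ^ b}"
    have "\<not> q ^ b dvd M" using NM M0 q2 by (auto dest!: dvd_imp_le)
    then have W: "smul (q ^ b) (f i) \<in> lat \<and> smul M (f i) \<notin> lat" if "i \<in> W" for i
      using that by (simp add: W_def smul_in_lat_iff)
    have kM: "int k dvd int M * y" for y using k qM by (auto simp: int_dvd_int_iff)
    have "card W \<le> q \<or> (\<exists>T\<subseteq>W. T \<noteq> {} \<and> card T \<le> q \<and> smul M (sum f T) \<in> lat \<and> sum f T \<notin> lat)"
      by (rule class_dichotomy[OF q NM kM _ W add_subgroup_lat smul_in_lat uf_subset[OF uf]])
        (use fin in \<open>auto simp: W_def\<close>)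
    then obtain T where T: "T \<subseteq> W" "T \<noteq> {}" "card T \<le> q" "smul M (sum f T) \<in> lat" "sum f T \<notin> lat"
      using b(2) by (auto simp: W_def)
    then obtain t where t: "t \<in> T" by blast
    have TI: "T \<subseteq> I" using T by (auto simp: W_def)
    have "T \<noteq> {t}" using T(1,4) W[of t] by auto
    then have less_card: "card (insert t (I - T)) < card I"
      by (rule card_contract_less[OF fin TI t])
    let ?f = "f(t := sum f T)" and ?I = "insert t (I - T)"
    have "cross ?I ?f \<le> geom q 1 a + (if k = 1 then 1 else 2)"
    proof (rule less.hyps[OF less_card])
      show "finite ?I" using fin by simp
      show "uf lat ?I ?f" by (rule uf_contract[OF uf fin TI t])
      fix i assume i: "i \<in> ?I"
      have "sum f T \<in> tors (q ^ a)" using tor TI by (intro sum_in_tors) auto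
      then show "?f i \<notin> lat \<and> ?f i \<in> tors (q ^ a)" using i nz tor T by auto
    qed
    moreover have "cross T f \<le> 1 / real (lord (sum f T))"
    proof -
      have "cross T f = (\<Sum>i\<in>T. 1 / real (q ^ b))"
        using T(1) by (intro sum.cong) (auto simp: W_def)
      also have "\<dots> = real (card T) / real (q ^ b)" by simp
      also have "\<dots> \<le> real q / real (q ^ b)" using T(3) by (intro divide_right_mono) auto
      also have "\<dots> = 1 / real M" using q2 by (simp add: NM)
      also have "\<dots> \<le> 1 / real (lord (sum f T))"
      proof -
        have "lord (sum f T) \<le> M" using T(4) M0 by (intro dvd_imp_le) (simp_all add: smul_in_lat_iff)
        then show ?thesis using lord_pos[of "sum f T"] by (intro divide_left_mono) auto
      qed
      finally show ?thesis .
    qed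
    ultimately show ?thesis
      using contract_weight_le[OF fin TI t, of "\<lambda>v. 1 / real (lord v)" f] by linarith
  qed
qed

end

section \<open>Divisor sums and the wideness condition\<close>

lemma geom_nonneg: "0 \<le> geom p s a"
  by (simp add: geom_def sum_nonneg)

text \<open>The left side is \<sigma>(N)/N, which is multiplicative; an inequality suffices and
  spares the injectivity of (i, d) to p^i d.\<close>

lemma sum_inverse_divisors_le:
  assumes "finite A" "\<And>p. p \<in> A \<Longrightarrow> prime p"
  shows "(\<Sum>d\<in>{d. d dvd (\<Prod>p\<in>A. p ^ e p)}. 1 / real d) \<le> (\<Prod>p\<in>A. geom p 0 (Suc (e p)))"
  using assms
proof (induction A rule: finite_induct)
  case empty
  then show ?case by simp
next
  case (insert p A)
  let ?m = "\<Prod>p\<in>A. p ^ e p"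
  have p: "prime p" using insert.prems by simp
  have m0: "?m > 0" using insert.prems prime_gt_0_nat by (intro prod_pos) simp
  have p0: "p > 0" using p by (rule prime_gt_0_nat)
  have prod: "(\<Prod>p\<in>insert p A. p ^ e p) = p ^ e p * ?m" using insert.hyps by simp
  have "(\<Sum>d\<in>{d. d dvd p ^ e p * ?m}. 1 / real d) \<le> (\<Sum>d\<in>(\<lambda>(i, d). p ^ i * d) ` ({0..<Suc (e p)} \<times> {d. d dvd ?m}). 1 / real d)"
  proof (rule sum_mono2)
    show "finite ((\<lambda>(i, d). p ^ i * d) ` ({0..<Suc (e p)} \<times> {d. d dvd ?m}))" using m0 by simp
    show "{d. d dvd p ^ e p * ?m} \<subseteq> (\<lambda>(i, d). p ^ i * d) ` ({0..<Suc (e p)} \<times> {d. d dvd ?m})"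
    proof
      fix x assume "x \<in> {d. d dvd p ^ e p * ?m}"
      then have "x dvd p ^ e p * ?m" by simp
      then obtain b d where "x = p ^ b * d" "b \<le> e p" "d dvd ?m" by (rule prime_power_divisor[OF p])
      then show "x \<in> (\<lambda>(i, d). p ^ i * d) ` ({0..<Suc (e p)} \<times> {d. d dvd ?m})"
        by (intro image_eqI[of _ _ "(b, d)"]) auto
    qed
  qed simp
  also have "\<dots> \<le> sum ((\<lambda>d. 1 / real d) \<circ> (\<lambda>(i, d). p ^ i * d)) ({0..<Suc (e p)} \<times> {d. d dvd ?m})"
    using m0 by (intro sum_image_le) auto
  also have "\<dots> = (\<Sum>(i, d)\<in>{0..<Suc (e p)} \<times> {d. d dvd ?m}. (1 / real p) ^ i * (1 / real d))"
    by (rule sum.cong) (auto simp: power_one_over)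
  also have "\<dots> = geom p 0 (Suc (e p)) * (\<Sum>d\<in>{d. d dvd ?m}. 1 / real d)"
    unfolding geom_def sum_product sum.cartesian_product ..
  also have "\<dots> \<le> geom p 0 (Suc (e p)) * (\<Prod>p\<in>A. geom p 0 (Suc (e p)))"
    using insert.IH insert.prems by (intro mult_left_mono geom_nonneg) simp
  finally show ?case using insert.hyps unfolding prod by simp
qed

lemma geom_closed_form:
  assumes "p \<ge> 2"
  shows "geom p 0 (Suc e) = (real p ^ (e + 1) - 1) / (real p ^ (e + 1) - real p ^ e)"
proof -
  have p: "real p > 1" using assms by simp
  have "(1 - 1 / real p) * geom p 0 (Suc e) = 1 - (1 / real p) ^ Suc e"
    unfolding geom_def using inverse_powers_sum[of 0 "Suc e" "1 / real p"] by simp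
  then have "real p ^ Suc e * ((1 - 1 / real p) * geom p 0 (Suc e)) = real p ^ Suc e * (1 - (1 / real p) ^ Suc e)"
    by simp
  moreover have "real p ^ Suc e * ((1 - 1 / real p) * g) = (real p ^ (e + 1) - real p ^ e) * g" for g
    using p by (simp add: field_simps)
  moreover have "real p ^ Suc e * (1 - (1 / real p) ^ Suc e) = real p ^ (e + 1) - 1"
    using p by (simp add: right_diff_distrib power_one_over del: power_Suc)
  ultimately have "(real p ^ (e + 1) - real p ^ e) * geom p 0 (Suc e) = real p ^ (e + 1) - 1" by metis
  moreover have "real p ^ (e + 1) - real p ^ e > 0" using p by simp
  ultimately show ?thesis by (subst nonzero_eq_divide_eq) (simp_all add: mult.commute del: power_Suc)
qed

lemma two_wide_wrt_sum_divisors: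
  assumes "p \<prec>\<^sub>2 m"
  shows "(\<Sum>d\<in>{d. d dvd m}. 1 / real d) \<le> 1 + 2 * (real p - 1) / (real p)\<^sup>2"
proof -
  have m: "m > 0" and p0: "p > 0" using assms prime_gt_0_nat by (auto simp: two_wide_wrt_def)
  have "(\<Sum>d\<in>{d. d dvd (\<Prod>q\<in>prime_factors m. q ^ multiplicity q m)}. 1 / real d) \<le>
      (\<Prod>q\<in>prime_factors m. geom q 0 (Suc (multiplicity q m)))"
    by (rule sum_inverse_divisors_le) auto
  also have "(\<Prod>q\<in>prime_factors m. q ^ multiplicity q m) = m"
    using prime_factorization_nat[OF m] by simp
  also have "(\<Prod>q\<in>prime_factors m. geom q 0 (Suc (multiplicity q m))) =
      (\<Prod>q\<in>prime_factors m. (real q ^ (multiplicity q m + 1) - 1) /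
        (real q ^ (multiplicity q m + 1) - real q ^ multiplicity q m))"
    by (intro prod.cong refl geom_closed_form prime_ge_2_nat) auto
  also have "\<dots> \<le> (real p ^ 2 + 2 * real p - 2) / real p ^ 2"
    using assms by (simp add: two_wide_wrt_def)
  also have "\<dots> = 1 + 2 * (real p - 1) / (real p)\<^sup>2"
    using p0 by (simp add: field_simps)
  finally show ?thesis .
qed

definition cyclic_value :: "nat \<Rightarrow> real" where
  "cyclic_value n = (\<Sum>p\<in>prime_factors n. geom p 0 (multiplicity p n))"

text \<open>The downward induction runs through all integers from \<open>q\<close> to 0, where
  \<open>M j\<close> collects the prime factors not below \<open>j\<close>; a \<open>j\<close> that
  is not a prime factor changes nothing. For a prime factor j < q, wideness relative to
  \<open>M (Suc j)\<close> is exactly the hypothesis on \<open>n\<close>.\<close>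

lemma (in pair_lattice) two_wide_bound:
  fixes I :: "'i set"
  assumes wide: "two_wide n" and n1: "n > 1" and q: "q = largest_prime_factor n"
    and k: "k = 1 \<or> k = q"
    and I: "finite I" "uf lat I f" "\<And>i. i \<in> I \<Longrightarrow> f i \<notin> lat"
  shows "cross I f \<le> cyclic_value n + (if k = 1 then 0 else 1)"
proof -
  define S where "S j = {p \<in> prime_factors n. j \<le> p}" for j
  define M where "M j = (\<Prod>p\<in>S j. p ^ multiplicity p n)" for j
  define C where "C j = (\<Sum>p\<in>S j. geom p 0 (multiplicity p n)) + (if k = 1 then 0 else 1)" for j
  have finS: "finite (S j)" for j by (simp add: S_def)
  have ne: "prime_factors n \<noteq> {}" using n1 by (simp add: prime_factorization_empty_iff)
  have qmax: "q = Max (prime_factors n)" using q n1 by (simp add: largest_prime_factor_def)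
  have qn: "q \<in> prime_factors n" unfolding qmax using ne by (intro Max_in) auto
  have pq: "prime q" using qn by auto
  have q_ge: "p \<le> q" if "p \<in> prime_factors n" for p unfolding qmax using that by (intro Max_ge) auto
  have claim: "\<forall>(I :: 'i set) f. finite I \<longrightarrow> uf lat I f \<longrightarrow> (\<forall>i\<in>I. f i \<notin> lat \<and> f i \<in> tors (M j)) \<longrightarrow>
      cross I f \<le> C j" if "j \<le> q" for j
    using that
  proof (induction rule: inc_induct)
    case base
    have Sq: "S q = {q}" using qn q_ge by (force simp: S_def)
    have "multiplicity q n > 0" using qn by (simp add: prime_factors_multiplicity)
    then have "C q = geom q 1 (multiplicity q n) + (if k = 1 then 1 else 2)"
      using geom_Suc_left[of 0 "multiplicity q n" q] by (simp add: C_def Sq)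
    moreover have "M q = q ^ multiplicity q n" by (simp add: M_def Sq)
    ultimately show ?case using prime_power_bound[OF pq k, where a = "multiplicity q n" and 'i = 'i] by simp
  next
    case (step j)
    show ?case
    proof (cases "j \<in> prime_factors n")
      case False
      then have "S j = S (Suc j)" by (auto simp: S_def Suc_le_eq order.order_iff_strict)
      then show ?thesis using step.IH by (simp add: M_def C_def)
    next
      case True
      have Sj: "S j = insert j (S (Suc j))" "j \<notin> S (Suc j)" using True by (auto simp: S_def)
      have "j < q" using step.hyps by simp
      then have "j \<prec>\<^sub>2 (\<Prod>p\<in>{p \<in> prime_factors n. j < p}. p ^ multiplicity p n)"
        using wide True q by (simp add: two_wide_def)
      then have wrt: "j \<prec>\<^sub>2 M (Suc j)" by (simp add: M_def S_def Suc_le_eq)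
      have pj: "prime j" using True by auto
      have jk: "\<not> j dvd k"
        using k pj pq \<open>j < q\<close> by (auto simp: primes_dvd_imp_eq dest: primes_dvd_imp_eq)
      interpret prime_step n k j "multiplicity j n" "M (Suc j)" "C (Suc j)"
        by unfold_locales (use pj jk wrt in \<open>auto simp: two_wide_wrt_def\<close>)
      have Mj: "M j = j ^ multiplicity j n * M (Suc j)" using Sj finS by (simp add: M_def)
      have Cj: "C j = geom j 0 (multiplicity j n) + C (Suc j)" using Sj finS by (simp add: C_def)
      show ?thesis
      proof (intro allI impI)
        fix I :: "'i set" and f
        assume I: "finite I" "uf lat I f" "\<forall>i\<in>I. f i \<notin> lat \<and> f i \<in> tors (M j)"
        show "cross I f \<le> C j"
          unfolding Cj
        proof (rule prime_step_bound[OF _ two_wide_wrt_sum_divisors[OF wrt] I(1,2)])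
          show "cross J g \<le> C (Suc j)"
            if "finite J" "uf lat J g" "\<And>i. i \<in> J \<Longrightarrow> g i \<notin> lat \<and> g i \<in> tors (M (Suc j))"
            for J :: "'i set" and g
            using step.IH that by blast
          show "f i \<notin> lat \<and> f i \<in> tors (j ^ multiplicity j n * M (Suc j))" if "i \<in> I" for i
            using I(3) that Mj by simp
        qed
      qed
    qed
  qed
  have S0: "S 0 = prime_factors n" by (simp add: S_def)
  have "M 0 = n" using prime_factorization_nat[OF n_pos] by (simp add: M_def S0)
  moreover have "v \<in> tors n" for v
  proof -
    have "k dvd n" using k qn by auto
    then show ?thesis by (simp add: tors_def lat_def)
  qed
  ultimately show ?thesis using claim[OF le0] I by (simp add: C_def S0 cyclic_value_def)
qed

section \<open>Families attaining the bound\<close>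

lemma add_subgroup_smul:
  assumes "add_subgroup H" "v \<in> H"
  shows "smul m v \<in> H"
proof (induction m)
  case 0
  have "smul 0 v = 0" by (simp add: smul_def zero_prod_def)
  then show ?case using add_subgroup_zero[OF assms(1)] by simp
next
  case (Suc m)
  have "smul (Suc m) v = smul m v + v" by (simp add: prod_eq_iff algebra_simps)
  then show ?case using add_subgroup_add[OF assms(1) Suc assms(2)] by simp
qed

text \<open>Modulo \<open>H\<close> the element \<open>e\<close> has order exactly \<open>p\<close>;
  the witness is a Bezout identity.\<close>

lemma prime_dvd_of_smul_in:
  assumes p: "prime p" and H: "add_subgroup H" and e: "smul p e \<in> H" "e \<notin> H" and c: "smul c e \<in> H"
  shows "p dvd c"
proof (rule ccontr)
  assume "\<not> p dvd c"
  then have "coprime p c" by (rule prime_imp_coprime[OF p])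
  then have "gcd c p = 1" by (simp add: coprime_iff_gcd_eq_1 gcd.commute)
  moreover have "c \<noteq> 0" using \<open>\<not> p dvd c\<close> by (metis dvd_0_right)
  ultimately obtain x y where xy: "c * x = p * y + 1" using bezout_nat[of c p] by auto
  have "e = smul x (smul c e) - smul y (smul p e)"
  proof -
    have "smul x (smul c e) = smul (c * x) e" "smul y (smul p e) = smul (p * y) e"
      by (simp_all add: smul_smul mult.commute)
    then show ?thesis unfolding xy by (simp add: prod_eq_iff algebra_simps)
  qed
  also have "\<dots> \<in> H" using e(1) c add_subgroup_smul[OF H] by (intro add_subgroup_diff[OF H])
  finally show False using e(2) by simp
qed

context pair_lattice
begin

lemma lord_eqI: "(\<And>c. smul c v \<in> lat \<longleftrightarrow> r dvd c) \<Longrightarrow> lord v = r"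
  by (metis dvd_antisym dvd_refl smul_in_lat_iff)

lemma lord_uminus: "lord (- v) = lord v"
  by (rule lord_eqI) (simp add: smul_in_lat_iff[symmetric] lat_def)

lemma lord_smul_coprime: "coprime c (lord v) \<Longrightarrow> lord (smul c v) = lord v"
  by (rule lord_eqI)
    (simp add: smul_smul smul_in_lat_iff coprime_commute coprime_dvd_mult_left_iff)

text \<open>A UFIS must itself be zero-sum, which \<open>uf\<close> does not include; hence the
  condition on the total sum. Indices in \<open>nat\<close> leave room for further blocks.\<close>

definition attains :: "(int \<times> int) set \<Rightarrow> real \<Rightarrow> bool" where
  "attains H x \<longleftrightarrow> (\<exists>(I :: nat set) f. finite I \<and> uf lat I f \<and> sum f I \<in> lat \<and>
     (\<forall>i\<in>I. f i \<in> H \<and> f i \<notin> lat) \<and> cross I f = x)"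

text \<open>The new block consists of \<open>p - 1\<close> copies of \<open>e\<close> and one copy of \<open>(1 - p) e\<close>.\<close>

lemma attains_extend:
  assumes att: "attains H x" and H: "add_subgroup H" "lat \<subseteq> H"
    and H': "add_subgroup H'" "H \<subseteq> H'" "e \<in> H'"
    and p: "prime p" and e: "smul p e \<in> H" "e \<notin> H" and ord: "lord e = p ^ b"
  shows "attains H' (x + real p / real (p ^ b))"
proof -
  obtain I f where I: "finite (I :: nat set)" "uf lat I f" "sum f I \<in> lat"
    "\<forall>i\<in>I. f i \<in> H \<and> f i \<notin> lat" "cross I f = x"
    using att unfolding attains_def by blast
  obtain N where N: "\<forall>i\<in>I. i < N" using I(1) finite_nat_iff_bounded by auto
  define B where "B = {N..<N + p}"
  define l where "l = N + (p - 1)"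
  \<comment> \<open>Since p e lies in \<open>H\<close>, \<open>u\<close> is congruent to
    \<open>e\<close> modulo \<open>H\<close>, so r terms of the block sum to r e modulo
    \<open>H\<close>, while the whole block sums to 0 exactly. As p - 1 is coprime to
    \<open>p\<close>, \<open>u\<close> has the same order as \<open>e\<close>.\<close>
  define u where "u = - smul (p - 1) e"
  define g where "g i = (if i = l then u else if i \<in> B then e else f i)" for i
  have p2: "p \<ge> 2" using p by (rule prime_ge_2_nat)
  have B: "finite B" "card B = p" "I \<inter> B = {}" "l \<in> B" using N p2 by (auto simp: B_def l_def)
  have gI: "g i = f i" if "i \<in> I" for i using that B by (auto simp: g_def)
  have sumI: "sum g X = sum f X" if "X \<subseteq> I" for X using that gI by (intro sum.cong) auto
  have e_lat: "e \<notin> lat" using e(2) H(2) by blast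
  have b0: "b > 0" using e_lat ord lord_eq_1_iff[of e] by (cases b) auto
  have cop: "coprime (p - 1) (lord e)"
  proof -
    have "coprime (p - 1) p" by (rule coprime_diff_one_left_nat) (use p2 in simp)
    then show ?thesis unfolding ord by simp
  qed
  have ordB: "lord (g i) = p ^ b" if "i \<in> B" for i
    using that ord lord_smul_coprime[OF cop] by (simp add: g_def u_def lord_uminus)
  have const: "sum (\<lambda>_. e) Y = smul (card Y) e" for Y :: "nat set"
    by (simp add: prod_eq_iff fst_sum snd_sum)
  have sumB: "\<exists>h\<in>H. sum g Y + h = smul (card Y) e" if Y: "Y \<subseteq> B" for Y
  proof -
    have finY: "finite Y" using Y B by (auto dest: finite_subset)
    show ?thesis
    proof (cases "l \<in> Y")
      case False
      then have "sum g Y = sum (\<lambda>_. e) Y" using Y by (intro sum.cong) (auto simp: g_def)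
      then show ?thesis using const add_subgroup_zero[OF H(1)] by (intro bexI[of _ 0]) auto
    next
      case True
      have "sum g (Y - {l}) = sum (\<lambda>_. e) (Y - {l})" using Y by (intro sum.cong) (auto simp: g_def)
      then have "sum g Y = u + smul (card (Y - {l})) e"
        using True finY by (simp add: sum.remove[of Y l] g_def const)
      moreover have "card Y = card (Y - {l}) + 1" using True finY by (metis Suc_eq_plus1 card_Suc_Diff1)
      ultimately have "sum g Y + smul p e = smul (card Y) e"
        using p2 by (simp add: u_def prod_eq_iff algebra_simps of_nat_diff)
      then show ?thesis using e(1) by blast
    qed
  qed
  have sumB0: "sum g B = 0"
  proof -
    have "sum g (B - {l}) = sum (\<lambda>_. e) (B - {l})" by (rule sum.cong) (auto simp: g_def)
    then have "sum g B = u + smul (card (B - {l})) e"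
      using B by (simp add: sum.remove[of B l] g_def const)
    then show ?thesis using B by (simp add: u_def)
  qed
  have split: "sum g X = sum f (X \<inter> I) + sum g (X \<inter> B)" if X: "X \<subseteq> I \<union> B" for X
  proof -
    have "sum g X = sum g ((X \<inter> I) \<union> (X \<inter> B))" using X by (intro sum.cong) auto
    also have "\<dots> = sum g (X \<inter> I) + sum g (X \<inter> B)"
      using I(1) B by (intro sum.union_disjoint) auto
    finally show ?thesis using sumI[of "X \<inter> I"] by simp
  qed
  have sub: "sum f X \<in> H" if "X \<subseteq> I" for X
    using that I(4) 
  proof (induction X rule: infinite_finite_induct)
    case (insert i X)
    then show ?case using add_subgroup_add[OF H(1)] by auto
  qed (use add_subgroup_zero[OF H(1)] in auto)
  \<comment> \<open>Modulo \<open>H\<close> only the block is visible: a zero-sum set contains a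
    number of its terms divisible by \<open>p\<close>, hence none or all of them.\<close>
  have zero: "sum g (X \<inter> B) = 0 \<and> (X \<inter> B = {} \<or> B \<subseteq> X) \<and> sum f (X \<inter> I) \<in> lat"
    if X: "X \<subseteq> I \<union> B" and s: "sum g X \<in> lat" for X
  proof -
    obtain h where h: "h \<in> H" "sum g (X \<inter> B) + h = smul (card (X \<inter> B)) e"
      using sumB[of "X \<inter> B"] by auto
    have "sum g (X \<inter> B) = sum g X - sum f (X \<inter> I)" using split[OF X] by simp
    moreover have "sum g X - sum f (X \<inter> I) \<in> H"
      by (rule add_subgroup_diff[OF H(1) subsetD[OF H(2) s] sub]) simp
    ultimately have "sum g (X \<inter> B) \<in> H" by simp
    then have "smul (card (X \<inter> B)) e \<in> H" using h add_subgroup_add[OF H(1)] by metis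
    then have d: "p dvd card (X \<inter> B)" by (rule prime_dvd_of_smul_in[OF p H(1) e])
    have "card (X \<inter> B) \<le> p" using B card_mono[of B "X \<inter> B"] by simp
    then consider "card (X \<inter> B) = 0" | "card (X \<inter> B) = p"
      using d p2 by (metis dvd_imp_le le_antisym neq0_conv)
    then have "X \<inter> B = {} \<or> B \<subseteq> X"
    proof cases
      case 1
      then show ?thesis using B by simp
    next
      case 2
      then have "X \<inter> B = B" using B by (intro card_seteq) auto
      then show ?thesis by blast
    qed
    moreover from this have "X \<inter> B = {} \<or> X \<inter> B = B" by blast
    then have "sum g (X \<inter> B) = 0" using sumB0 by auto
    ultimately show ?thesis using s split[OF X] by simp
  qed
  have ufg: "uf lat (I \<union> B) g"
    unfolding uf_def
  proof (intro allI impI)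
    fix X Y assume X: "X \<subseteq> I \<union> B" and Y: "Y \<subseteq> I \<union> B" and s: "sum g X \<in> lat" "sum g Y \<in> lat"
    note zX = zero[OF X s(1)] and zY = zero[OF Y s(2)]
    have "sum f (X \<inter> I \<inter> (Y \<inter> I)) \<in> lat" by (rule ufD[OF I(2)]) (use zX zY in auto)
    moreover have "X \<inter> I \<inter> (Y \<inter> I) = X \<inter> Y \<inter> I" by blast
    moreover have "X \<inter> Y \<inter> B = {} \<or> X \<inter> Y \<inter> B = B" using zX zY by blast
    then have "sum g (X \<inter> Y \<inter> B) = 0" using sumB0 by auto
    moreover have "X \<inter> Y \<subseteq> I \<union> B" using X by blast
    ultimately show "sum g (X \<inter> Y) \<in> lat" using split[of "X \<inter> Y"] by simp
  qed
  have "cross (I \<union> B) g = cross I g + cross B g"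
    using I(1) B by (intro sum.union_disjoint) auto
  also have "cross I g = x" using I(5) gI by simp
  also have "cross B g = real p / real (p ^ b)" using B ordB by simp
  finally have "cross (I \<union> B) g = x + real p / real (p ^ b)" .
  moreover have "sum g (I \<union> B) \<in> lat"
  proof -
    have "(I \<union> B) \<inter> I = I" "(I \<union> B) \<inter> B = B" by auto
    then show ?thesis using split[of "I \<union> B"] sumB0 I(3) by simp
  qed
  moreover have "g i \<in> H' \<and> g i \<notin> lat" if "i \<in> I \<union> B" for i
  proof (cases "i \<in> I")
    case True
    then show ?thesis using I(4) gI H'(2) by auto
  next
    case False
    then have iB: "i \<in> B" using that by simp
    have "lord (g i) \<noteq> 1" using ordB[OF iB] b0 p2 by simp
    then have "g i \<notin> lat" using lord_eq_1_iff by blast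
    moreover have "u \<in> H'"
      unfolding u_def
      using add_subgroup_diff[OF H'(1) add_subgroup_zero[OF H'(1)] add_subgroup_smul[OF H'(1,3)], of "p - 1"]
      by simp
    ultimately show ?thesis using iB H'(3) by (simp add: g_def)
  qed
  ultimately show ?thesis
    unfolding attains_def using I(1) B(1) ufg by (intro exI[of _ "I \<union> B"] exI[of _ g]) auto
qed

definition tors_fst :: "nat \<Rightarrow> (int \<times> int) set" where
  "tors_fst m = {v. int n dvd int m * fst v \<and> int k dvd snd v}"

lemma add_subgroup_tors_fst: "add_subgroup (tors_fst m)"
  by (auto simp: add_subgroup_def tors_fst_def right_diff_distrib)

text \<open>The m-torsion of C_n is built up one prime factor at a time. With b the exponent of p in
  m, the new block consists of p terms of order p^b and adds p / p^b, precisely the next term of the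
  geometric sum for p.\<close>

lemma attains_tors_fst: "m dvd n \<Longrightarrow> attains (tors_fst m) (cyclic_value m)"
proof (induction m rule: less_induct)
  case (less m)
  have m0: "m > 0" using less.prems n_pos by (auto intro!: Nat.gr0I)
  show ?case
  proof (cases "m = 1")
    case True
    then show ?thesis
      unfolding attains_def
      by (intro exI[of _ "{}"]) (simp add: uf_def cyclic_value_def)
  next
    case False
    then obtain p where p: "prime p" "p dvd m" using prime_factor_nat by blast
    then obtain m' where m': "m = p * m'" by (auto elim: dvdE)
    have p2: "p \<ge> 2" using p(1) by (rule prime_ge_2_nat)
    have m'0: "m' > 0" using m' m0 by simp
    have "attains (tors_fst m') (cyclic_value m')"
      using less.IH[of m'] less.prems m' m'0 p2 by (auto dest: dvd_mult_right)
    define b where "b = multiplicity p m"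
    have b: "b = Suc (multiplicity p m')"
      using p m'0 prime_gt_1_nat unfolding b_def m' by (intro multiplicity_times_same) auto
    obtain c where c: "n = p ^ b * c"
    proof -
      have "p ^ b dvd m" unfolding b_def by (rule multiplicity_dvd)
      then have "p ^ b dvd n" using less.prems by (rule dvd_trans)
      then show ?thesis using that by (auto elim: dvdE)
    qed
    have c0: "c > 0" using c n_pos by simp
    define e where "e = (int c, 0 :: int)"
    have smul_e: "int n dvd int x * int c \<longleftrightarrow> p ^ b dvd x" for x
      using c0 unfolding c of_nat_mult[symmetric] int_dvd_int_iff by (simp add: mult.commute)
    have "attains (tors_fst m) (cyclic_value m' + real p / real (p ^ b))"
    proof (rule attains_extend[where H = "tors_fst m'" and e = e])
      show "lat \<subseteq> tors_fst m'" by (auto simp: lat_def tors_fst_def)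
      show "tors_fst m' \<subseteq> tors_fst m" by (auto simp: tors_fst_def m' mult.assoc)
      have "p ^ b dvd m" unfolding b_def by (rule multiplicity_dvd)
      then show "e \<in> tors_fst m" using smul_e[of m] by (simp add: e_def tors_fst_def)
      have "p ^ b dvd m' * p" using \<open>p ^ b dvd m\<close> by (simp add: m' mult.commute)
      then show "smul p e \<in> tors_fst m'"
        using smul_e[of "m' * p"] by (simp add: e_def tors_fst_def mult.assoc)
      have "\<not> p ^ b dvd m'"
        unfolding b using p m'0 p2 by (simp add: power_dvd_iff_le_multiplicity del: power_Suc)
      then show "e \<notin> tors_fst m'" using smul_e[of m'] by (simp add: e_def tors_fst_def)
      show "lord e = p ^ b" by (rule lord_eqI) (simp add: e_def lat_def smul_e)
    qed (use \<open>attains (tors_fst m') (cyclic_value m')\<close> add_subgroup_tors_fst p(1) in auto)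
    moreover have "cyclic_value m = cyclic_value m' + real p / real (p ^ b)"
    proof -
      have sub: "prime_factors m' \<subseteq> prime_factors m" using m0 by (simp add: m' dvd_prime_factors)
      have pm: "p \<in> prime_factors m" using p m0 by (simp add: prime_factors_dvd)
      have "cyclic_value m' = (\<Sum>r\<in>prime_factors m. geom r 0 (multiplicity r m'))"
        unfolding cyclic_value_def
      proof (rule sum.mono_neutral_left[OF _ sub])
        show "\<forall>r\<in>prime_factors m - prime_factors m'. geom r 0 (multiplicity r m') = 0"
          by (auto simp: geom_def prime_factors_multiplicity)
      qed simp
      also have "\<dots> = geom p 0 (multiplicity p m') + (\<Sum>r\<in>prime_factors m - {p}. geom r 0 (multiplicity r m'))"
        using pm by (simp add: sum.remove)
      finally have 1: "cyclic_value m' = \<dots>" .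
      have "cyclic_value m = geom p 0 b + (\<Sum>r\<in>prime_factors m - {p}. geom r 0 (multiplicity r m))"
        unfolding cyclic_value_def b_def using pm by (simp add: sum.remove)
      also have "(\<Sum>r\<in>prime_factors m - {p}. geom r 0 (multiplicity r m)) =
          (\<Sum>r\<in>prime_factors m - {p}. geom r 0 (multiplicity r m'))"
      proof (rule sum.cong[OF refl])
        fix r assume r: "r \<in> prime_factors m - {p}"
        then have "prime r" "r \<noteq> p" by auto
        then have "\<not> r dvd p" using p(1) primes_dvd_imp_eq by blast
        then have "multiplicity r m = multiplicity r m'"
          unfolding m' using \<open>prime r\<close> p2 m'0
          by (subst prime_elem_multiplicity_mult_distrib) (auto simp: not_dvd_imp_multiplicity_0)
        then show "geom r 0 (multiplicity r m) = geom r 0 (multiplicity r m')" by simp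
      qed
      also have "geom p 0 b = geom p 0 (multiplicity p m') + real p / real (p ^ b)"
        using p2 unfolding b by (simp add: geom_def power_one_over)
      finally show ?thesis using 1 by simp
    qed
    ultimately show ?thesis by simp
  qed
qed

lemma attains_cyclic_value: "attains UNIV (cyclic_value n)"
  using attains_tors_fst[of n] unfolding attains_def by auto

lemma attains_rank_two:
  assumes k: "prime k"
  shows "attains UNIV (cyclic_value n + 1)"
proof -
  have "attains UNIV (cyclic_value n + real k / real (k ^ 1))"
  proof (rule attains_extend[where H = "tors_fst n" and e = "(0, 1)"])
    show "attains (tors_fst n) (cyclic_value n)" by (rule attains_tors_fst) simp
    show "lat \<subseteq> tors_fst n" by (auto simp: lat_def tors_fst_def)
    show "lord (0, 1) = k ^ 1" by (rule lord_eqI) (simp add: lat_def int_dvd_int_iff)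
    show "(0, 1) \<notin> tors_fst n" using prime_gt_1_nat[OF k] by (simp add: tors_fst_def)
  qed (use k add_subgroup_tors_fst in \<open>auto simp: tors_fst_def add_subgroup_def\<close>)
  then show ?thesis using k_pos by simp
qed

end

section \<open>Indexed sequences over a realised group\<close>

lemma mset_set_set_mset:
  assumes "\<And>x. count M x \<le> 1"
  shows "mset_set (set_mset M) = M"
proof (rule multiset_eqI)
  fix x show "count (mset_set (set_mset M)) x = count M x"
  proof (cases "x \<in># M")
    case True
    then have "1 \<le> count M x" by (simp only: count_greater_eq_one_iff)
    then have "count M x = 1" by (rule le_antisym[OF assms])
    then show ?thesis using True by simp
  qed (simp add: not_in_iff)
qed

lemma subseteq_mset_set:
  assumes "finite Z" "M \<subseteq># mset_set Z"
  shows "M = mset_set (set_mset M)" "set_mset M \<subseteq> Z"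
proof -
  have c: "count M x \<le> (if x \<in> Z then 1 else 0)" for x
    using mset_subset_eq_count[OF assms(2), of x] assms(1) by (simp add: count_mset_set')
  have "count M x \<le> 1" for x using c[of x] by (auto split: if_splits)
  then show "M = mset_set (set_mset M)" by (simp add: mset_set_set_mset)
  show "set_mset M \<subseteq> Z"
    using mset_subset_eqD[OF assms(2)] assms(1) by auto
qed

lemma mset_set_eq_add:
  assumes "finite Z" "M + N = mset_set Z"
  obtains X where "X \<subseteq> Z" "M = mset_set X" "N = mset_set (Z - X)"
proof -
  have "M \<subseteq># mset_set Z" using assms(2) by (metis mset_subset_eq_add_left)
  note M = subseteq_mset_set[OF assms(1) this]
  have "N = mset_set Z - mset_set (set_mset M)" using assms(2) M(1) by (metis add_diff_cancel_left')
  also have "\<dots> = mset_set (Z - set_mset M)" using assms(1) M(2) by (simp add: mset_set_Diff)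
  finally show ?thesis using that M by blast
qed

lemma indexed_seq_mset_set:
  assumes "indexed_seq G S"
  shows "S = mset_set (set_mset S)" "set_mset S \<subseteq> (carrier G - {\<one>\<^bsub>G\<^esub>}) \<times> UNIV"
proof -
  have "count S x \<le> 1" for x using assms unfolding indexed_seq_def by blast
  then show "S = mset_set (set_mset S)" by (simp add: mset_set_set_mset)
  show "set_mset S \<subseteq> (carrier G - {\<one>\<^bsub>G\<^esub>}) \<times> UNIV" using assms by (simp add: indexed_seq_def)
qed

lemma val_mset_set: "finite A \<Longrightarrow> val g (mset_set A) = card {x \<in> A. fst x = g}"
  by (simp add: val_def)

locale finite_comm_group = comm_group G for G :: "('a, 'b) monoid_scheme" (structure) +
  assumes finite_carrier: "finite (carrier G)"
begin

abbreviation terms :: "('a \<times> nat) set" where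
  "terms \<equiv> (carrier G - {\<one>}) \<times> UNIV"

lemma seq_sum_mset_set:
  assumes "finite A" "A \<subseteq> terms"
  shows "seq_sum G (mset_set A) = finprod G fst A"
  using assms
proof (induction A rule: finite_induct)
  case empty
  have "(\<Otimes>g\<in>carrier G - {\<one>}. g [^] val g (mset_set {})) = \<one>"
    by (rule finprod_one_eqI) (simp add: val_def)
  then show ?case unfolding seq_sum_def by simp
next
  case (insert x A)
  let ?C = "carrier G - {\<one>}"
  have x: "fst x \<in> ?C" using insert.prems by (auto simp: mem_Times_iff)
  have v: "val g (mset_set (insert x A)) = val g (mset_set A) + (if g = fst x then 1 else 0)" for g
  proof -
    have "val g (mset_set (insert x A)) = card {y \<in> insert x A. fst y = g}"
      by (rule val_mset_set) (use insert.hyps in simp)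
    also have "{y \<in> insert x A. fst y = g} = (if g = fst x then insert x {y \<in> A. fst y = g} else {y \<in> A. fst y = g})"
      by auto
    also have "card \<dots> = card {y \<in> A. fst y = g} + (if g = fst x then 1 else 0)"
      using insert.hyps by simp
    finally show ?thesis using insert.hyps(1) by (simp add: val_mset_set)
  qed
  have "seq_sum G (mset_set (insert x A)) =
      (\<Otimes>g\<in>?C. g [^] val g (mset_set A) \<otimes> (if fst x = g then g else \<one>))"
    unfolding seq_sum_def v by (intro finprod_cong') auto
  also have "\<dots> = (\<Otimes>g\<in>?C. g [^] val g (mset_set A)) \<otimes> (\<Otimes>g\<in>?C. if fst x = g then g else \<one>)"
    by (intro finprod_multf) auto
  also have "(\<Otimes>g\<in>?C. if fst x = g then g else \<one>) = fst x"
    using x finite_carrier by (intro finprod_singleton) auto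
  also have "(\<Otimes>g\<in>?C. g [^] val g (mset_set A)) = finprod G fst A"
    using insert by (simp add: seq_sum_def)
  also have "finprod G fst A \<otimes> fst x = finprod G fst (insert x A)"
    using insert.hyps insert.prems x by (subst finprod_insert) (auto intro!: m_comm finprod_closed)
  finally show ?case .
qed

lemma cross_number_mset_set:
  assumes "finite A" "A \<subseteq> terms"
  shows "cross_number G (mset_set A) = (\<Sum>x\<in>A. 1 / real (ord (fst x)))"
proof -
  have "(\<Sum>x\<in>A. 1 / real (ord (fst x))) =
      (\<Sum>g\<in>carrier G - {\<one>}. \<Sum>x\<in>{x \<in> A. fst x = g}. 1 / real (ord (fst x)))"
    using assms finite_carrier by (intro sum.group[symmetric]) auto
  also have "\<dots> = (\<Sum>g\<in>carrier G - {\<one>}. \<Sum>x\<in>{x \<in> A. fst x = g}. 1 / real (ord g))"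
    by (intro sum.cong refl) simp
  finally show ?thesis using assms(1) by (simp add: cross_number_def val_mset_set)
qed

lemma zero_sum_mset_set:
  "finite A \<Longrightarrow> A \<subseteq> terms \<Longrightarrow> zero_sum G (mset_set A) \<longleftrightarrow> finprod G fst A = \<one>"
  by (simp add: zero_sum_def seq_sum_mset_set)

lemma indexed_seq_terms: "finite A \<Longrightarrow> A \<subseteq> terms \<Longrightarrow> indexed_seq G (mset_set A)"
  by (auto simp: indexed_seq_def count_mset_set')

lemma finprod_terms_split:
  assumes "finite A" "A \<subseteq> terms" "X \<subseteq> A"
  shows "finprod G fst A = finprod G fst X \<otimes> finprod G fst (A - X)"
proof -
  have "finprod G fst (X \<union> (A - X)) = finprod G fst X \<otimes> finprod G fst (A - X)"
    using assms by (intro finprod_Un_disjoint) (auto dest: finite_subset)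
  moreover have "X \<union> (A - X) = A" using assms by blast
  ultimately show ?thesis by simp
qed

lemma finprod_terms_diff:
  assumes "finite A" "A \<subseteq> terms" "X \<subseteq> A" "finprod G fst A = \<one>" "finprod G fst X = \<one>"
  shows "finprod G fst (A - X) = \<one>"
proof -
  have "finprod G fst (A - X) \<in> carrier G" using assms by (intro finprod_closed) auto
  then show ?thesis using finprod_terms_split[OF assms(1-3)] assms(4,5) by simp
qed

lemma irreducible_factorization_exists:
  assumes "finite A" "A \<subseteq> terms" "finprod G fst A = \<one>"
  shows "\<exists>F. irreducible_factorization G (mset_set A) F"
  using assms
proof (induction "card A" arbitrary: A rule: less_induct)
  case less
  note A = less.prems
  show ?case
  proof (cases "A = {} \<or> irreducible_seq G (mset_set A)")
    case True
    then show ?thesis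
    proof
      assume "A = {}"
      then show ?thesis by (intro exI[of _ "{#}"]) (simp add: irreducible_factorization_def)
    next
      assume "irreducible_seq G (mset_set A)"
      then show ?thesis
        by (intro exI[of _ "{#mset_set A#}"]) (simp add: irreducible_factorization_def)
    qed
  next
    case False
    have "mset_set A \<noteq> {#}" using False A(1) by (simp add: mset_set_empty_iff)
    then obtain T where T: "T \<subseteq># mset_set A" "T \<noteq> {#}" "T \<noteq> mset_set A" "zero_sum G T"
      using False A indexed_seq_terms zero_sum_mset_set unfolding irreducible_seq_def by blast
    define X where "X = set_mset T"
    have TX: "T = mset_set X" and XA: "X \<subseteq> A" using subseteq_mset_set[OF A(1) T(1)] by (simp_all add: X_def)
    have "finite X" "X \<noteq> {}" using T(2) by (simp_all add: X_def)
    moreover have "X \<subseteq> terms" using XA A(2) by (rule subset_trans)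
    moreover have "X \<noteq> A" using T(3) TX by blast
    ultimately have X: "finite X" "X \<subseteq> terms" "X \<noteq> {}" "X \<noteq> A" by simp_all
    have X1: "finprod G fst X = \<one>" using T(4) TX zero_sum_mset_set[OF X(1,2)] by simp
    have X2: "finprod G fst (A - X) = \<one>" by (rule finprod_terms_diff[OF A(1,2) XA A(3) X1])
    have "card X < card A" using A(1) XA X by (intro psubset_card_mono) auto
    then obtain F where F: "irreducible_factorization G (mset_set X) F"
      using less.hyps[OF _ X(1,2) X1] by blast
    have "card (A - X) < card A" using A(1) XA X by (intro psubset_card_mono) auto
    then obtain F' where F': "irreducible_factorization G (mset_set (A - X)) F'"
      using less.hyps[OF _ finite_Diff[OF A(1)] _ X2] A(2) by blast
    have "mset_set X + mset_set (A - X) = mset_set A"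
      using XA A(1) by (simp add: mset_set_Diff subset_imp_msubset_mset_set)
    then have "irreducible_factorization G (mset_set A) (F + F')"
      using F F' by (auto simp: irreducible_factorization_def)
    then show ?thesis by blast
  qed
qed

lemma finprod_factorization:
  assumes "finite Z" "Z \<subseteq> terms" "\<Sum>\<^sub># F = mset_set Z" "\<And>T. T \<in># F \<Longrightarrow> zero_sum G T"
  shows "finprod G fst Z = \<one>"
  using assms
proof (induction F arbitrary: Z)
  case empty
  then have "mset_set Z = {#}" by simp
  then have "Z = {}" using empty.prems(1) by (simp add: mset_set_empty_iff)
  then show ?case by simp
next
  case (add T F)
  have "T + \<Sum>\<^sub># F = mset_set Z" using add.prems(3) by simp
  then obtain X where X: "X \<subseteq> Z" "T = mset_set X" "\<Sum>\<^sub># F = mset_set (Z - X)"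
    by (rule mset_set_eq_add[OF add.prems(1)])
  have fX: "finite X" "X \<subseteq> terms" using X add.prems by (auto dest: finite_subset)
  have "finprod G fst X = \<one>" using add.prems(4)[of T] X zero_sum_mset_set[OF fX] by simp
  moreover have "finprod G fst (Z - X) = \<one>"
    by (rule add.IH[OF _ _ X(3)]) (use add.prems in auto)
  ultimately show ?case using finprod_terms_split[OF add.prems(1,2) X(1)] by simp
qed

lemma factorization_member:
  assumes "irreducible_factorization G S F" "T \<in># F"
  shows "T \<subseteq># S" "irreducible_seq G T"
  using assms by (auto simp: irreducible_factorization_def dest: multi_member_split)

text \<open>Factorizations of X and its complement, and of Y and its complement, both give one of S,
  so they agree. Hence each factor of X lies in Y or is disjoint from Y, and the factors inside Y
  have product X \<inter> Y.\<close>

lemma UFIS_Int: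
  assumes U: "UFIS G S" and X: "X \<subseteq> set_mset S" "finprod G fst X = \<one>"
    and Y: "Y \<subseteq> set_mset S" "finprod G fst Y = \<one>"
  shows "finprod G fst (X \<inter> Y) = \<one>"
proof -
  define A where "A = set_mset S"
  have S: "S = mset_set A" "A \<subseteq> terms" "finite A"
    using indexed_seq_mset_set[of G S] U by (auto simp: UFIS_def A_def)
  have A1: "finprod G fst A = \<one>"
    using U S zero_sum_mset_set[OF S(3,2)] by (simp add: UFIS_def)
  have split: "\<exists>F F'. irreducible_factorization G (mset_set Z) F \<and> irreducible_factorization G (mset_set (A - Z)) F' \<and>
      irreducible_factorization G S (F + F')" if Z: "Z \<subseteq> A" "finprod G fst Z = \<one>" for Z
  proof -
    have fin: "finite Z" "Z \<subseteq> terms" using Z S by (auto dest: finite_subset)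
    obtain F where F: "irreducible_factorization G (mset_set Z) F"
      using irreducible_factorization_exists[OF fin Z(2)] by blast
    have "finprod G fst (A - Z) = \<one>" by (rule finprod_terms_diff[OF S(3,2) Z(1) A1 Z(2)])
    then obtain F' where F': "irreducible_factorization G (mset_set (A - Z)) F'"
      using irreducible_factorization_exists[of "A - Z"] S by auto
    have "mset_set Z + mset_set (A - Z) = mset_set A"
      using Z S by (simp add: mset_set_Diff subset_imp_msubset_mset_set)
    then have "irreducible_factorization G S (F + F')"
      using F F' S by (auto simp: irreducible_factorization_def)
    then show ?thesis using F F' by blast
  qed
  obtain F F' where F: "irreducible_factorization G (mset_set X) F" "irreducible_factorization G (mset_set (A - X)) F'"
      "irreducible_factorization G S (F + F')"
    using split[of X] X by (auto simp: A_def)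
  obtain E E' where E: "irreducible_factorization G (mset_set Y) E" "irreducible_factorization G (mset_set (A - Y)) E'"
      "irreducible_factorization G S (E + E')"
    using split[of Y] Y by (auto simp: A_def)
  have eq: "F + F' = E + E'" using U F(3) E(3) unfolding UFIS_def by blast
  have finXY: "finite X" "finite Y" using X Y by (auto dest: finite_subset)
  have Ydich: "set_mset T \<subseteq> Y \<or> set_mset T \<inter> Y = {}" if "T \<in># F" for T
  proof -
    have "T \<in># E + E'" using that eq by (metis union_iff)
    then consider "T \<in># E" | "T \<in># E'" by auto
    then show ?thesis
    proof cases
      case 1
      then show ?thesis using subseteq_mset_set(2)[OF finXY(2) factorization_member(1)[OF E(1)]] by blast
    next
      case 2
      then show ?thesis using subseteq_mset_set(2)[of "A - Y", OF _ factorization_member(1)[OF E(2)]] S by blast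
    qed
  qed
  define F1 where "F1 = {#T \<in># F. set_mset T \<subseteq> Y#}"
  define F2 where "F2 = {#T \<in># F. \<not> set_mset T \<subseteq> Y#}"
  have "F = F1 + F2" unfolding F1_def F2_def by (rule multiset_partition)
  then have "\<Sum>\<^sub># F1 + \<Sum>\<^sub># F2 = mset_set X" using F(1) by (simp add: irreducible_factorization_def)
  then obtain Z where Z: "Z \<subseteq> X" "\<Sum>\<^sub># F1 = mset_set Z" "\<Sum>\<^sub># F2 = mset_set (X - Z)"
    by (rule mset_set_eq_add[OF finXY(1)])
  have finZ: "finite Z" using Z finXY by (auto dest: finite_subset)
  have "Z = X \<inter> Y"
  proof (rule equalityI)
    have "set_mset (\<Sum>\<^sub># F1) \<subseteq> Y" by (auto simp: F1_def)
    then show "Z \<subseteq> X \<inter> Y" using Z finZ by simp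
    have "set_mset (\<Sum>\<^sub># F2) \<inter> Y = {}" using Ydich by (fastforce simp: F2_def)
    then have "(X - Z) \<inter> Y = {}" using Z finXY by simp
    then show "X \<inter> Y \<subseteq> Z" by blast
  qed
  moreover have "finprod G fst Z = \<one>"
  proof (rule finprod_factorization[OF finZ _ Z(2)])
    show "Z \<subseteq> terms"
      by (rule subset_trans[OF Z(1) subset_trans[OF X(1) S(2)[unfolded A_def]]])
    show "zero_sum G T" if "T \<in># F1" for T
      using factorization_member(2)[OF F(1), of T] that by (simp add: F1_def irreducible_seq_def)
  qed
  ultimately show ?thesis by simp
qed

text \<open>Irreducible factors that share a term, even from different factorizations, have a
  zero-sum intersection and so are equal. Thus any two factorizations have the same factors, each of
  multiplicity one because the sequence is squarefree.\<close>

lemma UFIS_I: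
  assumes A: "finite A" "A \<subseteq> terms" "finprod G fst A = \<one>"
    and Int: "\<And>X Y. X \<subseteq> A \<Longrightarrow> Y \<subseteq> A \<Longrightarrow> finprod G fst X = \<one> \<Longrightarrow> finprod G fst Y = \<one> \<Longrightarrow> finprod G fst (X \<inter> Y) = \<one>"
  shows "UFIS G (mset_set A)"
proof -
  let ?P = "irreducible_factorization G (mset_set A)"
  have member: "\<exists>X\<subseteq>A. T = mset_set X \<and> X \<noteq> {} \<and> finprod G fst X = \<one>" if "?P F" "T \<in># F" for F T
  proof -
    note T = factorization_member[OF that]
    note X = subseteq_mset_set[OF A(1) T(1)]
    have "finite (set_mset T)" "set_mset T \<subseteq> terms" using X A by auto
    then have "finprod G fst (set_mset T) = \<one>"
      using T(2) zero_sum_mset_set X(1) unfolding irreducible_seq_def by metis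
    moreover have "set_mset T \<noteq> {}" using T(2) by (simp add: irreducible_seq_def)
    ultimately show ?thesis using X by blast
  qed
  have irr: "Y \<subseteq> X" if F: "?P F" "mset_set Y \<in># F" and X: "X \<subseteq> A" "finprod G fst X = \<one>"
    and Y: "Y \<subseteq> A" "finprod G fst Y = \<one>" and ne: "X \<inter> Y \<noteq> {}" for F X Y
  proof -
    have fin: "finite (X \<inter> Y)" "X \<inter> Y \<subseteq> terms" "finite Y" using Y A by (auto dest: finite_subset)
    have "zero_sum G (mset_set (X \<inter> Y))"
      using Int[OF X(1) Y(1) X(2) Y(2)] zero_sum_mset_set[OF fin(1,2)] by simp
    moreover have "mset_set (X \<inter> Y) \<subseteq># mset_set Y"
      using fin by (intro subset_imp_msubset_mset_set) auto
    moreover have "mset_set (X \<inter> Y) \<noteq> {#}" using ne fin by (simp add: mset_set_empty_iff)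
    ultimately have "mset_set (X \<inter> Y) = mset_set Y"
      using factorization_member(2)[OF F] unfolding irreducible_seq_def by blast
    then have "X \<inter> Y = Y" using fin by (metis finite_set_mset_mset_set)
    then show ?thesis by blast
  qed
  have sub: "set_mset F \<subseteq> set_mset F'" if F: "?P F" and F': "?P F'" for F F'
  proof
    fix T assume T: "T \<in># F"
    obtain Y where Y: "Y \<subseteq> A" "T = mset_set Y" "Y \<noteq> {}" "finprod G fst Y = \<one>" using member[OF F T] by blast
    obtain y where y: "y \<in> Y" using Y by blast
    have "y \<in># \<Sum>\<^sub># F'" using F' Y(1) y A(1) by (auto simp: irreducible_factorization_def)
    then obtain T' where T': "T' \<in># F'" "y \<in># T'" by auto
    obtain X where X: "X \<subseteq> A" "T' = mset_set X" "finprod G fst X = \<one>" using member[OF F' T'(1)] by blast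
    have "finite X" using X A by (auto dest: finite_subset)
    then have yX: "y \<in> X" using T' X by simp
    have "Y \<subseteq> X" by (rule irr[OF F _ X(1,3) Y(1,4)]) (use T Y yX y in auto)
    moreover have "X \<subseteq> Y" by (rule irr[OF F' _ Y(1,4) X(1,3)]) (use T' X yX y in auto)
    ultimately show "T \<in># F'" using T' X Y by simp
  qed
  have simple: "mset_set (set_mset F) = F" if F: "?P F" for F
  proof (rule mset_set_set_mset)
    fix T
    show "count F T \<le> 1"
    proof (rule ccontr)
      assume "\<not> count F T \<le> 1"
      then have "replicate_mset 2 T \<subseteq># F" by (simp add: count_le_replicate_mset_subset_eq[symmetric])
      then obtain F0 where F0: "F = replicate_mset 2 T + F0" by (auto simp: subset_mset.le_iff_add)
      then have TF: "T \<in># F" by simp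
      obtain Y where Y: "Y \<subseteq> A" "T = mset_set Y" "Y \<noteq> {}" using member[OF F TF] by blast
      obtain y where y: "y \<in> Y" using Y by blast
      have "finite Y" using Y A by (auto dest: finite_subset)
      then have "count T y = 1" using Y y by simp
      moreover have "mset_set A = T + T + \<Sum>\<^sub># F0"
        using F F0 by (auto simp: irreducible_factorization_def numeral_2_eq_2 add.assoc)
      ultimately have "count (mset_set A) y \<ge> 2" by simp
      then show False by (simp add: count_mset_set' split: if_splits)
    qed
  qed
  have "F = F'" if "?P F" "?P F'" for F F'
    using simple[OF that(1)] simple[OF that(2)] sub[OF that] sub[OF that(2,1)] by (metis subset_antisym)
  then show ?thesis
    using irreducible_factorization_exists[OF A] indexed_seq_terms[OF A(1,2)] zero_sum_mset_set[OF A(1,2)] A(3)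
    unfolding UFIS_def by blast
qed

end

text \<open>\<open>\<phi>\<close> is a homomorphism only modulo \<open>lat\<close>, and
  \<open>\<psi>\<close> chooses preimages; this identifies G with the quotient of the integer pairs
  without a quotient type.\<close>

locale lattice_realisation = finite_comm_group G + pair_lattice n k
  for G :: "('a, 'b) monoid_scheme" (structure) and n k +
  fixes \<phi> :: "'a \<Rightarrow> int \<times> int" and \<psi> :: "int \<times> int \<Rightarrow> 'a"
  assumes hom: "x \<in> carrier G \<Longrightarrow> y \<in> carrier G \<Longrightarrow> \<phi> (x \<otimes> y) - (\<phi> x + \<phi> y) \<in> lat"
    and kernel: "x \<in> carrier G \<Longrightarrow> \<phi> x \<in> lat \<longleftrightarrow> x = \<one>"
    and onto: "\<psi> v \<in> carrier G" "\<phi> (\<psi> v) - v \<in> lat"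
begin

lemma lat_cong: "u - v \<in> lat \<Longrightarrow> u \<in> lat \<longleftrightarrow> v \<in> lat"
proof
  assume uv: "u - v \<in> lat"
  show "v \<in> lat" if "u \<in> lat"
    using add_subgroup_diff[OF add_subgroup_lat that uv] by simp
  show "u \<in> lat" if "v \<in> lat"
    using add_subgroup_add[OF add_subgroup_lat uv that] by simp
qed

lemma phi_finprod:
  assumes "finite X" "g \<in> X \<rightarrow> carrier G"
  shows "\<phi> (finprod G g X) - (\<Sum>i\<in>X. \<phi> (g i)) \<in> lat"
  using assms
proof (induction X rule: finite_induct)
  case empty
  show ?case using kernel[of \<one>] by simp
next
  case (insert i X)
  have c: "g i \<in> carrier G" "finprod G g X \<in> carrier G" using insert.prems by (auto intro!: finprod_closed)
  have "finprod G g (insert i X) = g i \<otimes> finprod G g X"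
    using insert by (intro finprod_insert) auto
  then have "\<phi> (finprod G g (insert i X)) - (\<phi> (g i) + \<phi> (finprod G g X)) \<in> lat"
    using hom[OF c] by simp
  moreover have "\<phi> (finprod G g X) - (\<Sum>i\<in>X. \<phi> (g i)) \<in> lat" using insert by auto
  ultimately have "(\<phi> (finprod G g (insert i X)) - (\<phi> (g i) + \<phi> (finprod G g X))) +
      (\<phi> (finprod G g X) - (\<Sum>i\<in>X. \<phi> (g i))) \<in> lat"
    by (rule add_subgroup_add[OF add_subgroup_lat])
  then show ?case using insert.hyps by (simp add: algebra_simps)
qed

lemma finprod_eq_one_iff:
  assumes "finite X" "g \<in> X \<rightarrow> carrier G"
  shows "finprod G g X = \<one> \<longleftrightarrow> (\<Sum>i\<in>X. \<phi> (g i)) \<in> lat"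
proof -
  have "finprod G g X = \<one> \<longleftrightarrow> \<phi> (finprod G g X) \<in> lat"
    using kernel[OF finprod_closed[OF assms(2)]] by simp
  then show ?thesis using lat_cong[OF phi_finprod[OF assms]] by simp
qed

lemma ord_eq_lord:
  assumes "x \<in> carrier G"
  shows "ord x = lord (\<phi> x)"
proof (rule lord_eqI[symmetric])
  fix m :: nat
  have "x [^] m = (\<Otimes>i\<in>{..<m}. x)" using assms by (simp add: finprod_const)
  then have "x [^] m = \<one> \<longleftrightarrow> (\<Sum>i\<in>{..<m}. \<phi> x) \<in> lat"
    using finprod_eq_one_iff[of "{..<m}" "\<lambda>_. x"] assms by simp
  moreover have "(\<Sum>i\<in>{..<m}. \<phi> x) = smul m (\<phi> x)"
    by (simp add: prod_eq_iff fst_sum snd_sum)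
  ultimately show "smul m (\<phi> x) \<in> lat \<longleftrightarrow> ord x dvd m"
    using pow_eq_id[OF assms, of m] by simp
qed

lemma K1_eqI:
  assumes upper: "\<And>(I :: ('a \<times> nat) set) f. finite I \<Longrightarrow> uf lat I f \<Longrightarrow> (\<And>i. i \<in> I \<Longrightarrow> f i \<notin> lat) \<Longrightarrow>
      cross I f \<le> x"
    and lower: "attains UNIV x"
  shows "K1 G = x"
  unfolding K1_def
proof (rule Greatest_equality)
  show "y \<le> x" if y: "\<exists>S. UFIS G S \<and> y = cross_number G S" for y
  proof -
    obtain S where S: "UFIS G S" "y = cross_number G S" using y by blast
    define A where "A = set_mset S"
    have A: "S = mset_set A" "A \<subseteq> terms" "finite A"
      using indexed_seq_mset_set[of G S] S by (auto simp: UFIS_def A_def)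
    have fin: "finprod G fst X = \<one> \<longleftrightarrow> (\<Sum>i\<in>X. \<phi> (fst i)) \<in> lat" if "X \<subseteq> A" for X
      by (rule finprod_eq_one_iff) (use that A in \<open>auto dest: finite_subset\<close>)
    have "(\<Sum>i\<in>A. 1 / real (lord (\<phi> (fst i)))) \<le> x"
    proof (rule upper[OF A(3)])
      show "uf lat A (\<lambda>i. \<phi> (fst i))"
        unfolding uf_def
      proof (intro allI impI)
        fix X Y assume XY: "X \<subseteq> A" "Y \<subseteq> A" "(\<Sum>i\<in>X. \<phi> (fst i)) \<in> lat" "(\<Sum>i\<in>Y. \<phi> (fst i)) \<in> lat"
        then have "finprod G fst (X \<inter> Y) = \<one>"
          using UFIS_Int[OF S(1), of X Y] fin by (auto simp: A_def)
        then show "(\<Sum>i\<in>X \<inter> Y. \<phi> (fst i)) \<in> lat" using fin[of "X \<inter> Y"] XY by blast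
      qed
      show "\<phi> (fst i) \<notin> lat" if "i \<in> A" for i
        using kernel[of "fst i"] that A by auto
    qed
    moreover have "y = (\<Sum>i\<in>A. 1 / real (lord (\<phi> (fst i))))"
      unfolding S(2) A(1) cross_number_mset_set[OF A(3,2)]
      using A(2) ord_eq_lord by (intro sum.cong) auto
    ultimately show ?thesis by simp
  qed
next
  obtain I f where I: "finite (I :: nat set)" "uf lat I f" "sum f I \<in> lat" "\<forall>i\<in>I. f i \<notin> lat"
    "cross I f = x"
    using lower unfolding attains_def by blast
  \<comment> \<open>The index serves as the label, so that equal group elements become distinct
    terms.\<close>
  define h where "h i = (\<psi> (f i), i)" for i
  define A where "A = h ` I"
  have inj: "inj_on h X" for X by (auto simp: h_def intro!: inj_onI)
  have finA: "finite A" using I(1) by (simp add: A_def)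
  have f_iff: "\<psi> (f i) \<noteq> \<one>" if "i \<in> I" for i
    using that I(4) kernel[OF onto(1)] lat_cong[OF onto(2)] by metis
  have carr: "\<psi> (f i) \<in> carrier G" for i by (rule onto(1))
  have At: "A \<subseteq> terms" using carr f_iff by (auto simp: A_def h_def)
  have fin: "finprod G fst (h ` X) = \<one> \<longleftrightarrow> sum f X \<in> lat" if X: "X \<subseteq> I" for X
  proof -
    have finX: "finite X" using X I(1) by (rule finite_subset)
    have "finprod G fst (h ` X) = \<one> \<longleftrightarrow> (\<Sum>a\<in>h ` X. \<phi> (fst a)) \<in> lat"
      using finX carr by (intro finprod_eq_one_iff) (auto simp: h_def)
    also have "(\<Sum>a\<in>h ` X. \<phi> (fst a)) = (\<Sum>i\<in>X. \<phi> (\<psi> (f i)))"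
      unfolding sum.reindex[OF inj] by (simp add: h_def)
    also have "\<dots> \<in> lat \<longleftrightarrow> sum f X \<in> lat"
    proof (rule lat_cong)
      show "(\<Sum>i\<in>X. \<phi> (\<psi> (f i))) - sum f X \<in> lat"
        unfolding sum_subtractf[symmetric] by (rule sum_in_lat) (rule onto(2))
    qed
    finally show ?thesis .
  qed
  have "UFIS G (mset_set A)"
  proof (rule UFIS_I[OF finA At])
    show "finprod G fst A = \<one>" using fin[of I] I(3) by (simp add: A_def)
    fix X' Y' assume "X' \<subseteq> A" "Y' \<subseteq> A" and one: "finprod G fst X' = \<one>" "finprod G fst Y' = \<one>"
    then obtain X Y where XY: "X \<subseteq> I" "X' = h ` X" "Y \<subseteq> I" "Y' = h ` Y"
      unfolding A_def by (meson subset_imageE)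
    have "X' \<inter> Y' = h ` (X \<inter> Y)" unfolding XY using inj[of UNIV] by (simp add: image_Int)
    moreover have "sum f (X \<inter> Y) \<in> lat" using ufD[OF I(2) XY(1,3)] one fin XY by simp
    ultimately show "finprod G fst (X' \<inter> Y') = \<one>" using fin[of "X \<inter> Y"] XY by auto
  qed
  moreover have "cross_number G (mset_set A) = x"
  proof -
    have "cross_number G (mset_set A) = (\<Sum>i\<in>I. 1 / real (ord (\<psi> (f i))))"
      unfolding cross_number_mset_set[OF finA At] unfolding A_def sum.reindex[OF inj]
      by (simp add: h_def)
    also have "\<dots> = cross I f"
    proof (rule sum.cong[OF refl])
      fix i
      have "lord (\<phi> (\<psi> (f i))) = lord (f i)"
      proof (rule lord_eqI)
        fix c
        have "smul c (\<phi> (\<psi> (f i))) - smul c (f i) \<in> lat"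
          unfolding smul_diff[symmetric] by (rule smul_in_lat[OF onto(2)])
        then show "smul c (\<phi> (\<psi> (f i))) \<in> lat \<longleftrightarrow> lord (f i) dvd c"
          using lat_cong smul_in_lat_iff by blast
      qed
      then show "1 / real (ord (\<psi> (f i))) = 1 / real (lord (f i))" using ord_eq_lord[OF onto(1)] by simp
    qed
    finally show ?thesis using I(5) by simp
  qed
  ultimately show "\<exists>S. UFIS G S \<and> x = cross_number G S" by blast
qed

end

section \<open>The value of the conjectured formula\<close>

text \<open>An isomorphism invariant whose values at prime powers determine the value of the
  formula; it makes the definite description in \<open>K1_star\<close> meaningful.\<close>

definition torsion_count :: "('a, 'b) monoid_scheme \<Rightarrow> nat \<Rightarrow> nat" where
  "torsion_count G m = card {x \<in> carrier G. x [^]\<^bsub>G\<^esub> m = \<one>\<^bsub>G\<^esub>}"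

lemma torsion_count_iso:
  assumes "group G" "group H" "G \<cong> H"
  shows "torsion_count G m = torsion_count H m"
proof -
  obtain h where h: "h \<in> iso G H" using assms(3) by (auto simp: is_iso_def)
  interpret group_hom G H h
    using assms h by (simp add: group_hom_def group_hom_axioms_def iso_def)
  have bij: "bij_betw h (carrier G) (carrier H)" using h by (simp add: iso_def)
  have iff: "h x [^]\<^bsub>H\<^esub> m = \<one>\<^bsub>H\<^esub> \<longleftrightarrow> x [^]\<^bsub>G\<^esub> m = \<one>\<^bsub>G\<^esub>" if x: "x \<in> carrier G" for x
  proof -
    have "h x [^]\<^bsub>H\<^esub> m = h (x [^]\<^bsub>G\<^esub> m)" using x by (simp add: hom_nat_pow)
    moreover have "h (x [^]\<^bsub>G\<^esub> m) = h \<one>\<^bsub>G\<^esub> \<longleftrightarrow> x [^]\<^bsub>G\<^esub> m = \<one>\<^bsub>G\<^esub>"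
      using bij x by (intro inj_on_eq_iff[of h "carrier G"]) (auto simp: bij_betw_def)
    ultimately show ?thesis by simp
  qed
  have "bij_betw h {x \<in> carrier G. x [^]\<^bsub>G\<^esub> m = \<one>\<^bsub>G\<^esub>} {y \<in> carrier H. y [^]\<^bsub>H\<^esub> m = \<one>\<^bsub>H\<^esub>}"
    unfolding bij_betw_def
  proof
    show "inj_on h {x \<in> carrier G. x [^]\<^bsub>G\<^esub> m = \<one>\<^bsub>G\<^esub>}"
      using bij by (auto simp: bij_betw_def intro: inj_on_subset)
    show "h ` {x \<in> carrier G. x [^]\<^bsub>G\<^esub> m = \<one>\<^bsub>G\<^esub>} = {y \<in> carrier H. y [^]\<^bsub>H\<^esub> m = \<one>\<^bsub>H\<^esub>}"
    proof (intro equalityI subsetI)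
      fix y assume y: "y \<in> {y \<in> carrier H. y [^]\<^bsub>H\<^esub> m = \<one>\<^bsub>H\<^esub>}"
      then obtain x where "x \<in> carrier G" "y = h x" using bij unfolding bij_betw_def by blast
      then show "y \<in> h ` {x \<in> carrier G. x [^]\<^bsub>G\<^esub> m = \<one>\<^bsub>G\<^esub>}" using iff y by blast
    qed (use iff in auto)
  qed
  then show ?thesis unfolding torsion_count_def by (rule bij_betw_same_card)
qed

lemma card_multiples_mod:
  fixes P m :: nat
  assumes "P > 0"
  shows "card {y \<in> {0..<int P}. int P dvd int m * y} = gcd m P"
proof -
  define g where "g = gcd m P"
  define Q where "Q = P div g"
  have g0: "g > 0" using assms by (simp add: g_def)
  have P: "P = Q * g" by (simp add: Q_def g_def)
  have Q0: "Q > 0" using assms P by (auto intro!: Nat.gr0I)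
  define m' where "m' = m div g"
  have m: "m = m' * g" by (simp add: m'_def g_def)
  have "coprime (m div g) (P div g)" unfolding g_def by (rule div_gcd_coprime) (use assms in simp)
  then have cop: "coprime Q m'" by (simp add: Q_def m'_def coprime_commute)
  have iff: "int P dvd int m * y \<longleftrightarrow> int Q dvd y" for y
  proof -
    have "int P dvd int m * y \<longleftrightarrow> int g * int Q dvd int g * (int m' * y)"
      by (simp add: P m algebra_simps)
    also have "\<dots> \<longleftrightarrow> int Q dvd int m' * y" using g0 by simp
    also have "\<dots> \<longleftrightarrow> int Q dvd y" using cop by (simp add: coprime_dvd_mult_right_iff)
    finally show ?thesis .
  qed
  have "{y \<in> {0..<int P}. int P dvd int m * y} = (\<lambda>t. int Q * t) ` {0..<int g}"
  proof (intro equalityI subsetI)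
    fix y assume y: "y \<in> {y \<in> {0..<int P}. int P dvd int m * y}"
    then obtain t where t: "y = int Q * t" using iff by (auto elim: dvdE)
    have "0 \<le> int Q * t" "int Q * t < int Q * int g" using y t by (simp_all add: P)
    then have "0 \<le> t" "t < int g" using Q0 by (simp_all add: zero_le_mult_iff)
    then show "y \<in> (\<lambda>t. int Q * t) ` {0..<int g}" using t by auto
  next
    fix y assume "y \<in> (\<lambda>t. int Q * t) ` {0..<int g}"
    then obtain t where "y = int Q * t" "t \<in> {0..<int g}" by blast
    then have t: "y = int Q * t" "0 \<le> t" "t < int g" by simp_all
    then show "y \<in> {y \<in> {0..<int P}. int P dvd int m * y}"
      using Q0 iff by (simp add: P)
  qed
  moreover have "inj_on (\<lambda>t. int Q * t) {0..<int g}" using Q0 by (auto intro!: inj_onI)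
  ultimately show ?thesis by (simp add: card_image g_def)
qed

lemma pow_sum_group:
  assumes "\<And>i. i \<in> I \<Longrightarrow> group (G i)" "x \<in> carrier (sum_group I G)"
  shows "x [^]\<^bsub>sum_group I G\<^esub> (m :: nat) = (\<lambda>i\<in>I. x i [^]\<^bsub>G i\<^esub> m)"
proof (induction m)
  case 0
  show ?case by (simp add: nat_pow_def)
next
  case (Suc m)
  then show ?case by (simp add: nat_pow_def restrict_def fun_eq_iff)
qed

lemma carrier_sum_integer_mod_group:
  fixes P :: "nat \<Rightarrow> nat"
  assumes "\<And>i. i < r \<Longrightarrow> P i > 0"
  shows "carrier (sum_group {..<r} (\<lambda>i. integer_mod_group (P i))) = (\<Pi>\<^sub>E i\<in>{..<r}. {0..<int (P i)})"
proof -
  have "carrier (sum_group {..<r} (\<lambda>i. integer_mod_group (P i))) = (\<Pi>\<^sub>E i\<in>{..<r}. carrier (integer_mod_group (P i)))"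
    by (subst carrier_sum_group) auto
  also have "\<dots> = (\<Pi>\<^sub>E i\<in>{..<r}. {0..<int (P i)})"
    by (rule PiE_cong) (use assms in \<open>auto simp: carrier_integer_mod_group\<close>)
  finally show ?thesis .
qed

lemma torsion_count_sum_group:
  fixes P :: "nat \<Rightarrow> nat"
  assumes "\<And>i. i < r \<Longrightarrow> P i > 0"
  shows "torsion_count (sum_group {..<r} (\<lambda>i. integer_mod_group (P i))) m = (\<Prod>i<r. gcd m (P i))"
proof -
  let ?S = "sum_group {..<r} (\<lambda>i. integer_mod_group (P i))"
  have "{x \<in> carrier ?S. x [^]\<^bsub>?S\<^esub> m = \<one>\<^bsub>?S\<^esub>} =
      (\<Pi>\<^sub>E i\<in>{..<r}. {y \<in> {0..<int (P i)}. int (P i) dvd int m * y})"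
  proof (intro equalityI subsetI)
    fix x assume x: "x \<in> {x \<in> carrier ?S. x [^]\<^bsub>?S\<^esub> m = \<one>\<^bsub>?S\<^esub>}"
    then have c: "x \<in> (\<Pi>\<^sub>E i\<in>{..<r}. {0..<int (P i)})" using carrier_sum_integer_mod_group[OF assms] by simp
    have "(\<lambda>i\<in>{..<r}. x i [^]\<^bsub>integer_mod_group (P i)\<^esub> m) = (\<lambda>i\<in>{..<r}. 0)"
      using x pow_sum_group[of "{..<r}" "\<lambda>i. integer_mod_group (P i)" x m] by simp
    then have "(int m * x i) mod int (P i) = 0" if "i < r" for i
      using that by (auto simp: fun_eq_iff restrict_def split: if_splits)
    then show "x \<in> (\<Pi>\<^sub>E i\<in>{..<r}. {y \<in> {0..<int (P i)}. int (P i) dvd int m * y})"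
      using c by (auto simp: PiE_iff)
  next
    fix x assume x: "x \<in> (\<Pi>\<^sub>E i\<in>{..<r}. {y \<in> {0..<int (P i)}. int (P i) dvd int m * y})"
    then have "x \<in> (\<Pi>\<^sub>E i\<in>{..<r}. {0..<int (P i)})" by (auto simp: PiE_iff)
    then have c: "x \<in> carrier ?S" using carrier_sum_integer_mod_group[OF assms] by simp
    have "x [^]\<^bsub>?S\<^esub> m = (\<lambda>i\<in>{..<r}. x i [^]\<^bsub>integer_mod_group (P i)\<^esub> m)"
      by (rule pow_sum_group) (use c in auto)
    also have "\<dots> = \<one>\<^bsub>?S\<^esub>" using x by (auto simp: fun_eq_iff PiE_iff)
    finally show "x \<in> {x \<in> carrier ?S. x [^]\<^bsub>?S\<^esub> m = \<one>\<^bsub>?S\<^esub>}" using c by simp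
  qed
  then have "torsion_count ?S m = card (\<Pi>\<^sub>E i\<in>{..<r}. {y \<in> {0..<int (P i)}. int (P i) dvd int m * y})"
    by (simp add: torsion_count_def)
  also have "\<dots> = (\<Prod>i<r. card {y \<in> {0..<int (P i)}. int (P i) dvd int m * y})"
    by (rule card_PiE) simp
  also have "\<dots> = (\<Prod>i<r. gcd m (P i))"
    by (rule prod.cong) (use assms card_multiples_mod in auto)
  finally show ?thesis .
qed

lemma gcd_prime_powers:
  fixes s p :: nat
  assumes "prime s" "prime p"
  shows "gcd (s ^ b) (p ^ a) = (if p = s then s ^ min b a else 1)"
proof (cases "p = s")
  case True
  have "gcd (s ^ b) (s ^ a) = s ^ min b a"
  proof (cases "b \<le> a")
    case True
    then show ?thesis by (simp add: le_imp_power_dvd gcd_proj1_if_dvd min_absorb1)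
  next
    case False
    then show ?thesis by (simp add: le_imp_power_dvd gcd_proj2_if_dvd min_absorb2)
  qed
  then show ?thesis using True by simp
next
  case False
  then have "coprime s p" using primes_coprime assms by blast
  then show ?thesis using False by (simp add: coprime_iff_gcd_eq_1[symmetric])
qed

text \<open>The difference of minima is 1 for j < a and 0 otherwise. Sums of such minima over the
  summands of a prime \<open>s\<close> are the exponents in the torsion counts at powers of
  \<open>s\<close>, so this form exposes the dependence on the group alone.\<close>

lemma geom_eq_min_differences:
  assumes "a \<le> B"
  shows "geom s 0 a = (\<Sum>j<B. (real (min (Suc j) a) - real (min j a)) * (1 / real s) ^ j)"
proof -
  have "(\<Sum>j<B. (real (min (Suc j) a) - real (min j a)) * (1 / real s) ^ j) =
      (\<Sum>j<B. if j \<in> {0..<a} then (1 / real s) ^ j else 0)"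
    by (rule sum.cong) (auto simp: min_def)
  also have "\<dots> = (\<Sum>j\<in>{..<B} \<inter> {0..<a}. (1 / real s) ^ j)"
    by (rule sum.inter_restrict[symmetric]) simp
  also have "{..<B} \<inter> {0..<a} = {0..<a}" using assms by auto
  finally show ?thesis by (simp add: geom_def)
qed

lemma decomposition_value_eq:
  fixes p a :: "nat \<Rightarrow> nat"
  assumes p: "\<And>i. i < r \<Longrightarrow> prime (p i)" and a: "\<And>i. i < r \<Longrightarrow> a i \<le> B" and fin: "finite S" "p ` {..<r} \<subseteq> S"
  shows "(\<Sum>i<r. geom (p i) 0 (a i)) =
    (\<Sum>s\<in>S. \<Sum>j<B. (real (\<Sum>i\<in>{i. i < r \<and> p i = s}. min (Suc j) (a i)) -
      real (\<Sum>i\<in>{i. i < r \<and> p i = s}. min j (a i))) * (1 / real s) ^ j)"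
proof -
  have "(\<Sum>i<r. geom (p i) 0 (a i)) = (\<Sum>s\<in>S. \<Sum>i\<in>{i \<in> {..<r}. p i = s}. geom (p i) 0 (a i))"
    using fin by (intro sum.group[symmetric]) auto
  also have "\<dots> = (\<Sum>s\<in>S. \<Sum>i\<in>{i. i < r \<and> p i = s}. \<Sum>j<B. (real (min (Suc j) (a i)) - real (min j (a i))) * (1 / real s) ^ j)"
    using a by (intro sum.cong) (auto simp: geom_eq_min_differences)
  also have "\<dots> = (\<Sum>s\<in>S. \<Sum>j<B. \<Sum>i\<in>{i. i < r \<and> p i = s}. (real (min (Suc j) (a i)) - real (min j (a i))) * (1 / real s) ^ j)"
    by (intro sum.cong refl sum.swap)
  also have "\<dots> = (\<Sum>s\<in>S. \<Sum>j<B. (real (\<Sum>i\<in>{i. i < r \<and> p i = s}. min (Suc j) (a i)) -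
      real (\<Sum>i\<in>{i. i < r \<and> p i = s}. min j (a i))) * (1 / real s) ^ j)"
    by (simp add: sum_distrib_right[symmetric] sum_subtractf)
  finally show ?thesis .
qed

lemma prod_gcd_prime_powers:
  fixes p a :: "nat \<Rightarrow> nat"
  assumes p: "\<And>i. i < r \<Longrightarrow> prime (p i)" and s: "prime s"
  shows "(\<Prod>i<r. gcd (s ^ b) (p i ^ a i)) = s ^ (\<Sum>i\<in>{i. i < r \<and> p i = s}. min b (a i))"
proof -
  have "(\<Prod>i<r. gcd (s ^ b) (p i ^ a i)) = (\<Prod>i\<in>{..<r}. if i \<in> {i. p i = s} then s ^ min b (a i) else 1)"
    by (rule prod.cong) (use gcd_prime_powers[OF s] p in auto)
  also have "\<dots> = (\<Prod>i\<in>{..<r} \<inter> {i. p i = s}. s ^ min b (a i))"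
    by (rule prod.inter_restrict[symmetric]) simp
  also have "{..<r} \<inter> {i. p i = s} = {i. i < r \<and> p i = s}" by auto
  also have "(\<Prod>i\<in>\<dots>. s ^ min b (a i)) = s ^ (\<Sum>i\<in>{i. i < r \<and> p i = s}. min b (a i))"
    by (simp add: power_sum)
  finally show ?thesis .
qed

lemma prime_power_value:
  assumes "prime p" "a > 0"
  shows "(real p ^ a - 1) / (real p ^ a - real p ^ (a - 1)) = geom p 0 a"
  using geom_closed_form[OF prime_ge_2_nat[OF assms(1)], of "a - 1"] assms(2) by simp

lemma decomposition_value_unique:
  assumes G: "group G" and d: "prime_power_decomposition G r p a" and d': "prime_power_decomposition G r' p' a'"
  shows "(\<Sum>i<r. geom (p i) 0 (a i)) = (\<Sum>i<r'. geom (p' i) 0 (a' i))"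
proof -
  have p: "prime (p i)" if "i < r" for i using d that by (simp add: prime_power_decomposition_def)
  have p': "prime (p' i)" if "i < r'" for i using d' that by (simp add: prime_power_decomposition_def)
  define S where "S = p ` {..<r} \<union> p' ` {..<r'}"
  define B where "B = (\<Sum>i<r. a i) + (\<Sum>i<r'. a' i)"
  have S: "finite S" "p ` {..<r} \<subseteq> S" "p' ` {..<r'} \<subseteq> S" by (auto simp: S_def)
  have B: "a i \<le> B" if "i < r" for i
    using member_le_sum[of i "{..<r}" a] that by (simp add: B_def)
  have B': "a' i \<le> B" if "i < r'" for i
    using member_le_sum[of i "{..<r'}" a'] that by (simp add: B_def)
  have count: "(\<Sum>i\<in>{i. i < r \<and> p i = s}. min b (a i)) = (\<Sum>i\<in>{i. i < r' \<and> p' i = s}. min b (a' i))"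
    if s: "s \<in> S" for s b
  proof -
    have ps: "prime s" using s p p' by (auto simp: S_def)
    have pos: "p i ^ a i > 0" if "i < r" for i using p[OF that] prime_gt_0_nat by simp
    have pos': "p' i ^ a' i > 0" if "i < r'" for i using p'[OF that] prime_gt_0_nat by simp
    have "torsion_count G (s ^ b) = (\<Prod>i<r. gcd (s ^ b) (p i ^ a i))"
    proof -
      have "torsion_count G (s ^ b) =
          torsion_count (sum_group {..<r} (\<lambda>i. integer_mod_group (p i ^ a i))) (s ^ b)"
        by (rule torsion_count_iso[OF G]) (use d in \<open>auto simp: prime_power_decomposition_def\<close>)
      also have "\<dots> = (\<Prod>i<r. gcd (s ^ b) (p i ^ a i))"
        by (rule torsion_count_sum_group) (rule pos)
      finally show ?thesis .
    qed
    moreover have "torsion_count G (s ^ b) = (\<Prod>i<r'. gcd (s ^ b) (p' i ^ a' i))"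
    proof -
      have "torsion_count G (s ^ b) =
          torsion_count (sum_group {..<r'} (\<lambda>i. integer_mod_group (p' i ^ a' i))) (s ^ b)"
        by (rule torsion_count_iso[OF G]) (use d' in \<open>auto simp: prime_power_decomposition_def\<close>)
      also have "\<dots> = (\<Prod>i<r'. gcd (s ^ b) (p' i ^ a' i))"
        by (rule torsion_count_sum_group) (rule pos')
      finally show ?thesis .
    qed
    ultimately have "s ^ (\<Sum>i\<in>{i. i < r \<and> p i = s}. min b (a i)) = s ^ (\<Sum>i\<in>{i. i < r' \<and> p' i = s}. min b (a' i))"
      using prod_gcd_prime_powers[of r p s b a, OF p ps] prod_gcd_prime_powers[of r' p' s b a', OF p' ps]
      by simp
    then show ?thesis using prime_gt_1_nat[OF ps] by simp
  qed
  show ?thesis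
    using decomposition_value_eq[of r p a B S, OF p B S(1,2)]
      decomposition_value_eq[of r' p' a' B S, OF p' B' S(1,3)] count by simp
qed

lemma K1_star_eqI:
  assumes G: "group G" and d: "prime_power_decomposition G r p a" and x: "x = (\<Sum>i<r. geom (p i) 0 (a i))"
  shows "K1_star G = x"
  unfolding K1_star_def
proof (rule the_equality)
  have val: "(\<Sum>i<r. (real (p i) ^ a i - 1) / (real (p i) ^ a i - real (p i) ^ (a i - 1))) = (\<Sum>i<r. geom (p i) 0 (a i))"
    if "prime_power_decomposition G r p a" for r p a
  proof (rule sum.cong[OF refl])
    fix i assume "i \<in> {..<r}"
    then have "prime (p i)" "a i > 0" using that by (simp_all add: prime_power_decomposition_def)
    then show "(real (p i) ^ a i - 1) / (real (p i) ^ a i - real (p i) ^ (a i - 1)) = geom (p i) 0 (a i)"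
      by (rule prime_power_value)
  qed
  show "\<exists>r p \<alpha>. prime_power_decomposition G r p \<alpha> \<and>
     x = (\<Sum>i<r. (real (p i) ^ \<alpha> i - 1) / (real (p i) ^ \<alpha> i - real (p i) ^ (\<alpha> i - 1)))"
    using d unfolding x val[OF d, symmetric] by (intro exI[of _ r] exI[of _ p] exI[of _ a] conjI refl)
  show "y = x" if y: "\<exists>r p \<alpha>. prime_power_decomposition G r p \<alpha> \<and>
     y = (\<Sum>i<r. (real (p i) ^ \<alpha> i - 1) / (real (p i) ^ \<alpha> i - real (p i) ^ (\<alpha> i - 1)))" for y
  proof -
    obtain r' p' a' where d': "prime_power_decomposition G r' p' a'"
      and y': "y = (\<Sum>i<r'. (real (p' i) ^ a' i - 1) / (real (p' i) ^ a' i - real (p' i) ^ (a' i - 1)))"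
      using y by blast
    show ?thesis using decomposition_value_unique[OF G d' d] y' val[OF d'] x by simp
  qed
qed

lemma int_dvd_iff_prime_powers:
  fixes n :: nat
  assumes "n > 0"
  shows "int n dvd x \<longleftrightarrow> (\<forall>p\<in>prime_factors n. int (p ^ multiplicity p n) dvd x)"
proof
  assume "int n dvd x"
  then show "\<forall>p\<in>prime_factors n. int (p ^ multiplicity p n) dvd x"
    using multiplicity_dvd by (metis dvd_trans int_dvd_int_iff)
next
  assume h: "\<forall>p\<in>prime_factors n. int (p ^ multiplicity p n) dvd x"
  show "int n dvd x"
  proof (cases "x = 0")
    case False
    define y where "y = nat \<bar>x\<bar>"
    have y: "int m dvd x \<longleftrightarrow> m dvd y" for m by (simp add: y_def)
    have y0: "y \<noteq> 0" using False by (simp add: y_def)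
    have "n dvd y"
    proof (rule multiplicity_le_imp_dvd)
      show "n \<noteq> 0" using assms by simp
      fix p :: nat assume p: "prime p"
      show "multiplicity p n \<le> multiplicity p y"
      proof (cases "p \<in> prime_factors n")
        case True
        then have "p ^ multiplicity p n dvd y" using h y by blast
        then show ?thesis using y0 p prime_gt_1_nat[OF p] by (intro multiplicity_geI) auto
      next
        case False
        then have "multiplicity p n = 0" using p by (simp add: prime_factors_multiplicity)
        then show ?thesis by simp
      qed
    qed
    then show ?thesis using y by simp
  qed simp
qed

context lattice_realisation
begin

lemma phi_diff_in_lat_iff:
  assumes x: "x \<in> carrier G" and y: "y \<in> carrier G"
  shows "\<phi> x - \<phi> y \<in> lat \<longleftrightarrow> x = y"
proof
  assume h: "\<phi> x - \<phi> y \<in> lat"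
  define z where "z = x \<otimes> inv y"
  have z: "z \<in> carrier G" "z \<otimes> y = x" using x y by (simp_all add: z_def m_assoc)
  have "\<phi> x - (\<phi> z + \<phi> y) \<in> lat" using hom[OF z(1) y] z(2) by simp
  then have "(\<phi> x - \<phi> y) - (\<phi> x - (\<phi> z + \<phi> y)) \<in> lat" by (rule add_subgroup_diff[OF add_subgroup_lat h])
  then have "\<phi> z \<in> lat" by simp
  then have "z = \<one>" using kernel[OF z(1)] by simp
  then show "x = y" using z y by simp
qed simp

text \<open>Reducing the coordinates \<open>c i\<close> modulo the prime powers is a homomorphism,
  injective because these congruences together define \<open>lat\<close>; surjectivity follows by
  counting.\<close>

lemma decompositionI:
  fixes p a :: "nat \<Rightarrow> nat" and c :: "nat \<Rightarrow> int \<times> int \<Rightarrow> int"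
  assumes p: "\<And>i. i < r \<Longrightarrow> prime (p i) \<and> a i > 0"
    and c: "\<And>i u v. c i (u + v) = c i u + c i v"
    and lat: "\<And>v. v \<in> lat \<longleftrightarrow> (\<forall>i<r. int (p i ^ a i) dvd c i v)"
    and card: "card (carrier G) = (\<Prod>i<r. p i ^ a i)"
  shows "prime_power_decomposition G r p a"
proof -
  define P where "P i = p i ^ a i" for i
  let ?S = "sum_group {..<r} (\<lambda>i. integer_mod_group (P i))"
  have P: "P i > 0" if "i < r" for i using p[OF that] prime_gt_0_nat by (simp add: P_def)
  have carrS: "carrier ?S = (\<Pi>\<^sub>E i\<in>{..<r}. {0..<int (P i)})"
    by (rule carrier_sum_integer_mod_group) (rule P)
  define h where "h x = (\<lambda>i\<in>{..<r}. c i (\<phi> x) mod int (P i))" for x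
  have c_diff: "c i (u - v) = c i u - c i v" for i u v
    using c[of i "u - v" v] by simp
  have h_eq: "h x = h y \<longleftrightarrow> (\<forall>i<r. c i (\<phi> x) mod int (P i) = c i (\<phi> y) mod int (P i))" for x y
    by (auto simp: h_def fun_eq_iff restrict_def)
  have h_carr: "h x \<in> carrier ?S" for x
    unfolding carrS h_def by (rule restrict_PiE_iff[THEN iffD2]) (use P in auto)
  have "h \<in> hom G ?S"
  proof (rule homI)
    show "h x \<in> carrier ?S" for x by (rule h_carr)
    show "h (x \<otimes> y) = h x \<otimes>\<^bsub>?S\<^esub> h y" if "x \<in> carrier G" "y \<in> carrier G" for x y
    proof -
      have "c i (\<phi> (x \<otimes> y)) mod int (P i) = (c i (\<phi> x) mod int (P i) + c i (\<phi> y) mod int (P i)) mod int (P i)"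
        if "i < r" for i
      proof -
        have "int (P i) dvd c i (\<phi> (x \<otimes> y) - (\<phi> x + \<phi> y))"
          using hom[OF \<open>x \<in> carrier G\<close> \<open>y \<in> carrier G\<close>] lat that by (simp add: P_def)
        then have "c i (\<phi> (x \<otimes> y)) mod int (P i) = (c i (\<phi> x) + c i (\<phi> y)) mod int (P i)"
          by (simp add: c_diff c mod_eq_dvd_iff)
        then show ?thesis by (simp add: mod_add_eq)
      qed
      then show ?thesis by (auto simp: h_def fun_eq_iff restrict_def)
    qed
  qed
  moreover have inj: "inj_on h (carrier G)"
  proof (rule inj_onI)
    fix x y assume xy: "x \<in> carrier G" "y \<in> carrier G" "h x = h y"
    then have "\<forall>i<r. int (P i) dvd c i (\<phi> x - \<phi> y)"
      unfolding h_eq by (simp add: c_diff mod_eq_dvd_iff)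
    then have "\<phi> x - \<phi> y \<in> lat" using lat by (simp add: P_def)
    then show "x = y" using phi_diff_in_lat_iff xy by simp
  qed
  moreover have "h ` carrier G = carrier ?S"
  proof (rule card_seteq)
    show "finite (carrier ?S)" unfolding carrS by (rule finite_PiE) auto
    show "h ` carrier G \<subseteq> carrier ?S" using h_carr by blast
    have "card (carrier ?S) = (\<Prod>i<r. P i)" unfolding carrS by (subst card_PiE) auto
    then show "card (carrier ?S) \<le> card (h ` carrier G)"
      using card inj by (simp add: card_image P_def)
  qed
  ultimately have "h \<in> iso G ?S" by (simp add: iso_def bij_betw_def)
  then have "G \<cong> ?S" by (auto simp: is_iso_def)
  then show ?thesis using p by (simp add: prime_power_decomposition_def P_def)
qed

text \<open>The first summand splits into its prime powers; a prime \<open>k\<close> adds one more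
  summand at index \<open>r\<close>, with exponent 1 and value 1.\<close>

lemma K1_star_lattice:
  assumes k: "k = 1 \<or> prime k" and card: "card (carrier G) = n * k"
  shows "K1_star G = cyclic_value n + (if k = 1 then 0 else 1)"
proof -
  define r where "r = card (prime_factors n)"
  obtain e where e: "bij_betw e {..<r} (prime_factors n)"
    using ex_bij_betw_nat_finite[of "prime_factors n"] by (auto simp: r_def atLeast0LessThan)
  have e_in: "e i \<in> prime_factors n" if "i < r" for i using e that by (auto simp: bij_betw_def)
  define R where "R = (if k = 1 then r else Suc r)"
  define p where "p i = (if i < r then e i else k)" for i
  define a where "a i = (if i < r then multiplicity (e i) n else 1)" for i
  define c :: "nat \<Rightarrow> int \<times> int \<Rightarrow> int" where "c i = (if i < r then fst else snd)" for i
  have all_e: "(\<forall>i<r. Q (e i)) \<longleftrightarrow> (\<forall>p\<in>prime_factors n. Q p)" for Q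
    using e unfolding bij_betw_def by (metis (no_types, lifting) imageE image_eqI lessThan_iff)
  have "prime_power_decomposition G R p a"
  proof (rule decompositionI[where c = c])
    fix i assume i: "i < R"
    show "prime (p i) \<and> a i > 0"
    proof (cases "i < r")
      case True
      then show ?thesis using e_in[OF True] by (simp add: p_def a_def prime_factors_multiplicity)
    next
      case False
      then show ?thesis using i k by (auto simp: p_def a_def R_def split: if_splits)
    qed
  next
    show "c i (u + v) = c i u + c i v" for i u v by (simp add: c_def)
    have first: "(\<forall>i<r. int (p i ^ a i) dvd c i v) \<longleftrightarrow> int n dvd fst v" for v
      unfolding int_dvd_iff_prime_powers[OF n_pos] all_e[symmetric]
      by (simp add: p_def a_def c_def)
    show "v \<in> lat \<longleftrightarrow> (\<forall>i<R. int (p i ^ a i) dvd c i v)" for v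
    proof (cases "k = 1")
      case True
      then show ?thesis using first[of v] unfolding lat_def by (simp add: R_def)
    next
      case False
      have "(\<forall>i<Suc r. int (p i ^ a i) dvd c i v) \<longleftrightarrow> (\<forall>i<r. int (p i ^ a i) dvd c i v) \<and> int k dvd snd v"
        by (auto simp: less_Suc_eq p_def a_def c_def)
      then show ?thesis using False first[of v] unfolding lat_def by (simp add: R_def)
    qed
    have "(\<Prod>i<r. p i ^ a i) = (\<Prod>i<r. e i ^ multiplicity (e i) n)"
      by (rule prod.cong) (auto simp: p_def a_def)
    also have "\<dots> = (\<Prod>p\<in>prime_factors n. p ^ multiplicity p n)"
      by (rule prod.reindex_bij_betw[OF e])
    also have "\<dots> = n" using prime_factorization_nat[OF n_pos] by simp
    finally have "(\<Prod>i<r. p i ^ a i) = n" .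
    then show "card (carrier G) = (\<Prod>i<R. p i ^ a i)"
      using card by (simp add: R_def p_def a_def)
  qed
  moreover have "cyclic_value n + (if k = 1 then 0 else 1) = (\<Sum>i<R. geom (p i) 0 (a i))"
  proof -
    have "(\<Sum>i<r. geom (p i) 0 (a i)) = (\<Sum>i<r. geom (e i) 0 (multiplicity (e i) n))"
      by (rule sum.cong) (auto simp: p_def a_def)
    also have "\<dots> = cyclic_value n"
      unfolding cyclic_value_def by (rule sum.reindex_bij_betw[OF e])
    finally have "(\<Sum>i<r. geom (p i) 0 (a i)) = cyclic_value n" .
    then show ?thesis by (simp add: R_def p_def a_def geom_def)
  qed
  ultimately show ?thesis by (rule K1_star_eqI[OF is_group])
qed

lemma K1_lattice:
  assumes wide: "two_wide n" and k: "k = 1 \<or> k = largest_prime_factor n"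
  shows "K1 G = cyclic_value n + (if k = 1 then 0 else 1)"
proof (rule K1_eqI)
  have pk: "prime k" if "k \<noteq> 1"
  proof -
    have n1: "n \<noteq> 1" using k that by (auto simp: largest_prime_factor_def)
    then have "prime_factors n \<noteq> {}" using n_pos by (simp add: prime_factorization_empty_iff)
    then have "Max (prime_factors n) \<in> prime_factors n" by (intro Max_in) auto
    then show ?thesis using k that n1 by (auto simp: largest_prime_factor_def)
  qed
  show "attains UNIV (cyclic_value n + (if k = 1 then 0 else 1))"
  proof (cases "k = 1")
    case True
    show ?thesis unfolding if_P[OF True] add_0_right by (rule attains_cyclic_value)
  next
    case False
    show ?thesis unfolding if_not_P[OF False] by (rule attains_rank_two[OF pk[OF False]])
  qed
  fix I :: "('a \<times> nat) set" and f
  assume I: "finite I" "uf lat I f" "\<And>i. i \<in> I \<Longrightarrow> f i \<notin> lat"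
  show "cross I f \<le> cyclic_value n + (if k = 1 then 0 else 1)"
  proof (cases "n = 1")
    case True
    then have "k = 1" using k by (auto simp: largest_prime_factor_def)
    then have "v \<in> lat" for v using True unfolding lat_def by simp
    then have "I = {}" using I(3) by blast
    moreover have "0 \<le> cyclic_value n" unfolding cyclic_value_def by (intro sum_nonneg geom_nonneg)
    ultimately show ?thesis by simp
  next
    case False
    then have "n > 1" using n_pos by simp
    then show ?thesis by (rule two_wide_bound[OF wide _ refl k I])
  qed
qed

end

section \<open>The two groups of the theorem as quotients of the integer pairs\<close>

lemma lattice_realisation_cyclic:
  assumes "n > 0"
  shows "lattice_realisation (integer_mod_group n) n 1 (\<lambda>x. (x, 0)) (\<lambda>v. fst v mod int n)"
proof -
  interpret comm_group "integer_mod_group n" by simp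
  interpret pair_lattice n 1 by unfold_locales (use assms in auto)
  show ?thesis
  proof unfold_locales
    show "finite (carrier (integer_mod_group n))" using assms by (simp add: carrier_integer_mod_group)
    fix x y assume "x \<in> carrier (integer_mod_group n)"
    then have x: "0 \<le> x" "x < int n" using assms by (simp_all add: carrier_integer_mod_group)
    show "(x \<otimes>\<^bsub>integer_mod_group n\<^esub> y, 0) - ((x, 0) + (y, 0)) \<in> pair_lattice.lat n 1"
      unfolding lat_def by (simp add: mod_eq_dvd_iff[symmetric])
    show "(x, 0) \<in> pair_lattice.lat n 1 \<longleftrightarrow> x = \<one>\<^bsub>integer_mod_group n\<^esub>"
      unfolding lat_def using x by (auto dest: zdvd_imp_le)
  next
    fix v :: "int \<times> int"
    show "fst v mod int n \<in> carrier (integer_mod_group n)" using assms by (simp add: carrier_integer_mod_group)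
    show "(fst v mod int n, 0) - v \<in> pair_lattice.lat n 1"
      unfolding lat_def by (simp add: mod_eq_dvd_iff[symmetric])
  qed
qed

lemma lattice_realisation_product:
  assumes "n > 0" "k > 0"
  shows "lattice_realisation (integer_mod_group n \<times>\<times> integer_mod_group k) n k id (\<lambda>v. (fst v mod int n, snd v mod int k))"
proof -
  let ?G = "integer_mod_group n \<times>\<times> integer_mod_group k"
  interpret group ?G by (intro DirProd_group) auto
  interpret comm_group ?G
    by (rule group_comm_groupI) (auto simp: DirProd_def add.commute)
  interpret pair_lattice n k by unfold_locales (use assms in auto)
  show ?thesis
  proof unfold_locales
    show "finite (carrier ?G)" using assms by (simp add: carrier_integer_mod_group)
    fix x y assume "x \<in> carrier ?G"
    then have x: "0 \<le> fst x" "fst x < int n" "0 \<le> snd x" "snd x < int k"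
      using assms by (auto simp: carrier_integer_mod_group)
    show "id (x \<otimes>\<^bsub>?G\<^esub> y) - (id x + id y) \<in> pair_lattice.lat n k"
      by (cases x; cases y) (simp add: lat_def mod_eq_dvd_iff[symmetric])
    show "id x \<in> pair_lattice.lat n k \<longleftrightarrow> x = \<one>\<^bsub>?G\<^esub>"
      using x by (cases x) (auto simp: lat_def dest: zdvd_imp_le)
  next
    fix v :: "int \<times> int"
    show "(fst v mod int n, snd v mod int k) \<in> carrier ?G" using assms by (simp add: carrier_integer_mod_group)
    show "id (fst v mod int n, snd v mod int k) - v \<in> pair_lattice.lat n k"
      by (simp add: lat_def mod_eq_dvd_iff[symmetric])
  qed
qed

theorem corollary11:
  fixes n q :: nat
  assumes "two_wide n"
    and "q = largest_prime_factor n"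
  shows "K1 (integer_mod_group n) = K1_star (integer_mod_group n) \<and>
         K1 (integer_mod_group n \<times>\<times> integer_mod_group q) =
           K1_star (integer_mod_group n \<times>\<times> integer_mod_group q)"
proof
  have n: "n > 0" using assms(1) by (simp add: two_wide_def)
  have q: "q = 1 \<or> prime q"
  proof (cases "n = 1")
    case False
    then have "prime_factors n \<noteq> {}" using n by (simp add: prime_factorization_empty_iff)
    then have "Max (prime_factors n) \<in> prime_factors n" by (intro Max_in) auto
    then show ?thesis using assms(2) False by (auto simp: largest_prime_factor_def)
  qed (use assms(2) in \<open>simp add: largest_prime_factor_def\<close>)
  then have q0: "q > 0" using prime_gt_0_nat by auto
  interpret C: lattice_realisation "integer_mod_group n" n 1 "\<lambda>x. (x, 0)" "\<lambda>v. fst v mod int n"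
    by (rule lattice_realisation_cyclic[OF n])
  interpret D: lattice_realisation "integer_mod_group n \<times>\<times> integer_mod_group q" n q id
      "\<lambda>v. (fst v mod int n, snd v mod int q)"
    by (rule lattice_realisation_product[OF n q0])
  show "K1 (integer_mod_group n) = K1_star (integer_mod_group n)"
    using C.K1_lattice[OF assms(1)] C.K1_star_lattice n by (simp add: carrier_integer_mod_group)
  show "K1 (integer_mod_group n \<times>\<times> integer_mod_group q) = K1_star (integer_mod_group n \<times>\<times> integer_mod_group q)"
    using D.K1_lattice[OF assms(1)] D.K1_star_lattice[OF q] n q0 assms(2)
    by (simp add: carrier_integer_mod_group card_cartesian_product)
qed

end
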